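(* Let $E$ be a compact metric space with Borel $\sigma$-field $\mathcal{A}$, $T:E\to E$ continuous, $\mu$ a $T$-invariant Borel probability measure such that $S=(E,\mathcal{A},\mu,T)$ is uniquely ergodic, $f:E\to[0,1]$ continuous, $x\in E$, $\beta>0$, $J>0$. Let $m_1,\dots,m_r$ be the (finitely many) points where $G$ attains its global minimum, and let $2k_i$ and $\lambda_i>0$ be the type and strength of $m_i$ (the measures $\mathbb{Q}_{n,x}$, the magnetization $M_n$ and the functions $L,G_n,G$ are defined in the context). 1. Assume that for every $i\in\{1,\dots,r\}$ and every $j\in\{1,\dots,2k_i\}$ the function $E\to\mathbb{R}$, $y\mapsto \frac{\partial^j L}{\partial s^j}(f(y),\beta J m_i)$, belongs to $\mathcal{C}_{j/(2k_i)}(S)$. Then, for every bounded continuous function $h:\mathbb{R}\to\mathbb{R}$, the expectation of $h(M_n/n)$ under $\mathbb{Q}_{n,x}$ is equivalent, as $n$ goes to infinity, to $$\frac{\sum_{i=1}^r b_{i,n}\,h(m_i)}{\sum_{i=1}^r b_{i,n}},$$ where $$b_{i,n}=n^{-1/(2k_i)}\,e^{-nG_n(m_i)}\,\lambda_i^{-1/(2k_i)}\int_{-\infty}^{+\infty}\exp\big(-s^{2k_i}/(2k_i)!\big)\,ds .$$ In particular, if $G$ attains its minimum at a unique point $m$, then the distribution of $M_n/n$ under $\mathbb{Q}_{n,x}$ converges to the Dirac mass $\delta_m$ at $m$. 2. The distribution of $M_n/n$ under $\mathbb{Q}_{n,x}$ satisfies a large deviation principle with speed $n$ and good rate function $$I_{\beta,x}(z)=\Lambda^*(z)-\frac{\beta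 J}{2}z^2-\inf_{w\in\mathbb{R}}\Big\{\Lambda^*(w)-\frac{\beta J}{2}w^2\Big\},$$ where $\Lambda^*(z)=\sup_{\lambda\in\mathbb{R}}\{\lambda z-\Lambda(\lambda)\}$ and $\Lambda(\lambda)=\int_E\log\big(f(y)e^{\lambda}+(1-f(y))e^{-\lambda}\big)\,d\mu(y)$.
   Context: Uniquely ergodic: $\mu$ is the only $T$-invariant Borel probability measure on $E$. Gibbs measure: for $n\ge1$, $\mathbb{Q}_{n,x}$ is the probability measure on $\{-1,+1\}^n$ giving $\sigma=(\sigma_1,\dots,\sigma_n)$ a mass proportional to $$\exp\Big(\frac{\beta J}{2n}\Big(\sum_{i=1}^n\sigma_i\Big)^2\Big)\prod_{i=1}^n p_i(\sigma_i),\qquad p_i(1)=f(T^ix),\ p_i(-1)=1-f(T^ix).$$ When $f$ takes values in $(0,1)$ this is the measure proportional to $\exp[H_{n,x}(\sigma)]$ with $H_{n,x}(\sigma)=\frac{\beta J}{2n}(\sum_i\sigma_i)^2+\frac12\sum_{i}\log\big(\frac{f(T^ix)}{1-f(T^ix)}\big)\sigma_i$. The magnetization is $M_n=\sum_{i=1}^n\sigma_i$. Functions: $L(\phi,s)=\log(\phi e^{s}+(1-\phi)e^{-s})$ on $[0,1]\times\mathbb{R}$; $\frac{\partial^j L}{\partial s^j}$ is the $j$-th partial derivative in the second variable. $$G_n(s)=\frac{\beta J}{2}s^2-\frac1n\sum_{i=1}^nL(f(T^ix),\beta Js),\qquad G(s)=\frac{\beta J}{2}s^2-\int_EL(f(y),\beta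 Js)\,d\mu(y).$$ $G$ is real analytic and its set of global minimum points is nonempty and finite. Type and strength: for a global minimum point $m$ of $G$, the type is the (finite, even) integer $2k=\min\{j\ge1: G^{(j)}(m)\ne0\}$ and the strength is $G^{(2k)}(m)>0$. Class $\mathcal{C}_\alpha(S)$, $\alpha\in[0,1]$: the $\mu$-integrable functions $h:E\to\mathbb{R}$ such that for every $y\in E$, $\big|\sum_{k=1}^n\big(h(T^ky)-\int_Eh\,d\mu\big)\big|=o(n^\alpha)$ as $n\to\infty$. Large deviation principle with speed $n$ and good rate function $I$ (lower semicontinuous, with compact level sets): for every Borel set $B$, $-\inf_{B^\circ}I\le\liminf_n\frac1n\log\mathbb{Q}_{n,x}(M_n/n\in B)\le\limsup_n\frac1n\log\mathbb{Q}_{n,x}(M_n/n\in B)\le-\inf_{\bar B}I$.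
   Formalization: "Equivalent" is stated as: the difference tends to 0 for every bounded continuous h, and the ratio tends to 1 when the comparison sequence stays bounded away from 0; the plain ratio claim fails, e.g. for a unique minimum m with h(m)=0 and h>0 elsewhere. *)

theory Defs
  imports "HOL-Probability.Probability" "HOL-Library.Landau_Symbols"
begin

section \<open>Unique ergodicity\<close>

definition invariant_prob :: "('a::topological_space \<Rightarrow> 'a) \<Rightarrow> 'a measure \<Rightarrow> bool" where
  "invariant_prob T \<mu> \<longleftrightarrow>
     prob_space \<mu> \<and> sets \<mu> = sets borel \<and> T \<in> measurable \<mu> \<mu> \<and> distr \<mu> \<mu> T = \<mu>"

definition uniquely_ergodic :: "('a::topological_space \<Rightarrow> 'a) \<Rightarrow> 'a measure \<Rightarrow> bool" where
  "uniquely_ergodic T \<mu> \<longleftrightarrow>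
     invariant_prob T \<mu> \<and> (\<forall>\<nu>. invariant_prob T \<nu> \<longrightarrow> \<nu> = \<mu>)"

text \<open>The bound \<open>o(n\<^sup>\<alpha>)\<close> is required at every point, not uniformly in the point.\<close>

definition class_C ::
  "('a::topological_space \<Rightarrow> 'a) \<Rightarrow> 'a measure \<Rightarrow> real \<Rightarrow> ('a \<Rightarrow> real) set" where
  "class_C T \<mu> \<alpha> = {h. integrable \<mu> h \<and>
     (\<forall>y. (\<lambda>n. \<bar>\<Sum>k=1..n. h ((T ^^ k) y) - (\<integral>z. h z \<partial>\<mu>)\<bar>) \<in> o(\<lambda>n. real n powr \<alpha>))}"


section \<open>The Gibbs measure\<close>

text \<open>A configuration is an extensional function on \<open>{1..n}\<close>; the values \<open>\<plusminus>1\<close> are real numbers.\<close>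

definition spins :: "nat \<Rightarrow> (nat \<Rightarrow> real) set" where
  "spins n = PiE {1..n} (\<lambda>_. {-1, 1})"

definition magnetization :: "nat \<Rightarrow> (nat \<Rightarrow> real) \<Rightarrow> real" where
  "magnetization n \<sigma> = (\<Sum>i=1..n. \<sigma> i)"

definition gibbs_weight ::
  "real \<Rightarrow> real \<Rightarrow> ('a \<Rightarrow> 'a) \<Rightarrow> ('a \<Rightarrow> real) \<Rightarrow> nat \<Rightarrow> 'a \<Rightarrow> (nat \<Rightarrow> real) \<Rightarrow> real" where
  "gibbs_weight \<beta> J T f n x \<sigma> =
     exp (\<beta> * J / (2 * real n) * (\<Sum>i=1..n. \<sigma> i)\<^sup>2) *
     (\<Prod>i=1..n. if \<sigma> i = 1 then f ((T ^^ i) x) else 1 - f ((T ^^ i) x))"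

definition gibbs ::
  "real \<Rightarrow> real \<Rightarrow> ('a \<Rightarrow> 'a) \<Rightarrow> ('a \<Rightarrow> real) \<Rightarrow> nat \<Rightarrow> 'a \<Rightarrow> (nat \<Rightarrow> real) measure" where
  "gibbs \<beta> J T f n x = point_measure (spins n)
     (\<lambda>\<sigma>. ennreal (gibbs_weight \<beta> J T f n x \<sigma> / (\<Sum>\<tau>\<in>spins n. gibbs_weight \<beta> J T f n x \<tau>)))"

definition mean_magnetization_distr ::
  "real \<Rightarrow> real \<Rightarrow> ('a \<Rightarrow> 'a) \<Rightarrow> ('a \<Rightarrow> real) \<Rightarrow> nat \<Rightarrow> 'a \<Rightarrow> real measure" where
  "mean_magnetization_distr \<beta> J T f n x =
     distr (gibbs \<beta> J T f n x) borel (\<lambda>\<sigma>. magnetization n \<sigma> / real n)"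


section \<open>The functions \<open>L\<close>, \<open>G\<^sub>n\<close> and \<open>G\<close>; minima, types and strengths\<close>

definition L_fun :: "real \<Rightarrow> real \<Rightarrow> real" where
  "L_fun \<phi> s = ln (\<phi> * exp s + (1 - \<phi>) * exp (- s))"

definition G_emp ::
  "real \<Rightarrow> real \<Rightarrow> ('a \<Rightarrow> 'a) \<Rightarrow> ('a \<Rightarrow> real) \<Rightarrow> 'a \<Rightarrow> nat \<Rightarrow> real \<Rightarrow> real" where
  "G_emp \<beta> J T f x n s =
     \<beta> * J / 2 * s\<^sup>2 - 1 / real n * (\<Sum>i=1..n. L_fun (f ((T ^^ i) x)) (\<beta> * J * s))"

definition G_lim :: "real \<Rightarrow> real \<Rightarrow> ('a \<Rightarrow> real) \<Rightarrow> 'a measure \<Rightarrow> real \<Rightarrow> real" where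
  "G_lim \<beta> J f \<mu> s = \<beta> * J / 2 * s\<^sup>2 - (\<integral>y. L_fun (f y) (\<beta> * J * s) \<partial>\<mu>)"

definition global_minima :: "(real \<Rightarrow> real) \<Rightarrow> real set" where
  "global_minima g = {m. \<forall>s. g m \<le> g s}"

text \<open>The type is the full even integer \<open>2k\<close>, not \<open>k\<close>.\<close>

definition min_type :: "(real \<Rightarrow> real) \<Rightarrow> real \<Rightarrow> nat" where
  "min_type g m = (LEAST j. 1 \<le> j \<and> (deriv ^^ j) g m \<noteq> 0)"

definition min_strength :: "(real \<Rightarrow> real) \<Rightarrow> real \<Rightarrow> real" where
  "min_strength g m = (deriv ^^ min_type g m) g m"

definition b_weight ::
  "real \<Rightarrow> real \<Rightarrow> ('a \<Rightarrow> 'a) \<Rightarrow> ('a \<Rightarrow> real) \<Rightarrow> 'a measure \<Rightarrow> 'a \<Rightarrow> nat \<Rightarrow> real \<Rightarrow> real" where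
  "b_weight \<beta> J T f \<mu> x n m =
     (let t = min_type (G_lim \<beta> J f \<mu>) m in
        real n powr (- 1 / real t) * exp (- (real n * G_emp \<beta> J T f x n m)) *
        min_strength (G_lim \<beta> J f \<mu>) m powr (- 1 / real t) *
        (\<integral>s. exp (- (s ^ t) / fact t) \<partial>lborel))"


section \<open>Large deviations\<close>

definition ereal_log :: "real \<Rightarrow> ereal" where
  "ereal_log p = (if p = 0 then -\<infinity> else ereal (ln p))"

definition good_rate_function :: "('b::topological_space \<Rightarrow> ereal) \<Rightarrow> bool" where
  "good_rate_function I \<longleftrightarrow>
     (\<forall>z. 0 \<le> I z) \<and> (\<forall>c. open {z. c < I z}) \<and> (\<forall>c::real. compact {z. I z \<le> ereal c})"

definition satisfies_LDP ::
  "(nat \<Rightarrow> 'b::topological_space measure) \<Rightarrow> ('b \<Rightarrow> ereal) \<Rightarrow> bool" where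
  "satisfies_LDP P I \<longleftrightarrow> good_rate_function I \<and>
     (\<forall>B\<in>sets borel.
        - (INF z\<in>interior B. I z)
          \<le> liminf (\<lambda>n. ereal (1 / real n) * ereal_log (measure (P n) B)) \<and>
        limsup (\<lambda>n. ereal (1 / real n) * ereal_log (measure (P n) B))
          \<le> - (INF z\<in>closure B. I z))"

definition Lambda :: "('a \<Rightarrow> real) \<Rightarrow> 'a measure \<Rightarrow> real \<Rightarrow> real" where
  "Lambda f \<mu> l = (\<integral>y. ln (f y * exp l + (1 - f y) * exp (- l)) \<partial>\<mu>)"

text \<open>The Legendre transform takes the value \<open>\<infinity>\<close> outside \<open>[-1,1]\<close>, hence the type \<^typ>\<open>ereal\<close>.\<close>

definition Lambda_star :: "('a \<Rightarrow> real) \<Rightarrow> 'a measure \<Rightarrow> real \<Rightarrow> ereal" where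
  "Lambda_star f \<mu> z = (SUP l. ereal (l * z - Lambda f \<mu> l))"

definition rate_fun :: "real \<Rightarrow> real \<Rightarrow> ('a \<Rightarrow> real) \<Rightarrow> 'a measure \<Rightarrow> real \<Rightarrow> ereal" where
  "rate_fun \<beta> J f \<mu> z =
     Lambda_star f \<mu> z - ereal (\<beta> * J / 2 * z\<^sup>2)
     - (INF w. Lambda_star f \<mu> w - ereal (\<beta> * J / 2 * w\<^sup>2))"

end

theory Submission
  imports Defs
begin

text \<open>
  Weak convergence of the empirical measures of an orbit is obtained without Riesz representation:
  a Tychonoff cluster point of the visit frequencies is a finitely additive \<open>T\<close>-invariant content
  on all subsets of \<open>E\<close>; its regularization is a Borel measure by Caratheodory's theorem, which is
  invariant and hence equal to \<open>\<mu>\<close>. So \<open>G\<^sub>n \<rightarrow> G\<close> at every point.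

  The slope \<open>u\<close> of \<open>L(\<phi>, \<cdot>)\<close> satisfies \<open>u' = 1 - u\<^sup>2\<close>, so the \<open>j\<close>-th derivative of \<open>L\<close> is
  at most \<open>2\<^sup>j j!\<close>; thus \<open>G\<close> is analytic, and being coercive it has finitely many minima,
  all of finite even type. By the Hubbard--Stratonovich transform \<open>M\<^sub>n / n\<close> plus an independent
  Gaussian of variance \<open>1 / (n \<beta> J)\<close> has density proportional to \<open>exp (- n G\<^sub>n)\<close>, and Laplace's
  method at each minimum gives the weights \<open>b\<^sub>i\<^sub>,\<^sub>n\<close>: the hypothesis on the class \<open>C\<close> is
  exactly what makes the Taylor coefficients of \<open>n G\<^sub>n\<close> of order below the type vanish in the limit
  after rescaling.

  For the large deviations, the partition function of the independent spins tilted by \<open>l\<close> grows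
  like \<open>exp (n \<Lambda>(l))\<close>. Exponential Markov bounds and compactness of \<open>[-1, 1]\<close> give the upper bound;
  the lower bound at \<open>\<Lambda>'(l)\<close> follows by tilting, and all other points where \<open>\<Lambda>\<^sup>*\<close> is finite
  are approximated by such points.
\<close>

section \<open>Birkhoff averages under unique ergodicity\<close>

text \<open>Two obstacles shape the proof. The differences G_n(m_i) - G(m_i) tend to 0, but n times
  them is not controlled, so the shares of the weights b_{i,n} in their sum may oscillate with n,
  and no limit of the weighted averages can be expected. Every comparison is therefore made with the
  b_{i,n} themselves, using only that they are positive and that their averages are bounded.
  Moreover, ergodic averages converge at each fixed parameter s, whereas Laplace's method needs
  estimates uniform in s. Near a minimum these come from the Taylor remainder, bounded independently
  of n and s; elsewhere from a Lipschitz bound for the empirical part of G_n and a quadratic lower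
  bound of G_n, both uniform in n. The cluster point argument runs along an arbitrary infinite set
  of bad times: a failure of convergence would survive in the cluster point and contradict its
  domination by \<mu> on closed sets.\<close>

lemma compact_unit_cube: "compact {p :: 'i \<Rightarrow> real. \<forall>i. p i \<in> {0..1}}"
proof -
  have "compactin (product_topology (\<lambda>_::'i. euclideanreal) UNIV) (PiE UNIV (\<lambda>_. {0..1}))"
    by (subst compactin_PiE) auto
  moreover have "PiE UNIV (\<lambda>_::'i. {0..1::real}) = {p. \<forall>i. p i \<in> {0..1}}"
    by auto
  ultimately show ?thesis
    by (simp add: euclidean_product_topology)
qed

text \<open>The index set will consist of all subsets of a space, so a filter takes the place of a
  convergent subsequence. The second conclusion is the working form of clustering: every closed
  relation between coordinates that holds at all late times in \<open>S\<close> passes to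
  \<open>m\<close>.\<close>

lemma cluster_point_unit_cube:
  fixes p :: "nat \<Rightarrow> 'i \<Rightarrow> real"
  assumes S: "infinite S" and p: "\<And>n i. p n i \<in> {0..1}"
  obtains m where "\<And>i. m i \<in> {0..1}"
    and "\<And>C N. closed C \<Longrightarrow> (\<And>n. n \<in> S \<Longrightarrow> n \<ge> N \<Longrightarrow> p n \<in> C) \<Longrightarrow> m \<in> C"
proof -
  define F where "F = filtermap p (inf sequentially (principal S))"
  have "F \<noteq> bot"
    using S by (auto simp: F_def trivial_limit_def eventually_filtermap eventually_inf_principal
        eventually_sequentially infinite_nat_iff_unbounded_le)
  moreover have "eventually (\<lambda>q. q \<in> {p. \<forall>i. p i \<in> {0..1}}) F"
    using p by (auto simp: F_def eventually_filtermap)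
  ultimately obtain m where m: "m \<in> {p. \<forall>i. p i \<in> {0..1}}" "inf (nhds m) F \<noteq> bot"
    using compact_unit_cube[where 'i='i] unfolding compact_filter by blast
  show ?thesis
  proof (rule that)
    show "m i \<in> {0..1}" for i using m by auto
    fix C N assume C: "closed C" and N: "\<And>n. n \<in> S \<Longrightarrow> n \<ge> N \<Longrightarrow> p n \<in> C"
    show "m \<in> C"
    proof (rule ccontr)
      assume "m \<notin> C"
      then have "eventually (\<lambda>q. q \<in> - C) (nhds m)"
        using C by (intro eventually_nhds_in_open) auto
      moreover have "eventually (\<lambda>q. q \<in> C) F"
        unfolding F_def eventually_filtermap eventually_inf_principal
        using eventually_ge_at_top[of N] by eventually_elim (use N in auto)
      ultimately have "eventually (\<lambda>q. False) (inf (nhds m) F)"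
        unfolding eventually_inf by (intro exI[of _ "\<lambda>q. q \<in> - C"] exI[of _ "\<lambda>q. q \<in> C"]) auto
      with m(2) show False by (simp add: trivial_limit_def)
    qed
  qed
qed

section \<open>From a finitely additive content to a Borel measure\<close>

text \<open>By normality the disjoint closed sets \<open>K - V\<close> and \<open>K - W\<close> have
  disjoint open neighbourhoods; removing one of them from \<open>K\<close> leaves one piece. The
  splitting yields finite subadditivity of an inner content on open sets.\<close>

lemma closed_subset_Un_open_split:
  fixes K :: "'a::t4_space set"
  assumes "closed K" "open V" "open W" "K \<subseteq> V \<union> W"
  obtains K1 K2 where "closed K1" "closed K2" "K = K1 \<union> K2" "K1 \<subseteq> V" "K2 \<subseteq> W"
proof -
  have "closed (K - V)" "closed (K - W)" "(K - V) \<inter> (K - W) = {}"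
    using assms by (auto intro: closed_Diff)
  then obtain V' W' where "open V'" "open W'" "K - V \<subseteq> V'" "K - W \<subseteq> W'" "V' \<inter> W' = {}"
    using t4_space by metis
  then show ?thesis
    using that[of "K - V'" "K - W'"] assms by (auto intro: closed_Diff)
qed

text \<open>\<open>m\<close> need not be countably additive, so equality with \<open>m\<close>
  cannot be expected; one inequality on closed sets and one on open sets survive.
  \<open>\<beta>\<close> is the inner content of open sets, \<open>\<mu>\<close> the outer measure
  that it induces, and \<open>\<nu>\<close> the restriction of \<open>\<mu>\<close> to Borel
  sets.\<close>

lemma content_regularization:
  fixes m :: "'a::metric_space set \<Rightarrow> real"
  assumes comp: "compact (UNIV :: 'a set)"
    and nonneg: "\<And>A. 0 \<le> m A"
    and add: "\<And>A B. A \<inter> B = {} \<Longrightarrow> m (A \<union> B) = m A + m B"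
  obtains \<nu> where "sets \<nu> = sets borel" "finite_measure \<nu>"
    and "\<And>K. closed K \<Longrightarrow> m K \<le> measure \<nu> K"
    and "\<And>U t. open U \<Longrightarrow> (\<And>K. closed K \<Longrightarrow> K \<subseteq> U \<Longrightarrow> m K \<le> t) \<Longrightarrow> measure \<nu> U \<le> t"
proof -
  define \<beta> where "\<beta> U = (SUP K\<in>{K. closed K \<and> K \<subseteq> U}. ennreal (m K))" for U
  define \<mu> where "\<mu> A = (INF U\<in>{U. open U \<and> A \<subseteq> U}. \<beta> U)" for A
  have m_empty: "m {} = 0" using add[of "{}" "{}"] by simp
  have m_mono: "m A \<le> m B" if "A \<subseteq> B" for A B
    using add[of A "B - A"] nonneg[of "B - A"] that by (simp add: Un_absorb1)
  have m_sub: "m (A \<union> B) \<le> m A + m B" for A B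
    using add[of A "B - A"] m_mono[of "B - A" B] by simp
  have \<beta>_upper: "ennreal (m K) \<le> \<beta> U" if "closed K" "K \<subseteq> U" for K U
    unfolding \<beta>_def using that by (intro SUP_upper) auto
  have \<beta>_mono: "\<beta> U \<le> \<beta> V" if "U \<subseteq> V" for U V
    unfolding \<beta>_def using that by (intro SUP_subset_mono) auto
  have \<mu>_lower: "\<mu> A \<le> \<beta> U" if "open U" "A \<subseteq> U" for A U
    unfolding \<mu>_def using that by (intro INF_lower) auto
  have \<mu>_open: "\<mu> U = \<beta> U" if "open U" for U
    using that by (intro antisym \<mu>_lower) (auto simp: \<mu>_def intro!: INF_greatest \<beta>_mono)
  have \<mu>_mono: "\<mu> A \<le> \<mu> B" if "A \<subseteq> B" for A B
    unfolding \<mu>_def using that by (intro INF_superset_mono) auto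
  have \<mu>_fin: "\<mu> A \<le> ennreal (m UNIV)" for A
    by (rule order_trans[OF \<mu>_lower[of UNIV]])
       (auto simp: \<beta>_def intro!: SUP_least ennreal_leI m_mono)
  have fin_sub: "ennreal (m K) \<le> (\<Sum>i<N. \<beta> (U i))"
    if "closed K" "\<And>i. open (U i)" "K \<subseteq> (\<Union>i<N. U i)" for K N and U :: "nat \<Rightarrow> 'a set"
    using that
  proof (induction N arbitrary: K)
    case 0
    then show ?case by (simp add: m_empty)
  next
    case (Suc N)
    have "K \<subseteq> (\<Union>i<N. U i) \<union> U N" using Suc.prems(3) by (auto simp: lessThan_Suc)
    moreover have "open (\<Union>i<N. U i)" using Suc.prems by auto
    ultimately obtain K1 K2 where K: "closed K1" "closed K2" "K = K1 \<union> K2"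
      "K1 \<subseteq> (\<Union>i<N. U i)" "K2 \<subseteq> U N"
      using closed_subset_Un_open_split[OF Suc.prems(1) _ Suc.prems(2)[of N]] by metis
    have "ennreal (m K) \<le> ennreal (m K1) + ennreal (m K2)"
      using m_sub[of K1 K2] nonneg K(3) by (metis ennreal_leI ennreal_plus)
    also have "\<dots> \<le> (\<Sum>i<N. \<beta> (U i)) + \<beta> (U N)"
      using K Suc by (intro add_mono \<beta>_upper) auto
    finally show ?case by simp
  qed
  \<comment> \<open>Compactness of the space reduces a countable open cover of a closed set to a
    finite one.\<close>
  have \<beta>_cs: "\<beta> (\<Union>i. U i) \<le> (\<Sum>i. \<beta> (U i))" if U: "\<And>i. open (U i)" for U :: "nat \<Rightarrow> 'a set"
    unfolding \<beta>_def[of "\<Union>i. U i"]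
  proof (rule SUP_least)
    fix K assume "K \<in> {K. closed K \<and> K \<subseteq> (\<Union>i. U i)}"
    then have K: "closed K" "K \<subseteq> (\<Union>i. U i)" by auto
    have "compact K" using compact_Int_closed[OF comp K(1)] by simp
    then obtain I where I: "finite I" "K \<subseteq> (\<Union>i\<in>I. U i)"
      using compactE_image[of K UNIV U] K U by metis
    obtain N where N: "I \<subseteq> {..<N}" using finite_nat_bounded[OF I(1)] by blast
    have "ennreal (m K) \<le> (\<Sum>i<N. \<beta> (U i))"
      using fin_sub[of K U N] K U I N by blast
    also have "\<dots> \<le> (\<Sum>i. \<beta> (U i))" by (rule sum_le_suminf) auto
    finally show "ennreal (m K) \<le> (\<Sum>i. \<beta> (U i))" .
  qed
  interpret PU: sigma_algebra UNIV "Pow UNIV :: 'a set set" by (rule sigma_algebra_Pow)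
  have oms: "outer_measure_space (Pow UNIV) \<mu>"
    unfolding outer_measure_space_def
  proof (intro conjI)
    have "\<beta> {} = 0" unfolding \<beta>_def by (auto simp: m_empty intro!: SUP_eq_const)
    then show "positive (Pow UNIV) \<mu>" by (simp add: positive_def \<mu>_open)
    show "increasing (Pow UNIV) \<mu>" by (auto simp: increasing_def \<mu>_mono)
    show "countably_subadditive (Pow UNIV) \<mu>"
      unfolding countably_subadditive_def
    proof (intro allI impI)
      fix A :: "nat \<Rightarrow> 'a set"
      show "\<mu> (\<Union>i. A i) \<le> (\<Sum>i. \<mu> (A i))"
      proof (rule ennreal_le_epsilon)
        fix e :: real assume e: "0 < e"
        have "\<exists>U. open U \<and> A i \<subseteq> U \<and> \<beta> U \<le> \<mu> (A i) + ennreal (e * (1/2) ^ Suc i)" for i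
        proof -
          have "\<mu> (A i) \<noteq> \<infinity>" using \<mu>_fin[of "A i"] by (auto simp: top_unique)
          then show ?thesis
            using INF_approx_ennreal[of "e * (1/2) ^ Suc i" "\<mu> (A i)" \<beta> "{U. open U \<and> A i \<subseteq> U}"] e
            by (fastforce simp: \<mu>_def)
        qed
        then obtain U where U: "\<And>i. open (U i)" "\<And>i. A i \<subseteq> U i"
          "\<And>i. \<beta> (U i) \<le> \<mu> (A i) + ennreal (e * (1/2) ^ Suc i)" by metis
        have "\<mu> (\<Union>i. A i) \<le> \<beta> (\<Union>i. U i)" using U by (intro \<mu>_lower) auto
        also have "\<dots> \<le> (\<Sum>i. \<beta> (U i))" using \<beta>_cs U by auto
        also have "\<dots> \<le> (\<Sum>i. \<mu> (A i) + ennreal (e * (1/2) ^ Suc i))"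
          using U by (intro suminf_le) auto
        also have "\<dots> = (\<Sum>i. \<mu> (A i)) + (\<Sum>i. ennreal (e * (1/2) ^ Suc i))"
          by (intro suminf_add[symmetric]) auto
        also have "(\<Sum>i. ennreal (e * (1/2) ^ Suc i)) = ennreal e"
          using e sums_mult[OF power_half_series, of e]
          by (intro suminf_ennreal_eq) auto
        finally show "\<mu> (\<Union>i. A i) \<le> (\<Sum>i. \<mu> (A i)) + ennreal e" .
      qed
    qed
  qed
  define L where "L = lambda_system UNIV (Pow UNIV) \<mu>"
  have ms: "measure_space UNIV L \<mu>"
    unfolding L_def by (rule PU.caratheodory_lemma[OF oms])
  have open_L: "V \<in> L" if V: "open V" for V
    unfolding L_def PU.lambda_system_eq
  proof (intro CollectI conjI ballI)
    fix A :: "'a set"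
    show "\<mu> (A \<inter> V) + \<mu> (A - V) = \<mu> A"
    proof (rule antisym)
      show "\<mu> (A \<inter> V) + \<mu> (A - V) \<le> \<mu> A"
        unfolding \<mu>_def[of A]
      proof (rule INF_greatest)
        fix W assume "W \<in> {W. open W \<and> A \<subseteq> W}"
        then have W: "open W" "A \<subseteq> W" by auto
        \<comment> \<open>\<open>W - V\<close> lies in the open set \<open>W - K\<close>. A closed
          \<open>K'\<close> inside \<open>W - K\<close> is disjoint from \<open>K\<close>, so
          additivity of \<open>m\<close> bounds \<open>m K + m K'\<close> by
          \<open>\<beta> W\<close>. The supremum is taken over \<open>K'\<close> here and over
          \<open>K\<close> afterwards.\<close>
        have *: "ennreal (m K) + \<mu> (W - V) \<le> \<beta> W" if K: "closed K" "K \<subseteq> W \<inter> V" for K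
        proof -
          have "ennreal (m K) + \<mu> (W - V) \<le> ennreal (m K) + \<beta> (W - K)"
            using K W by (intro add_mono \<mu>_lower) (auto intro: open_Diff)
          also have "\<dots> = (SUP K'\<in>{K'. closed K' \<and> K' \<subseteq> W - K}. ennreal (m K) + ennreal (m K'))"
            unfolding \<beta>_def by (rule ennreal_SUP_add_right) auto
          also have "\<dots> \<le> \<beta> W"
          proof (rule SUP_least)
            fix K' assume K': "K' \<in> {K'. closed K' \<and> K' \<subseteq> W - K}"
            have "K \<inter> K' = {}" using K' by auto
            then have "ennreal (m K) + ennreal (m K') = ennreal (m (K \<union> K'))"
              using add[of K K'] nonneg by (subst ennreal_plus[symmetric]) auto
            also have "\<dots> \<le> \<beta> W" using K K' by (intro \<beta>_upper) auto
            finally show "ennreal (m K) + ennreal (m K') \<le> \<beta> W" .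
          qed
          finally show ?thesis .
        qed
        have "\<mu> (A \<inter> V) + \<mu> (A - V) \<le> \<beta> (W \<inter> V) + \<mu> (W - V)"
          using W V by (intro add_mono \<mu>_lower \<mu>_mono) auto
        also have "\<dots> = (SUP K\<in>{K. closed K \<and> K \<subseteq> W \<inter> V}. ennreal (m K) + \<mu> (W - V))"
          unfolding \<beta>_def by (intro ennreal_SUP_add_left[symmetric]) auto
        also have "\<dots> \<le> \<beta> W" by (rule SUP_least) (use * in auto)
        finally show "\<mu> (A \<inter> V) + \<mu> (A - V) \<le> \<beta> W" .
      qed
      have "subadditive (Pow UNIV) \<mu>"
        using oms PU.countably_subadditive_subadditive unfolding outer_measure_space_def by blast
      then have "\<mu> ((A \<inter> V) \<union> (A - V)) \<le> \<mu> (A \<inter> V) + \<mu> (A - V)"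
        by (intro subadditiveD) auto
      then show "\<mu> A \<le> \<mu> (A \<inter> V) + \<mu> (A - V)" by (simp add: Int_Diff_Un)
    qed
  qed auto
  have sa: "sigma_algebra UNIV L" using ms by (simp add: measure_space_def)
  have borel_L: "sets borel \<subseteq> L"
    unfolding borel_def
    using sigma_algebra.sigma_sets_subset[OF sa, of "{S. open S}"] open_L by auto
  define \<nu> where "\<nu> = measure_of UNIV (sets (borel :: 'a measure)) \<mu>"
  have msb: "measure_space UNIV (sets (borel :: 'a measure)) \<mu>"
    by (rule measure_down[OF ms _ borel_L]) (metis sets.sigma_algebra_axioms space_borel)
  have sets_\<nu>: "sets \<nu> = sets borel"
    unfolding \<nu>_def by (metis sets.sets_measure_of_eq space_borel)
  have em: "emeasure \<nu> A = \<mu> A" if "A \<in> sets borel" for A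
    unfolding \<nu>_def using msb that
    by (intro emeasure_measure_of_sigma) (auto simp: measure_space_def)
  have fm: "finite_measure \<nu>"
    using em[of UNIV] \<mu>_fin[of UNIV] sets_eq_imp_space_eq[OF sets_\<nu>]
    by (intro finite_measureI) (auto simp: top_unique)
  interpret finite_measure \<nu> by fact
  show ?thesis
  proof (rule that[OF sets_\<nu> fm])
    fix K :: "'a set" assume K: "closed K"
    have "ennreal (m K) \<le> \<mu> K"
      unfolding \<mu>_def using K by (intro INF_greatest \<beta>_upper) auto
    then show "m K \<le> measure \<nu> K"
      using K em[of K] nonneg[of K] by (simp add: emeasure_eq_measure flip: ennreal_le_iff)
  next
    fix U t assume U: "open U" and t: "\<And>K. closed K \<Longrightarrow> K \<subseteq> U \<Longrightarrow> m K \<le> t"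
    have t0: "0 \<le> t" using t[of "{}"] m_empty by simp
    have "\<mu> U \<le> ennreal t"
      unfolding \<mu>_open[OF U] \<beta>_def using t by (intro SUP_least ennreal_leI) auto
    then show "measure \<nu> U \<le> t"
      using U em[of U] t0 by (simp add: emeasure_eq_measure flip: ennreal_le_iff)
  qed
qed

section \<open>Visit frequencies of an orbit and their cluster points\<close>

text \<open>Defined on all subsets, measurable or not, so that each time \<open>n\<close> gives a
  point of a product of unit intervals.\<close>

definition visit_freq :: "('a \<Rightarrow> 'a) \<Rightarrow> 'a \<Rightarrow> nat \<Rightarrow> 'a set \<Rightarrow> real" where
  "visit_freq T x n A = (\<Sum>i=1..n. indicator A ((T ^^ i) x)) / real n"

lemma visit_freq_bounds: "visit_freq T x n A \<in> {0..1}"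
proof -
  have "(\<Sum>i=1..n. indicator A ((T ^^ i) x) :: real) \<le> (\<Sum>i=1..n. 1)"
    by (intro sum_mono) (auto simp: indicator_def)
  then show ?thesis
    by (cases "n = 0") (auto simp: visit_freq_def divide_le_eq intro!: sum_nonneg divide_nonneg_nonneg)
qed

lemma visit_freq_Un:
  assumes "A \<inter> B = {}"
  shows "visit_freq T x n (A \<union> B) = visit_freq T x n A + visit_freq T x n B"
proof -
  have "indicator (A \<union> B) y = (indicator A y + indicator B y :: real)" for y
    using assms by (auto simp: indicator_def)
  then show ?thesis by (simp add: visit_freq_def sum.distrib add_divide_distrib)
qed

text \<open>Shifting the orbit by one step changes only the first and the last term of the sum. The
  bound \<open>1 / n\<close> forces every cluster point to be invariant.\<close>

lemma visit_freq_vimage: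
  assumes "n \<ge> 1"
  shows "\<bar>visit_freq T x n (T -` A) - visit_freq T x n A\<bar> \<le> 1 / real n"
proof -
  have "(\<Sum>i=1..n. indicator (T -` A) ((T ^^ i) x) :: real) = (\<Sum>i=1..n. indicator A ((T ^^ Suc i) x))"
    by (simp add: indicator_def)
  also have "\<dots> = (\<Sum>i=1..n. indicator A ((T ^^ i) x)) + indicator A ((T ^^ Suc n) x) - indicator A ((T ^^ 1) x)"
    using sum.shift_bounds_cl_Suc_ivl[of "\<lambda>i. indicator A ((T ^^ i) x) :: real" 1 n, symmetric]
      sum.atLeast_Suc_atMost[of 1 "Suc n" "\<lambda>i. indicator A ((T ^^ i) x) :: real"]
      sum.cl_ivl_Suc[of "\<lambda>i. indicator A ((T ^^ i) x) :: real" 1 n] assms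
    by simp
  finally have "visit_freq T x n (T -` A) - visit_freq T x n A =
      (indicator A ((T ^^ Suc n) x) - indicator A ((T ^^ 1) x)) / real n"
    by (simp only: visit_freq_def diff_divide_distrib[symmetric] add_diff_cancel_left' add_diff_eq[symmetric])
  then show ?thesis using assms by (auto simp: indicator_def abs_le_iff)
qed

lemma closed_eq_Inter_decseq_open:
  fixes C :: "'a::metric_space set"
  assumes "closed C"
  obtains U where "\<And>n::nat. open (U n)" "decseq U" "(\<Inter>n. U n) = C"
proof (cases "C = {}")
  case True
  then show ?thesis by (intro that[of "\<lambda>_. {}"]) (auto simp: decseq_def)
next
  case False
  define U where "U n = {y. infdist y C < 1 / real (Suc n)}" for n
  show ?thesis
  proof (rule that[of U])
    show "open (U n)" for n
      unfolding U_def by (intro open_Collect_less continuous_intros)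
    show "decseq U"
      by (auto simp: decseq_def U_def intro!: frac_le elim!: less_le_trans)
    have "y \<in> C" if "y \<in> (\<Inter>n. U n)" for y
    proof -
      have "infdist y C \<le> 0"
      proof (rule field_le_epsilon)
        fix e :: real assume "e > 0"
        then obtain n where "inverse (real (Suc n)) < e" using reals_Archimedean by blast
        moreover have "infdist y C < 1 / real (Suc n)" using that by (auto simp: U_def)
        ultimately show "infdist y C \<le> 0 + e" by (simp add: inverse_eq_divide)
      qed
      then show ?thesis
        using in_closed_iff_infdist_zero[OF assms False] infdist_nonneg[of y C] by simp
    qed
    then show "(\<Inter>n. U n) = C" by (auto simp: U_def)
  qed
qed

text \<open>Complements reverse the inequality for closed sets; writing a closed set as a decreasing
  intersection of open sets also gives the original inequality for it. Closed sets form an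
  intersection-stable generator, so equality on them is enough.\<close>

lemma invariant_of_open_superinvariant:
  fixes \<nu> :: "'a::metric_space measure"
  assumes \<nu>: "prob_space \<nu>" "sets \<nu> = sets borel" and T: "continuous_on UNIV T"
    and le: "\<And>U. open U \<Longrightarrow> measure \<nu> U \<le> measure \<nu> (T -` U)"
  shows "invariant_prob T \<nu>"
proof -
  interpret prob_space \<nu> by fact
  have sp: "space \<nu> = UNIV" using sets_eq_imp_space_eq[OF \<nu>(2)] by simp
  have Tm: "T \<in> measurable \<nu> \<nu>"
    using borel_measurable_continuous_onI[OF T] measurable_cong_sets[OF \<nu>(2) \<nu>(2)] by auto
  have vim: "open (T -` U)" if "open U" for U
    using T that by (simp add: continuous_on_open_vimage)
  have closed_eq: "measure \<nu> (T -` C) = measure \<nu> C" if C: "closed C" for C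
  proof (rule antisym)
    have "measure \<nu> (- C) \<le> measure \<nu> (T -` (- C))" using C le by auto
    moreover have "C \<in> sets \<nu>" "T -` C \<in> sets \<nu>"
      using C vim[of "- C"] \<nu>(2) by (auto simp: vimage_Compl closed_def[symmetric] borel_closed)
    ultimately show "measure \<nu> (T -` C) \<le> measure \<nu> C"
      using prob_compl[of C] prob_compl[of "T -` C"] sp
      by (simp add: vimage_Compl Compl_eq_Diff_UNIV vimage_Diff)
    obtain U where U: "\<And>n::nat. open (U n)" "decseq U" "(\<Inter>n. U n) = C"
      using closed_eq_Inter_decseq_open[OF C] by metis
    have "decseq (\<lambda>n. T -` U n)" using U(2) unfolding decseq_def by blast
    have "(\<lambda>n. measure \<nu> (U n)) \<longlonglongrightarrow> measure \<nu> (\<Inter>n. U n)"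
      using U \<nu>(2) by (intro finite_Lim_measure_decseq) auto
    moreover have "(\<lambda>n. measure \<nu> (T -` U n)) \<longlonglongrightarrow> measure \<nu> (\<Inter>n. T -` U n)"
      using U \<nu>(2) vim \<open>decseq (\<lambda>n. T -` U n)\<close> by (intro finite_Lim_measure_decseq) auto
    ultimately have "measure \<nu> (\<Inter>n. U n) \<le> measure \<nu> (\<Inter>n. T -` U n)"
      using le U by (intro LIMSEQ_le) auto
    also have "(\<Inter>n. T -` U n) = T -` C" using U(3) by auto
    finally show "measure \<nu> C \<le> measure \<nu> (T -` C)" using U(3) by simp
  qed
  have "distr \<nu> \<nu> T = \<nu>"
  proof (rule measure_eqI_generator_eq[where \<Omega> = UNIV and E = "{S. closed S}" and A = "\<lambda>_. UNIV"])
    show "Int_stable {S :: 'a set. closed S}" by (auto simp: Int_stable_def)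
    show "sets (distr \<nu> \<nu> T) = sigma_sets UNIV {S. closed S}"
      using \<nu>(2) by (simp add: borel_eq_closed)
    show "sets \<nu> = sigma_sets UNIV {S. closed S}"
      using \<nu>(2) by (simp add: borel_eq_closed)
    show "emeasure (distr \<nu> \<nu> T) X = emeasure \<nu> X" if "X \<in> {S. closed S}" for X
      using that closed_eq[of X] \<nu>(2) Tm sp
      by (simp add: emeasure_distr emeasure_eq_measure)
    show "emeasure (distr \<nu> \<nu> T) UNIV \<noteq> \<infinity>" for i :: nat
      using Tm \<nu>(2) by (simp add: emeasure_distr emeasure_eq_measure)
  qed auto
  then show ?thesis using \<nu> Tm by (simp add: invariant_prob_def)
qed

text \<open>Between \<open>m\<close> and its regularization only inequalities are available, and
  invariance is reached through them: for closed \<open>K\<close> inside open \<open>U\<close>,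
  \<open>m K\<close> equals \<open>m\<close> of the preimage of \<open>K\<close>, hence is at most
  the measure of the preimage of \<open>U\<close>; letting \<open>K\<close> vary bounds the measure
  of \<open>U\<close>. Unique ergodicity then identifies the regularization with
  \<open>\<mu>\<close>.\<close>

lemma visit_freq_cluster_point:
  fixes T :: "'a::metric_space \<Rightarrow> 'a"
  assumes comp: "compact (UNIV :: 'a set)" and T: "continuous_on UNIV T"
    and ue: "uniquely_ergodic T \<mu>" and S: "infinite S"
  obtains m where "\<And>K. closed K \<Longrightarrow> m K \<le> measure \<mu> K"
    and "\<And>C N. closed C \<Longrightarrow> (\<And>n. n \<in> S \<Longrightarrow> n \<ge> N \<Longrightarrow> visit_freq T x n \<in> C) \<Longrightarrow> m \<in> C"
proof -
  obtain m where m01: "\<And>A. m A \<in> {0..1}" and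
    mC: "\<And>C N. closed C \<Longrightarrow> (\<And>n. n \<in> S \<Longrightarrow> n \<ge> N \<Longrightarrow> visit_freq T x n \<in> C) \<Longrightarrow> m \<in> C"
    using cluster_point_unit_cube[OF S, of "visit_freq T x"] visit_freq_bounds by metis
  have add: "m (A \<union> B) = m A + m B" if "A \<inter> B = {}" for A B
  proof -
    have "m \<in> {p. p (A \<union> B) = p A + p B}"
      using visit_freq_Un[OF that]
      by (intro mC closed_Collect_eq continuous_intros continuous_on_product_coordinates) auto
    then show ?thesis by simp
  qed
  have inv: "m (T -` A) = m A" for A
  proof -
    have "\<bar>m (T -` A) - m A\<bar> \<le> 1 / real (Suc N)" for N
    proof -
      have "m \<in> {p. \<bar>p (T -` A) - p A\<bar> \<le> 1 / real (Suc N)}"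
      proof (rule mC[where N = "Suc N"])
        show "closed {p :: 'a set \<Rightarrow> real. \<bar>p (T -` A) - p A\<bar> \<le> 1 / real (Suc N)}"
          by (intro closed_Collect_le continuous_intros continuous_on_product_coordinates)
        fix n assume n: "n \<ge> Suc N"
        have "\<bar>visit_freq T x n (T -` A) - visit_freq T x n A\<bar> \<le> 1 / real n"
          using n by (intro visit_freq_vimage) auto
        also have "\<dots> \<le> 1 / real (Suc N)" using n by (intro frac_le) auto
        finally show "visit_freq T x n \<in> {p. \<bar>p (T -` A) - p A\<bar> \<le> 1 / real (Suc N)}" by simp
      qed
      then show ?thesis by simp
    qed
    moreover have "(\<lambda>N. 1 / real (Suc N)) \<longlonglongrightarrow> 0" by (rule LIMSEQ_Suc[OF lim_1_over_n])
    ultimately have "\<bar>m (T -` A) - m A\<bar> \<le> 0" by (intro LIMSEQ_le_const) auto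
    then show ?thesis by simp
  qed
  \<comment> \<open>At \<open>n = 0\<close> the frequency is \<open>0 / 0 = 0\<close>, hence the
    start at \<open>N = 1\<close>.\<close>
  have m1: "m UNIV = 1"
  proof -
    have "m \<in> {p. p UNIV = 1}"
      by (rule mC[where N = 1])
         (auto intro!: closed_Collect_eq continuous_intros continuous_on_product_coordinates
            simp: visit_freq_def)
    then show ?thesis by simp
  qed
  obtain \<nu> where \<nu>: "sets \<nu> = sets borel" "finite_measure \<nu>"
    and ge: "\<And>K. closed K \<Longrightarrow> m K \<le> measure \<nu> K"
    and le: "\<And>U t. open U \<Longrightarrow> (\<And>K. closed K \<Longrightarrow> K \<subseteq> U \<Longrightarrow> m K \<le> t) \<Longrightarrow> measure \<nu> U \<le> t"
    using content_regularization[OF comp _ add] m01 by (metis atLeastAtMost_iff)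
  interpret finite_measure \<nu> by fact
  have sp: "space \<nu> = UNIV" using sets_eq_imp_space_eq[OF \<nu>(1)] by simp
  have "measure \<nu> UNIV = 1"
    using ge[of UNIV] le[of UNIV 1] m1 m01 by (auto intro!: antisym)
  then have "prob_space \<nu>" using sp by (intro prob_spaceI) (simp add: emeasure_eq_measure)
  moreover have "measure \<nu> U \<le> measure \<nu> (T -` U)" if U: "open U" for U
  proof (rule le[OF U])
    fix K assume K: "closed K" "K \<subseteq> U"
    have cl: "closed (T -` K)"
      using T K(1) by (simp add: continuous_on_closed_vimage)
    have "m K = m (T -` K)" by (simp add: inv)
    also have "\<dots> \<le> measure \<nu> (T -` K)" using ge[OF cl] .
    also have "\<dots> \<le> measure \<nu> (T -` U)"
    proof (rule finite_measure_mono)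
      show "T -` U \<in> sets \<nu>" using T U \<nu>(1) by (simp add: continuous_on_open_vimage)
    qed (use K in auto)
    finally show "m K \<le> measure \<nu> (T -` U)" .
  qed
  ultimately have "invariant_prob T \<nu>" by (intro invariant_of_open_superinvariant \<nu> T)
  then have "\<nu> = \<mu>" using ue by (simp add: uniquely_ergodic_def)
  then show ?thesis using that ge mC by blast
qed

section \<open>From closed sets to continuous functions\<close>

text \<open>With \<open>q\<close> the integer part of \<open>v * N\<close>, exactly the
  \<open>q + 1\<close> indices up to \<open>q\<close> are counted; \<open>v < 1\<close> gives
  \<open>q < N\<close>, so none of them is cut off.\<close>

lemma floor_layers:
  fixes v :: real
  assumes "0 \<le> v" "v < 1" "N > 0"
  shows "v \<le> (\<Sum>k<N. of_bool (real k / real N \<le> v)) / real N"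
    and "(\<Sum>k<N. of_bool (real k / real N \<le> v)) / real N \<le> v + 1 / real N"
proof -
  define q where "q = nat \<lfloor>v * real N\<rfloor>"
  have q: "real q \<le> v * real N" "v * real N < real q + 1"
    unfolding q_def using assms by (auto simp: of_nat_nat)
  have "q < N"
  proof -
    have "v * real N < real N" using assms by simp
    with \<open>real q \<le> v * real N\<close> show ?thesis by linarith
  qed
  moreover have "{k. k < N \<and> real k / real N \<le> v} = {..q}"
  proof -
    have "real k / real N \<le> v \<longleftrightarrow> k \<le> q" for k
    proof -
      have "real k / real N \<le> v \<longleftrightarrow> real k \<le> v * real N"
        using assms by (simp add: divide_le_eq)
      also have "\<dots> \<longleftrightarrow> k \<le> q"
        using q by linarith
      finally show ?thesis .
    qed
    with \<open>q < N\<close> show ?thesis by auto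
  qed
  moreover have "(\<Sum>k<N. of_bool (real k / real N \<le> v) :: real) = real (card {k. k < N \<and> real k / real N \<le> v})"
    by (subst sum_of_bool_eq) (auto simp: Int_def conj_commute)
  ultimately show "v \<le> (\<Sum>k<N. of_bool (real k / real N \<le> v)) / real N"
    "(\<Sum>k<N. of_bool (real k / real N \<le> v)) / real N \<le> v + 1 / real N"
    using assms q by (auto simp: field_simps)
qed

text \<open>Superlevel sets of a continuous function are closed, and there
  \<open>m K \<le> measure \<mu> K\<close> points in the direction of an upper bound. The lower
  bound will come from applying this to the negative of the function.\<close>

lemma birkhoff_upper:
  fixes T :: "'a::metric_space \<Rightarrow> 'a" and g :: "'a \<Rightarrow> real"
  assumes comp: "compact (UNIV :: 'a set)" and T: "continuous_on UNIV T"
    and ue: "uniquely_ergodic T \<mu>" and g: "continuous_on UNIV g"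
    and g01: "\<And>y. 0 \<le> g y \<and> g y < 1" and e: "e > 0"
  shows "eventually (\<lambda>n. (\<Sum>i=1..n. g ((T ^^ i) x)) / real n < (\<integral>y. g y \<partial>\<mu>) + e) sequentially"
proof (rule ccontr)
  assume neg: "\<not> ?thesis"
  have pm: "prob_space \<mu>" "sets \<mu> = sets borel"
    using ue by (auto simp: uniquely_ergodic_def invariant_prob_def)
  interpret prob_space \<mu> by fact
  have gm: "g \<in> borel_measurable \<mu>"
    using borel_measurable_continuous_onI[OF g] measurable_cong_sets[OF pm(2) refl] by auto
  have gi: "integrable \<mu> g"
    using g01 by (intro integrable_const_bound[of _ 1] gm) (auto simp: abs_le_iff less_imp_le intro: order_trans)
  \<comment> \<open>The times at which the bound fails; the cluster point is taken along
    them.\<close>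
  define S where "S = {n. (\<Sum>i=1..n. g ((T ^^ i) x)) / real n \<ge> (\<integral>y. g y \<partial>\<mu>) + e}"
  have "infinite S"
    using neg unfolding S_def eventually_sequentially infinite_nat_iff_unbounded_le
    by (auto simp: not_less)
  then obtain m where mle: "\<And>K. closed K \<Longrightarrow> m K \<le> measure \<mu> K"
    and mC: "\<And>C N. closed C \<Longrightarrow> (\<And>n. n \<in> S \<Longrightarrow> n \<ge> N \<Longrightarrow> visit_freq T x n \<in> C) \<Longrightarrow> m \<in> C"
    using visit_freq_cluster_point[OF comp T ue, of S x] by metis
  obtain N where N: "N > 0" "1 / real N < e"
    using real_arch_inverse[of e] e by (auto simp: inverse_eq_divide)
  define K where "K k = {y. real k / real N \<le> g y}" for k
  have clK: "closed (K k)" for k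
    unfolding K_def by (intro closed_Collect_le continuous_intros g)
  have Ki: "integrable \<mu> (indicator (K k) :: _ \<Rightarrow> real)" for k
    using clK[of k] pm(2) by (auto simp: borel_closed emeasure_eq_measure intro!: integrable_real_indicator)
  have layer: "g y \<le> (\<Sum>k<N. indicator (K k) y) / real N"
    "(\<Sum>k<N. indicator (K k) y) / real N \<le> g y + 1 / real N" for y
    using floor_layers[of "g y" N] g01[of y] N by (auto simp: K_def indicator_def of_bool_def)
  have "m \<in> {p. (\<integral>y. g y \<partial>\<mu>) + e \<le> (\<Sum>k<N. p (K k)) / real N}"
  proof (rule mC[of _ 0])
    show "closed {p :: 'a set \<Rightarrow> real. (\<integral>y. g y \<partial>\<mu>) + e \<le> (\<Sum>k<N. p (K k)) / real N}"
      by (intro closed_Collect_le continuous_intros continuous_on_product_coordinates) (use N in auto)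
    fix n assume "n \<in> S"
    then have "(\<integral>y. g y \<partial>\<mu>) + e \<le> (\<Sum>i=1..n. g ((T ^^ i) x)) / real n" by (simp add: S_def)
    also have "\<dots> \<le> (\<Sum>i=1..n. (\<Sum>k<N. indicator (K k) ((T ^^ i) x)) / real N) / real n"
      by (intro divide_right_mono sum_mono layer) auto
    also have "\<dots> = (\<Sum>k<N. visit_freq T x n (K k)) / real N"
      unfolding visit_freq_def sum_divide_distrib[symmetric]
      by (subst sum.swap) (simp add: mult.commute)
    finally show "visit_freq T x n \<in> {p. (\<integral>y. g y \<partial>\<mu>) + e \<le> (\<Sum>k<N. p (K k)) / real N}" by simp
  qed
  then have "(\<integral>y. g y \<partial>\<mu>) + e \<le> (\<Sum>k<N. m (K k)) / real N" by simp
  also have "\<dots> \<le> (\<Sum>k<N. measure \<mu> (K k)) / real N"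
    by (intro divide_right_mono sum_mono mle clK) auto
  also have "\<dots> = (\<integral>y. (\<Sum>k<N. indicator (K k) y) / real N \<partial>\<mu>)"
    using Ki sets_eq_imp_space_eq[OF pm(2)] by (simp add: Bochner_Integration.integral_sum)
  also have "\<dots> \<le> (\<integral>y. g y + 1 / real N \<partial>\<mu>)"
  proof (rule integral_mono)
    show "integrable \<mu> (\<lambda>y. g y + 1 / real N)" using gi by simp
    show "integrable \<mu> (\<lambda>y. (\<Sum>k<N. indicator (K k) y) / real N)"
      by (intro integrable_divide Bochner_Integration.integrable_sum Ki)
  qed (use layer in auto)
  also have "\<dots> = (\<integral>y. g y \<partial>\<mu>) + 1 / real N"
    using gi by (simp add: prob_space)
  finally show False using N by simp
qed

theorem uniquely_ergodic_birkhoff: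
  fixes T :: "'a::metric_space \<Rightarrow> 'a" and g :: "'a \<Rightarrow> real"
  assumes comp: "compact (UNIV :: 'a set)" and T: "continuous_on UNIV T"
    and ue: "uniquely_ergodic T \<mu>" and g: "continuous_on UNIV g"
  shows "(\<lambda>n. (\<Sum>i=1..n. g ((T ^^ i) x)) / real n) \<longlonglongrightarrow> (\<integral>y. g y \<partial>\<mu>)"
proof -
  have pm: "prob_space \<mu>" "sets \<mu> = sets borel"
    using ue by (auto simp: uniquely_ergodic_def invariant_prob_def)
  interpret prob_space \<mu> by fact
  have "bounded (range g)" using compact_continuous_image[OF g comp] compact_imp_bounded by blast
  then obtain B0 where B0: "\<And>y. \<bar>g y\<bar> \<le> B0" by (auto simp: bounded_iff)
  define B where "B = \<bar>B0\<bar> + 1"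
  have B: "B > 0" "\<bar>g y\<bar> < B" for y using B0[of y] by (auto simp: B_def)
  have gm: "g \<in> borel_measurable \<mu>"
    using borel_measurable_continuous_onI[OF g] measurable_cong_sets[OF pm(2) refl] by auto
  have gi: "integrable \<mu> g"
    using B by (intro integrable_const_bound[of _ B] gm) (auto intro: less_imp_le)
  have *: "eventually (\<lambda>n. (\<Sum>i=1..n. s * g ((T ^^ i) x)) / real n < (\<integral>y. s * g y \<partial>\<mu>) + e) sequentially"
    if s: "\<bar>s\<bar> = 1" and e: "e > 0" for s e :: real
  proof -
    \<comment> \<open>An affine image of \<open>g\<close> or \<open>- g\<close> with values in the
      half-open unit interval required by the layers; the error is rescaled by the same factor
      \<open>2 * B\<close>.\<close>
    define g' where "g' y = (s * g y + B) / (2 * B)" for y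
    have sg: "\<bar>s * g y\<bar> < B" for y using B s by (simp add: abs_mult)
    have g'01: "0 \<le> g' y \<and> g' y < 1" for y
      using sg[of y] B(1) by (auto simp: g'_def field_simps abs_less_iff)
    have "eventually (\<lambda>n. (\<Sum>i=1..n. g' ((T ^^ i) x)) / real n < (\<integral>y. g' y \<partial>\<mu>) + e / (2 * B)) sequentially"
      using e B unfolding g'_def
      by (intro birkhoff_upper[OF comp T ue _ g'01[unfolded g'_def]] continuous_intros g) auto
    then show ?thesis using eventually_gt_at_top[of 0]
    proof eventually_elim
      case (elim n)
      have "(\<Sum>i=1..n. g' ((T ^^ i) x)) / real n = ((\<Sum>i=1..n. s * g ((T ^^ i) x)) / real n + B) / (2 * B)"
        using elim(2) B(1) unfolding g'_def sum_divide_distrib[symmetric] sum.distrib by (simp add: field_simps)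
      moreover have "(\<integral>y. g' y \<partial>\<mu>) = ((\<integral>y. s * g y \<partial>\<mu>) + B) / (2 * B)"
        using gi by (simp add: g'_def prob_space)
      ultimately have "((\<Sum>i=1..n. s * g ((T ^^ i) x)) / real n + B) / (2 * B)
          < ((\<integral>y. s * g y \<partial>\<mu>) + B + e) / (2 * B)"
        using elim(1) by (simp add: add_divide_distrib)
      then show ?case using B(1) by (simp add: divide_less_cancel)
    qed
  qed
  show ?thesis
  proof (rule LIMSEQ_I)
    fix e :: real assume e: "e > 0"
    have "eventually (\<lambda>n. norm ((\<Sum>i=1..n. g ((T ^^ i) x)) / real n - (\<integral>y. g y \<partial>\<mu>)) < e) sequentially"
      using *[of 1 e, simplified, OF e] *[of "-1" e, simplified, OF e]
      by eventually_elim (auto simp: abs_less_iff sum_negf)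
    then show "\<exists>no. \<forall>n\<ge>no. norm ((\<Sum>i=1..n. g ((T ^^ i) x)) / real n - (\<integral>y. g y \<partial>\<mu>)) < e"
      by (simp add: eventually_sequentially)
  qed
qed

section \<open>Derivatives of \<open>L\<close>\<close>

text \<open>The mean of one spin under its law tilted by \<open>s\<close>. For \<open>\<phi>\<close>
  strictly between 0 and 1 it equals \<open>tanh (s + ln (\<phi> / (1 - \<phi>)) / 2)\<close>; at
  the end points it is constantly -1 or 1.\<close>

definition L_slope :: "real \<Rightarrow> real \<Rightarrow> real" where
  "L_slope \<phi> s = (\<phi> * exp s - (1 - \<phi>) * exp (- s)) / (\<phi> * exp s + (1 - \<phi>) * exp (- s))"

lemma spin_mgf_pos:
  fixes \<phi> s :: real
  assumes "\<phi> \<in> {0..1}"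
  shows "0 < \<phi> * exp s + (1 - \<phi>) * exp (- s)"
proof (cases "\<phi> = 0")
  case False
  then show ?thesis using assms by (intro add_pos_nonneg) auto
qed auto

lemma L_slope_bound:
  assumes "\<phi> \<in> {0..1}" shows "\<bar>L_slope \<phi> s\<bar> \<le> 1"
proof -
  have "\<bar>\<phi> * exp s - (1 - \<phi>) * exp (- s)\<bar> \<le> \<phi> * exp s + (1 - \<phi>) * exp (- s)"
    using assms abs_triangle_ineq4[of "\<phi> * exp s" "(1 - \<phi>) * exp (- s)"] by (simp add: abs_mult)
  then show ?thesis
    using spin_mgf_pos[OF assms, of s] by (simp add: L_slope_def abs_divide divide_le_eq)
qed

lemma L_fun_deriv:
  assumes "\<phi> \<in> {0..1}"
  shows "(L_fun \<phi> has_real_derivative L_slope \<phi> s) (at s)"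
  unfolding L_fun_def[abs_def] L_slope_def using spin_mgf_pos[OF assms, of s]
  by (auto intro!: derivative_eq_intros)

lemma L_slope_deriv:
  assumes "\<phi> \<in> {0..1}"
  shows "(L_slope \<phi> has_real_derivative 1 - (L_slope \<phi> s)\<^sup>2) (at s)"
proof -
  define a b where "a s = \<phi> * exp s - (1 - \<phi>) * exp (- s)" and "b s = \<phi> * exp s + (1 - \<phi>) * exp (- s)" for s
  have "b s > 0" using spin_mgf_pos[OF assms] by (simp add: b_def)
  have "(a has_real_derivative b s) (at s)" "(b has_real_derivative a s) (at s)"
    unfolding a_def[abs_def] b_def[abs_def] by (auto intro!: derivative_eq_intros)
  then have "((\<lambda>s. a s / b s) has_real_derivative (b s * b s - a s * a s) / (b s * b s)) (at s)"
    using \<open>b s > 0\<close> by (intro DERIV_divide) auto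
  moreover have "(b s * b s - a s * a s) / (b s * b s) = 1 - (a s / b s)\<^sup>2"
    using \<open>b s > 0\<close> by (simp add: field_simps power2_eq_square)
  moreover have "L_slope \<phi> = (\<lambda>s. a s / b s)" by (auto simp: L_slope_def a_def b_def)
  ultimately show ?thesis by simp
qed

lemma L_fun_bound:
  assumes "\<phi> \<in> {0..1}" shows "\<bar>L_fun \<phi> s\<bar> \<le> \<bar>s\<bar>"
proof -
  have "\<phi> * exp s + (1 - \<phi>) * exp (- s) \<le> \<phi> * exp \<bar>s\<bar> + (1 - \<phi>) * exp \<bar>s\<bar>"
    using assms by (intro add_mono mult_left_mono) auto
  then have 1: "\<phi> * exp s + (1 - \<phi>) * exp (- s) \<le> exp \<bar>s\<bar>" by (simp add: algebra_simps)
  have "\<phi> * exp (-\<bar>s\<bar>) + (1 - \<phi>) * exp (-\<bar>s\<bar>) \<le> \<phi> * exp s + (1 - \<phi>) * exp (- s)"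
    using assms by (intro add_mono mult_left_mono) auto
  then have 2: "exp (-\<bar>s\<bar>) \<le> \<phi> * exp s + (1 - \<phi>) * exp (- s)" by (simp add: algebra_simps)
  show ?thesis
    using ln_mono[OF 1] ln_mono[OF 2] spin_mgf_pos[OF assms, of s]
    unfolding L_fun_def by (auto simp: abs_le_iff)
qed

text \<open>The slope \<open>u\<close> of \<open>L\<close> solves \<open>u' = 1 - u\<^sup>2\<close>, so \<open>(u\<^sup>k)' = k (u\<^sup>k\<^sup>-\<^sup>1 - u\<^sup>k\<^sup>+\<^sup>1)\<close>;
  \<open>pow_deriv j k u\<close> is the \<open>j\<close>-th derivative of \<open>u\<^sup>k\<close>.\<close>

fun pow_deriv :: "nat \<Rightarrow> nat \<Rightarrow> real \<Rightarrow> real" where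
  "pow_deriv 0 k v = v ^ k"
| "pow_deriv (Suc j) k v = real k * (pow_deriv j (k - 1) v - pow_deriv j (k + 1) v)"

text \<open>The Pochhammer symbol fits the recursion because
  \<open>k * pochhammer (k + 1) j = pochhammer k (Suc j)\<close>. Both terms are bounded by the one
  with \<open>k + 1\<close>, which costs a factor 2 per order. At \<open>k = 0\<close> the truncated
  \<open>k - 1\<close> is harmless, since the factor \<open>k\<close> vanishes.\<close>

lemma pow_deriv_bound:
  assumes "\<bar>v\<bar> \<le> 1" shows "\<bar>pow_deriv j k v\<bar> \<le> 2 ^ j * pochhammer (real k) j"
proof (induction j arbitrary: k)
  case 0
  then show ?case using power_le_one[of "\<bar>v\<bar>" k] assms by (simp add: power_abs)
next
  case (Suc j)
  show ?case
  proof (cases k)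
    case 0
    then show ?thesis by (simp add: pochhammer_0_left)
  next
    case (Suc i)
    have mono: "pochhammer (real i) j \<le> pochhammer (real (i + 2)) j"
      unfolding pochhammer_prod by (intro prod_mono) auto
    have "\<bar>pow_deriv j i v - pow_deriv j (i + 2) v\<bar> \<le> 2 ^ j * pochhammer (real i) j + 2 ^ j * pochhammer (real (i + 2)) j"
      using Suc.IH[of i] Suc.IH[of "i + 2"] by linarith
    also have "\<dots> \<le> 2 ^ Suc j * pochhammer (real (i + 2)) j"
      using mult_left_mono[OF mono, of "2 ^ j"] by simp
    finally have "real k * \<bar>pow_deriv j i v - pow_deriv j (i + 2) v\<bar> \<le>
        real k * (2 ^ Suc j * pochhammer (real (i + 2)) j)"
      by (intro mult_left_mono) auto
    moreover have "\<bar>pow_deriv (Suc j) k v\<bar> = real k * \<bar>pow_deriv j i v - pow_deriv j (i + 2) v\<bar>"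
      using Suc by (simp add: abs_mult)
    moreover have "real k * (2 ^ Suc j * pochhammer (real (i + 2)) j) = 2 ^ Suc j * pochhammer (real k) (Suc j)"
      using Suc by (simp add: pochhammer_rec add_ac)
    ultimately show ?thesis by linarith
  qed
qed

lemma continuous_on_pow_deriv [continuous_intros]:
  "continuous_on A h \<Longrightarrow> continuous_on A (\<lambda>x. pow_deriv j k (h x))"
  by (induction j arbitrary: k) (auto intro!: continuous_intros)

lemma pow_deriv_L_slope:
  assumes "\<phi> \<in> {0..1}"
  shows "((\<lambda>s. pow_deriv j k (L_slope \<phi> s)) has_real_derivative pow_deriv (Suc j) k (L_slope \<phi> s)) (at s)"
proof (induction j arbitrary: k)
  case 0
  have "((\<lambda>s. L_slope \<phi> s ^ k) has_real_derivative
      real k * ((1 - (L_slope \<phi> s)\<^sup>2) * L_slope \<phi> s ^ (k - Suc 0))) (at s)"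
    by (rule DERIV_power[OF L_slope_deriv[OF assms]])
  moreover have "real k * ((1 - (L_slope \<phi> s)\<^sup>2) * L_slope \<phi> s ^ (k - Suc 0)) = pow_deriv (Suc 0) k (L_slope \<phi> s)"
    by (cases k) (auto simp: algebra_simps power2_eq_square)
  ultimately show ?case by simp
next
  case (Suc j)
  then show ?case by (auto intro!: derivative_eq_intros simp: simp del: pow_deriv.simps(2) simp: pow_deriv.simps(2)[of j] pow_deriv.simps(2)[of "Suc j"])
qed

text \<open>From order one on, the derivatives are polynomials in the slope; continuity and
  measurability in \<open>\<phi>\<close> and bounds uniform in \<open>\<phi>\<close> and
  \<open>s\<close> can be read off from this form.\<close>

definition L_deriv :: "nat \<Rightarrow> real \<Rightarrow> real \<Rightarrow> real" where
  "L_deriv j \<phi> s = (case j of 0 \<Rightarrow> L_fun \<phi> s | Suc i \<Rightarrow> pow_deriv i 1 (L_slope \<phi> s))"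

lemma L_deriv_0: "L_deriv 0 = L_fun" by (simp add: L_deriv_def fun_eq_iff)

lemma L_deriv_has_derivative:
  assumes "\<phi> \<in> {0..1}"
  shows "(L_deriv j \<phi> has_real_derivative L_deriv (Suc j) \<phi> s) (at s)"
proof (cases j)
  case 0
  then show ?thesis using L_fun_deriv[OF assms] by (simp add: L_deriv_def[abs_def])
next
  case (Suc i)
  then show ?thesis using pow_deriv_L_slope[OF assms, of i 1] by (simp add: L_deriv_def[abs_def])
qed

lemma L_deriv_bound:
  assumes "\<phi> \<in> {0..1}" shows "\<bar>L_deriv (Suc j) \<phi> s\<bar> \<le> 2 ^ j * fact j"
  using pow_deriv_bound[OF L_slope_bound[OF assms], of j 1 s] by (simp add: L_deriv_def pochhammer_fact)

text \<open>The bridge between the iterated \<open>deriv\<close> in the definitions of type and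
  strength and the explicit sequences \<open>D\<close> of successive derivatives used in the
  arguments below.\<close>

lemma deriv_funpow_eq:
  fixes D :: "nat \<Rightarrow> real \<Rightarrow> real"
  assumes "\<And>j s. (D j has_real_derivative D (Suc j) s) (at s)"
  shows "(deriv ^^ j) (D 0) = D j"
  using assms by (induction j) (auto intro!: DERIV_imp_deriv)

lemma deriv_funpow_L_fun:
  assumes "\<phi> \<in> {0..1}" shows "(deriv ^^ j) (L_fun \<phi>) = L_deriv j \<phi>"
  using deriv_funpow_eq[of "\<lambda>j. L_deriv j \<phi>" j] L_deriv_has_derivative[OF assms] by (simp add: L_deriv_0)

lemma continuous_on_L_deriv: "continuous_on {0..1} (\<lambda>\<phi>. L_deriv j \<phi> s)"
proof -
  have "\<forall>\<phi>\<in>{0..1}. \<phi> * exp s + (1 - \<phi>) * exp (- s) \<noteq> 0"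
    using spin_mgf_pos[of _ s] by force
  then show ?thesis
    by (cases j) (auto simp: L_deriv_def L_slope_def L_fun_def intro!: continuous_intros)
qed

lemma measurable_L_deriv [measurable]: "(\<lambda>\<phi>. L_deriv j \<phi> s) \<in> borel_measurable borel"
proof -
  have "(\<lambda>v. pow_deriv i k v) \<in> borel_measurable borel" for i k
    by (intro borel_measurable_continuous_onI continuous_intros)
  then show ?thesis
    by (cases j) (auto simp: L_deriv_def L_slope_def L_fun_def intro!: measurable_compose[where N = borel])
qed

lemma deriv_seq_Taylor:
  fixes D :: "nat \<Rightarrow> real \<Rightarrow> real"
  assumes "\<And>j s. (D j has_real_derivative D (Suc j) s) (at s)"
  shows "\<exists>t. \<bar>t\<bar> \<le> \<bar>h\<bar> \<and>
    D j (s + h) = (\<Sum>i<n. D (j + i) s / fact i * h ^ i) + D (j + n) (s + t) / fact n * h ^ n"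
proof -
  have "((\<lambda>t. D (j + i) (s + t)) has_real_derivative D (j + Suc i) (s + t)) (at t)" for i t
    using DERIV_shift[of "D (j + i)" "D (j + Suc i) (s + t)" t s] assms[of "j + i" "s + t"]
    by (simp add: add.commute)
  then show ?thesis
    using Maclaurin_all_le[of "\<lambda>i t. D (j + i) (s + t)" "\<lambda>t. D j (s + t)" h n] by auto
qed

section \<open>The minima of \<open>G\<close>\<close>

lemma deriv_seq_continuous:
  fixes D :: "nat \<Rightarrow> real \<Rightarrow> real"
  assumes "\<And>j s. (D j has_real_derivative D (Suc j) s) (at s)"
  shows "continuous_on A (D j)"
  using assms by (auto intro!: continuous_at_imp_continuous_on dest: DERIV_isCont)

text \<open>The bound gives Taylor expansions that converge on balls whose radius does not depend on
  the centre. Hence the set \<open>Z\<close> of points where all derivatives of positive order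
  vanish is open as well as closed, and it is the whole line. The bound starts at order
  \<open>N\<close> because a quadratic term spoils it at low orders.\<close>

lemma analytic_flat_imp_constant:
  fixes D :: "nat \<Rightarrow> real \<Rightarrow> real"
  assumes D: "\<And>j s. (D j has_real_derivative D (Suc j) s) (at s)"
    and K: "K > 0" and bnd: "\<And>j s. j \<ge> N \<Longrightarrow> \<bar>D j s\<bar> \<le> K ^ j * fact j"
    and flat: "\<And>j. j \<ge> 1 \<Longrightarrow> D j m = 0"
  shows "D 0 s = D 0 m"
proof -
  define Z where "Z = {s. \<forall>j\<ge>1. D j s = 0}"
  have "closed Z"
  proof -
    have "Z = (\<Inter>j\<in>{1..}. {s. D j s = 0})" by (auto simp: Z_def)
    also have "closed \<dots>"
      by (intro closed_INT ballI closed_Collect_eq deriv_seq_continuous[of D] D continuous_intros)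
    finally show ?thesis .
  qed
  moreover have "open Z"
    unfolding open_contains_ball
  proof
    fix z assume z: "z \<in> Z"
    \<comment> \<open>Half of \<open>1 / K\<close>, so that the remainder of order \<open>n\<close>
      is at most \<open>(K * \<bar>h\<bar>) ^ n \<le> (1 / 2) ^ n\<close>.\<close>
    define r where "r = 1 / (2 * K)"
    have r: "r > 0" using K by (simp add: r_def)
    have const: "D 0 y = D 0 z" if y: "y \<in> ball z r" for y
    proof -
      define h where "h = y - z"
      have h: "K * \<bar>h\<bar> \<le> 1 / 2" using y K by (auto simp: h_def r_def dist_real_def field_simps abs_minus_commute)
      have est: "\<bar>D 0 y - D 0 z\<bar> \<le> (1 / 2) ^ n" if n: "n \<ge> N" "n \<ge> 1" for n
      proof -
        obtain t where "D 0 (z + h) = (\<Sum>i<n. D (0 + i) z / fact i * h ^ i) + D (0 + n) (z + t) / fact n * h ^ n"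
          using deriv_seq_Taylor[of D h 0 z n] D by auto
        moreover have "(\<Sum>i<n. D i z / fact i * h ^ i) = (\<Sum>i<n. if i = 0 then D 0 z else 0)"
          using z by (intro sum.cong) (auto simp: Z_def)
        ultimately have "D 0 y - D 0 z = D n (z + t) / fact n * h ^ n"
          using n by (simp add: h_def)
        also have "\<bar>\<dots>\<bar> \<le> K ^ n * \<bar>h\<bar> ^ n"
          unfolding abs_mult abs_divide power_abs
          using bnd[of n "z + t"] n by (intro mult_right_mono) (auto simp: divide_le_eq)
        also have "\<dots> = (K * \<bar>h\<bar>) ^ n" by (simp add: power_mult_distrib)
        also have "\<dots> \<le> (1 / 2) ^ n" using h K by (intro power_mono) auto
        finally show ?thesis .
      qed
      have "(\<lambda>n. (1 / 2 :: real) ^ n) \<longlonglongrightarrow> 0" by (intro LIMSEQ_realpow_zero) auto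
      then have "\<bar>D 0 y - D 0 z\<bar> \<le> 0"
        using est by (intro LIMSEQ_le_const[of _ _ "\<bar>D 0 y - D 0 z\<bar>"]) (auto intro!: exI[of _ "max N 1"])
      then show ?thesis by simp
    qed
    \<comment> \<open>A derivative that is constant on an open ball makes the next one vanish there;
      induction from order zero covers all orders.\<close>
    have step: "\<forall>y\<in>ball z r. D (Suc j) y = 0" if "\<forall>y\<in>ball z r. D j y = c" for j c
    proof (rule ballI)
      fix y assume y: "y \<in> ball z r"
      have "((\<lambda>_. c) has_real_derivative D (Suc j) y) (at y)"
        by (rule has_field_derivative_transform_within_open[OF D[of j y], where S = "ball z r"]) (use that y in auto)
      then show "D (Suc j) y = 0" using DERIV_unique DERIV_const by blast
    qed
    have "\<forall>y\<in>ball z r. D (Suc j) y = 0" for j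
      by (induction j) (use step const in blast)+
    moreover have "\<exists>i. j = Suc i" if "1 \<le> j" for j using that by (cases j) auto
    ultimately have "ball z r \<subseteq> Z" unfolding Z_def by blast
    then show "\<exists>e>0. ball z e \<subseteq> Z" using r by auto
  qed
  moreover have "m \<in> Z" using flat by (simp add: Z_def)
  ultimately have "Z = UNIV" using clopen[of Z] by auto
  then have "D 1 s = 0" for s by (auto simp: Z_def)
  then have "\<forall>x. DERIV (D 0) x :> 0" using D[of 0] by simp
  then show ?thesis using DERIV_isconst_all by blast
qed

text \<open>Strictness has two uses: \<open>D 0 (m + h) - D 0 m\<close> has the sign of the leading
  Taylor term, and it is nonzero for small \<open>h \<noteq> 0\<close>.\<close>

lemma local_expansion:
  fixes D :: "nat \<Rightarrow> real \<Rightarrow> real"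
  assumes D: "\<And>j s. (D j has_real_derivative D (Suc j) s) (at s)"
    and zero: "\<And>j. 1 \<le> j \<Longrightarrow> j < t \<Longrightarrow> D j m = 0" and t: "1 \<le> t" and nz: "D t m \<noteq> 0"
  shows "\<exists>\<delta>>0. \<forall>h. h \<noteq> 0 \<longrightarrow> \<bar>h\<bar> < \<delta> \<longrightarrow> \<bar>D 0 (m + h) - D 0 m - D t m / fact t * h ^ t\<bar> < \<bar>D t m\<bar> / fact t * \<bar>h\<bar> ^ t"
proof -
  have "compact (D (Suc t) ` {m - 1..m + 1})"
    by (intro compact_continuous_image deriv_seq_continuous D) auto
  then have "bounded (D (Suc t) ` {m - 1..m + 1})" by (rule compact_imp_bounded)
  then obtain C where C: "C > 0" "\<And>y. y \<in> {m - 1..m + 1} \<Longrightarrow> \<bar>D (Suc t) y\<bar> \<le> C"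
    unfolding bounded_pos by auto
  \<comment> \<open>The quotient keeps \<open>C * \<bar>h\<bar>\<close> below
    \<open>\<bar>D t m\<bar> / fact t\<close>; the 1 keeps \<open>m + u\<close> in the interval
    where \<open>C\<close> is a bound.\<close>
  define \<delta> where "\<delta> = min 1 (\<bar>D t m\<bar> / (C * fact t))"
  show ?thesis
  proof (intro exI[of _ \<delta>] conjI allI impI)
    show "\<delta> > 0" using C nz by (auto simp: \<delta>_def)
    fix h assume h: "h \<noteq> 0" "\<bar>h\<bar> < \<delta>"
    obtain u where u: "\<bar>u\<bar> \<le> \<bar>h\<bar>" "D 0 (m + h) = (\<Sum>i<Suc t. D (0 + i) m / fact i * h ^ i) + D (0 + Suc t) (m + u) / fact (Suc t) * h ^ Suc t"
      using deriv_seq_Taylor[of D h 0 m "Suc t"] D by blast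
    have "(\<Sum>i<t. D i m / fact i * h ^ i) = (\<Sum>i<t. if i = 0 then D 0 m else 0)"
      using zero by (intro sum.cong) auto
    then have "D 0 (m + h) - D 0 m - D t m / fact t * h ^ t = D (Suc t) (m + u) / fact (Suc t) * h ^ Suc t"
      using u(2) t by simp
    also have "\<bar>\<dots>\<bar> \<le> C / fact (Suc t) * \<bar>h\<bar> ^ Suc t"
      using u(1) h unfolding abs_mult abs_divide power_abs
      by (intro mult_right_mono divide_right_mono) (auto simp: \<delta>_def abs_le_iff intro!: C(2) divide_right_mono)
    also have "\<dots> \<le> C * \<bar>h\<bar> ^ Suc t"
      using C(1) by (intro mult_right_mono) (simp_all add: divide_le_eq fact_ge_1 del: fact_Suc)
    also have "\<dots> = (C * \<bar>h\<bar>) * \<bar>h\<bar> ^ t" by simp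
    also have "\<dots> < (\<bar>D t m\<bar> / fact t) * \<bar>h\<bar> ^ t"
      using h C(1) by (intro mult_strict_right_mono) (auto simp: \<delta>_def field_simps)
    finally show "\<bar>D 0 (m + h) - D 0 m - D t m / fact t * h ^ t\<bar> < \<bar>D t m\<bar> / fact t * \<bar>h\<bar> ^ t" .
  qed
qed

section \<open>Existence, finiteness, type and strength of the minima of a coercive analytic
  function\<close>

context
  fixes D :: "nat \<Rightarrow> real \<Rightarrow> real" and K :: real and N :: nat
  assumes D: "\<And>j s. (D j has_real_derivative D (Suc j) s) (at s)"
    and K: "K > 0" and bnd: "\<forall>j\<ge>N. \<forall>s. \<bar>D j s\<bar> \<le> K ^ j * fact j"
    and coercive: "\<And>C. \<exists>R. \<forall>s. \<bar>s\<bar> \<ge> R \<longrightarrow> C < D 0 s"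
begin

text \<open>A function flat at \<open>m\<close> would be constant, which coercivity excludes. Hence
  the \<open>LEAST\<close> in \<open>min_type\<close> is attained.\<close>

lemma exists_nonzero_derivative: "\<exists>j. 1 \<le> j \<and> (deriv ^^ j) (D 0) m \<noteq> 0"
proof (rule ccontr)
  assume "\<not> ?thesis"
  then have "D j m = 0" if "j \<ge> 1" for j using that deriv_funpow_eq[of D j, OF D] by auto
  then have const: "D 0 s = D 0 m" for s using analytic_flat_imp_constant[of D K N m s] D K bnd by blast
  moreover obtain R where "\<forall>s. \<bar>s\<bar> \<ge> R \<longrightarrow> D 0 m < D 0 s" using coercive by blast
  then have "D 0 m < D 0 \<bar>R\<bar>" by simp
  ultimately show False by (metis less_irrefl)
qed

lemma min_type_properties:
  shows "1 \<le> min_type (D 0) m" "D (min_type (D 0) m) m \<noteq> 0"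
    and "\<And>j. 1 \<le> j \<Longrightarrow> j < min_type (D 0) m \<Longrightarrow> D j m = 0"
    and "min_strength (D 0) m = D (min_type (D 0) m) m"
proof -
  have eq: "(deriv ^^ j) (D 0) = D j" for j by (rule deriv_funpow_eq[of D, OF D])
  show "1 \<le> min_type (D 0) m" "D (min_type (D 0) m) m \<noteq> 0"
    using LeastI_ex[OF exists_nonzero_derivative[of m]] by (auto simp: min_type_def eq)
  show "D j m = 0" if "1 \<le> j" "j < min_type (D 0) m" for j
    using not_less_Least[of j "\<lambda>j. 1 \<le> j \<and> (deriv ^^ j) (D 0) m \<noteq> 0"] that
    by (auto simp: min_type_def eq)
  show "min_strength (D 0) m = D (min_type (D 0) m) m" by (simp add: min_strength_def eq)
qed

text \<open>At a minimum the leading term cannot be negative for either sign of \<open>h\<close>: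
  positive \<open>h\<close> gives the sign of the strength, negative \<open>h\<close> the parity of
  the type.\<close>

lemma min_type_even_strength_pos:
  assumes m: "m \<in> global_minima (D 0)"
  shows "even (min_type (D 0) m)" "0 < D (min_type (D 0) m) m"
proof -
  define t where "t = min_type (D 0) m"
  note p = min_type_properties[where m = m, folded t_def]
  obtain \<delta> where \<delta>: "\<delta> > 0" "\<And>h. h \<noteq> 0 \<Longrightarrow> \<bar>h\<bar> < \<delta> \<Longrightarrow>
    \<bar>D 0 (m + h) - D 0 m - D t m / fact t * h ^ t\<bar> < \<bar>D t m\<bar> / fact t * \<bar>h\<bar> ^ t"
    using local_expansion[of D t m, OF D p(3) p(1) p(2)] by blast
  have pos: "0 < D t m * h ^ t" if h: "h \<noteq> 0" "\<bar>h\<bar> < \<delta>" for h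
  proof -
    have "D 0 m \<le> D 0 (m + h)" using m by (simp add: global_minima_def)
    then have "- (\<bar>D t m\<bar> / fact t * \<bar>h\<bar> ^ t) < D t m / fact t * h ^ t"
      using \<delta>(2)[OF h] by linarith
    then have "- \<bar>D t m * h ^ t\<bar> < D t m * h ^ t"
      by (simp add: abs_mult power_abs field_simps)
    then show ?thesis by linarith
  qed
  show "0 < D (min_type (D 0) m) m"
    using pos[of "\<delta> / 2"] \<delta>(1) by (simp add: t_def zero_less_mult_iff)
  then have "0 < (- \<delta> / 2) ^ t"
    using pos[of "- \<delta> / 2"] \<delta>(1) by (simp add: t_def zero_less_mult_iff)
  then show "even (min_type (D 0) m)"
    using \<delta>(1) by (auto simp: t_def[symmetric] zero_less_power_eq)
qed

lemma global_minima_nonempty: "global_minima (D 0) \<noteq> {}"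
proof -
  obtain R where R: "\<forall>s. \<bar>s\<bar> \<ge> R \<longrightarrow> D 0 0 < D 0 s" using coercive by blast
  have "\<not> \<bar>0\<bar> \<ge> R" using R by (metis less_irrefl)
  then have "compact {-R..R}" "{-R..R} \<noteq> {}" by auto
  then obtain z where z: "z \<in> {-R..R}" "\<forall>y\<in>{-R..R}. D 0 z \<le> D 0 y"
    using continuous_attains_inf[of "{-R..R}" "D 0"] deriv_seq_continuous[of D, OF D] by blast
  have "D 0 z \<le> D 0 y" for y
  proof (cases "\<bar>y\<bar> \<ge> R")
    case True
    have "D 0 z \<le> D 0 0" using z \<open>\<not> \<bar>0\<bar> \<ge> R\<close> by auto
    then show ?thesis using R True by (meson less_imp_le order_trans)
  next
    case False
    then have "y \<in> {-R..R}" by auto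
    then show ?thesis using z by blast
  qed
  then show ?thesis by (auto simp: global_minima_def)
qed

text \<open>Infinitely many minima in a bounded interval would accumulate at a point that is again a
  minimum, and the leading Taylor term isolates that point.\<close>

lemma global_minima_finite: "finite (global_minima (D 0))"
proof (rule ccontr)
  assume inf: "infinite (global_minima (D 0))"
  obtain R where R: "\<forall>s. \<bar>s\<bar> \<ge> R \<longrightarrow> D 0 0 < D 0 s" using coercive by blast
  have sub: "global_minima (D 0) \<subseteq> {-R..R}"
    using R by (auto simp: global_minima_def) (smt (verit, best))+
  then obtain l where l: "l \<in> {-R..R}" "l islimpt global_minima (D 0)"
    using inf compact_eq_Bolzano_Weierstrass[of "{-R..R}"] by blast
  have "closed (global_minima (D 0))"
  proof -
    have "global_minima (D 0) = (\<Inter>s. {m. D 0 m \<le> D 0 s})" by (auto simp: global_minima_def)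
    also have "closed \<dots>"
      by (intro closed_INT ballI closed_Collect_le deriv_seq_continuous[of D] D continuous_intros)
    finally show ?thesis .
  qed
  then have lm: "l \<in> global_minima (D 0)" using l closed_limpt by blast
  define t where "t = min_type (D 0) l"
  note p = min_type_properties[where m = l, folded t_def]
  obtain \<delta> where \<delta>: "\<delta> > 0" "\<And>h. h \<noteq> 0 \<Longrightarrow> \<bar>h\<bar> < \<delta> \<Longrightarrow>
    \<bar>D 0 (l + h) - D 0 l - D t l / fact t * h ^ t\<bar> < \<bar>D t l\<bar> / fact t * \<bar>h\<bar> ^ t"
    using local_expansion[of D t l, OF D p(3) p(1) p(2)] by blast
  obtain y where y: "y \<in> global_minima (D 0)" "y \<noteq> l" "dist y l < \<delta>"
    using l(2) \<delta>(1) unfolding islimpt_approachable by blast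
  \<comment> \<open>Equal values make the error as large as the leading term, against the strict
    inequality.\<close>
  have "D 0 y = D 0 l" using y lm by (auto simp: global_minima_def intro: antisym)
  then show False
    using \<delta>(2)[of "y - l"] y by (simp add: dist_real_def abs_mult power_abs)
qed

end

section \<open>Differentiation under the integral sign and the derivatives of G\<close>

context
  fixes M :: "'a measure" and f :: "'a \<Rightarrow> real"
  assumes M: "prob_space M" and f [measurable]: "f \<in> borel_measurable M" and f01: "\<And>y. f y \<in> {0..1}"
begin

interpretation prob_space M by fact

lemma integrable_L_deriv: "integrable M (\<lambda>y. L_deriv j (f y) s)"
proof (rule integrable_const_bound)
  show "AE y in M. norm (L_deriv j (f y) s) \<le> \<bar>s\<bar> + 2 ^ (j - 1) * fact (j - 1)"
  proof (rule AE_I2)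
    fix y
    show "norm (L_deriv j (f y) s) \<le> \<bar>s\<bar> + 2 ^ (j - 1) * fact (j - 1)"
      using L_fun_bound[OF f01[of y], of s] L_deriv_bound[OF f01[of y], of "j - 1" s]
      by (cases j) (auto simp: L_deriv_0)
  qed
  show "(\<lambda>y. L_deriv j (f y) s) \<in> borel_measurable M"
    using measurable_compose[OF f measurable_L_deriv] .
qed

text \<open>A second-order Taylor expansion bounds the distance from difference quotient to
  derivative by \<open>B * \<bar>h\<bar>\<close>, with \<open>B\<close> independent of
  \<open>y\<close>; the bound survives integration.\<close>

lemma integral_L_deriv_has_derivative:
  "((\<lambda>s. \<integral>y. L_deriv j (f y) s \<partial>M) has_real_derivative (\<integral>y. L_deriv (Suc j) (f y) s \<partial>M)) (at s)"
proof -
  define B :: real where "B = 2 ^ Suc j * fact (Suc j)"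
  have "(\<lambda>h. ((\<integral>y. L_deriv j (f y) (s + h) \<partial>M) - (\<integral>y. L_deriv j (f y) s \<partial>M)) / h
      - (\<integral>y. L_deriv (Suc j) (f y) s \<partial>M)) \<midarrow>0\<rightarrow> 0"
  proof (rule Lim_null_comparison)
    have "((\<lambda>h. B * \<bar>h\<bar>) \<longlongrightarrow> B * \<bar>0\<bar>) (at 0)" by (intro tendsto_intros)
    then show "((\<lambda>h. B * \<bar>h\<bar>) \<longlongrightarrow> 0) (at 0)" by simp
    show "\<forall>\<^sub>F h in at 0. norm (((\<integral>y. L_deriv j (f y) (s + h) \<partial>M) - (\<integral>y. L_deriv j (f y) s \<partial>M)) / h
      - (\<integral>y. L_deriv (Suc j) (f y) s \<partial>M)) \<le> B * \<bar>h\<bar>"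
      unfolding eventually_at
    proof (intro exI[of _ 1] conjI ballI impI)
      fix h :: real assume "h \<noteq> 0 \<and> dist h 0 < 1"
      then have h: "h \<noteq> 0" by simp
      have pt: "norm ((L_deriv j (f y) (s + h) - L_deriv j (f y) s) / h - L_deriv (Suc j) (f y) s) \<le> B * \<bar>h\<bar>" for y
      proof -
        obtain t where "L_deriv j (f y) (s + h) = (\<Sum>i<2. L_deriv (j + i) (f y) s / fact i * h ^ i)
            + L_deriv (j + 2) (f y) (s + t) / fact 2 * h ^ 2"
          using deriv_seq_Taylor[of "\<lambda>j. L_deriv j (f y)" h j s 2] L_deriv_has_derivative[OF f01] by blast
        then have eq: "(L_deriv j (f y) (s + h) - L_deriv j (f y) s) / h - L_deriv (Suc j) (f y) s
            = L_deriv (Suc (Suc j)) (f y) (s + t) / 2 * h"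
          using h by (simp add: eval_nat_numeral field_simps)
        have "\<bar>L_deriv (Suc (Suc j)) (f y) (s + t) / 2\<bar> \<le> B"
          using L_deriv_bound[OF f01[of y], of "Suc j" "s + t"] by (simp add: B_def)
        then show ?thesis unfolding eq by (simp only: real_norm_def abs_mult mult_right_mono abs_ge_zero)
      qed
      have "((\<integral>y. L_deriv j (f y) (s + h) \<partial>M) - (\<integral>y. L_deriv j (f y) s \<partial>M)) / h - (\<integral>y. L_deriv (Suc j) (f y) s \<partial>M)
        = (\<integral>y. (L_deriv j (f y) (s + h) - L_deriv j (f y) s) / h - L_deriv (Suc j) (f y) s \<partial>M)"
        by (simp add: integrable_L_deriv)
      also have "norm \<dots> \<le> (\<integral>y. B * \<bar>h\<bar> \<partial>M)"
        by (intro order_trans[OF integral_norm_bound] integral_mono)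
           (use pt in \<open>auto intro!: integrable_norm Bochner_Integration.integrable_diff integrable_divide integrable_L_deriv\<close>)
      also have "\<dots> = B * \<bar>h\<bar>" by (simp add: prob_space)
      finally show "norm (((\<integral>y. L_deriv j (f y) (s + h) \<partial>M) - (\<integral>y. L_deriv j (f y) s \<partial>M)) / h
          - (\<integral>y. L_deriv (Suc j) (f y) s \<partial>M)) \<le> B * \<bar>h\<bar>" .
    qed auto
  qed
  then show ?thesis unfolding DERIV_def by (simp add: LIM_zero_iff)
qed

lemma integral_L_deriv_bound: "\<bar>\<integral>y. L_deriv (Suc j) (f y) s \<partial>M\<bar> \<le> 2 ^ j * fact j"
proof -
  have "norm (\<integral>y. L_deriv (Suc j) (f y) s \<partial>M) \<le> (\<integral>y. 2 ^ j * fact j \<partial>M)"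
    using L_deriv_bound[OF f01]
    by (intro order_trans[OF integral_norm_bound] integral_mono integrable_norm integrable_L_deriv) auto
  then show ?thesis by (simp add: prob_space)
qed

lemma integral_L_fun_bound: "\<bar>\<integral>y. L_fun (f y) s \<partial>M\<bar> \<le> \<bar>s\<bar>"
proof -
  have "norm (\<integral>y. L_fun (f y) s \<partial>M) \<le> (\<integral>y. \<bar>s\<bar> \<partial>M)"
    using L_fun_bound[OF f01] integrable_L_deriv[of 0 s]
    by (intro order_trans[OF integral_norm_bound] integral_mono integrable_norm) (auto simp: L_deriv_0)
  then show ?thesis by (simp add: prob_space)
qed

end

definition quad_deriv :: "real \<Rightarrow> nat \<Rightarrow> real \<Rightarrow> real" where
  "quad_deriv c j s = (if j = 0 then c / 2 * s\<^sup>2 else if j = 1 then c * s else if j = 2 then c else 0)"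

lemma quad_deriv_has_derivative: "(quad_deriv c j has_real_derivative quad_deriv c (Suc j) s) (at s)"
proof -
  consider "j = 0" | "j = 1" | "j \<ge> 2" by linarith
  then show ?thesis
    by cases (auto simp: quad_deriv_def[abs_def] intro!: derivative_eq_intros)
qed

definition G_deriv :: "real \<Rightarrow> ('a \<Rightarrow> real) \<Rightarrow> 'a measure \<Rightarrow> nat \<Rightarrow> real \<Rightarrow> real" where
  "G_deriv c f M j s = quad_deriv c j s - c ^ j * (\<integral>y. L_deriv j (f y) (c * s) \<partial>M)"

lemma G_lim_eq_G_deriv: "G_lim \<beta> J f M = G_deriv (\<beta> * J) f M 0"
  by (auto simp: G_lim_def G_deriv_def quad_deriv_def L_deriv_0 fun_eq_iff)

context
  fixes M :: "'a measure" and f :: "'a \<Rightarrow> real" and c :: real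
  assumes M: "prob_space M" and f: "f \<in> borel_measurable M" and f01: "\<And>y. f y \<in> {0..1}" and c: "c > 0"
begin

lemma G_deriv_has_derivative: "(G_deriv c f M j has_real_derivative G_deriv c f M (Suc j) s) (at s)"
proof -
  have "((\<lambda>s. \<integral>y. L_deriv j (f y) (c * s) \<partial>M) has_real_derivative (\<integral>y. L_deriv (Suc j) (f y) (c * s) \<partial>M) * c) (at s)"
    by (rule DERIV_chain2[OF integral_L_deriv_has_derivative[OF M f f01]]) (auto intro!: derivative_eq_intros)
  then show ?thesis unfolding G_deriv_def[abs_def]
    by (auto intro!: derivative_eq_intros quad_deriv_has_derivative)
qed

text \<open>From order 3 on the quadratic part has disappeared; the factor \<open>c ^ j\<close> is
  the chain rule.\<close>

lemma G_deriv_bound: "\<forall>j\<ge>3. \<forall>s. \<bar>G_deriv c f M j s\<bar> \<le> (2 * c) ^ j * fact j"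
proof (intro allI impI)
  fix j :: nat and s :: real
  assume j: "3 \<le> j"
  obtain i where i: "j = Suc i" using j by (cases j) auto
  have "\<bar>G_deriv c f M j s\<bar> = c ^ j * \<bar>\<integral>y. L_deriv (Suc i) (f y) (c * s) \<partial>M\<bar>"
    using j c i by (simp add: G_deriv_def quad_deriv_def abs_mult)
  also have "\<dots> \<le> c ^ j * (2 ^ i * fact i)"
    using c by (intro mult_left_mono integral_L_deriv_bound[OF M f f01]) auto
  also have "\<dots> \<le> c ^ j * (2 ^ j * fact j)"
    using c i by (intro mult_left_mono mult_mono fact_mono power_increasing) auto
  finally show "\<bar>G_deriv c f M j s\<bar> \<le> (2 * c) ^ j * fact j" by (simp add: power_mult_distrib mult_ac)
qed

lemma two_c_pos: "0 < 2 * c" using c by simp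

text \<open>The integral is at most \<open>c * \<bar>s\<bar>\<close> in absolute value, so the
  quadratic term wins. In the radius \<open>4 + \<bar>C\<bar> / c\<close> the 4 makes
  \<open>\<bar>s\<bar> / 2 - 1\<close> at least 1, and the quotient then makes
  \<open>c * \<bar>s\<bar>\<close> exceed \<open>\<bar>C\<bar>\<close>.\<close>

lemma G_deriv_coercive: "\<exists>R. \<forall>s. \<bar>s\<bar> \<ge> R \<longrightarrow> C < G_deriv c f M 0 s"
proof -
  have lower: "G_deriv c f M 0 s \<ge> c * \<bar>s\<bar> * (\<bar>s\<bar> / 2 - 1)" for s
    using integral_L_fun_bound[OF M f f01, of "c * s"] c
    by (simp add: G_deriv_def quad_deriv_def L_deriv_0 abs_mult algebra_simps power2_eq_square abs_le_iff)

  show ?thesis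
  proof (intro exI allI impI)
    fix s :: real assume s: "4 + \<bar>C\<bar> / c \<le> \<bar>s\<bar>"
    have "\<bar>C\<bar> < c * \<bar>s\<bar>" using s c by (simp add: field_simps)
    also have "\<dots> \<le> c * \<bar>s\<bar> * (\<bar>s\<bar> / 2 - 1)"
    proof -
      have "\<bar>C\<bar> / c \<ge> 0" using c by simp
      then have "1 \<le> \<bar>s\<bar> / 2 - 1" using s by linarith
      then show ?thesis using mult_left_mono[of 1 "\<bar>s\<bar> / 2 - 1" "c * \<bar>s\<bar>"] c by simp
    qed
    finally show "C < G_deriv c f M 0 s" using lower[of s] by linarith
  qed
qed

lemmas G_min_type_properties = min_type_properties
  [where D = "G_deriv c f M", OF G_deriv_has_derivative two_c_pos G_deriv_bound G_deriv_coercive]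
lemmas G_min_type_even_strength_pos = min_type_even_strength_pos
  [where D = "G_deriv c f M", OF G_deriv_has_derivative two_c_pos G_deriv_bound G_deriv_coercive]
lemmas G_global_minima_nonempty = global_minima_nonempty
  [where D = "G_deriv c f M", OF G_deriv_has_derivative two_c_pos G_deriv_bound G_deriv_coercive]
lemmas G_global_minima_finite = global_minima_finite
  [where D = "G_deriv c f M", OF G_deriv_has_derivative two_c_pos G_deriv_bound G_deriv_coercive]

end

section \<open>The Gibbs measure and its Gaussian smoothing\<close>

definition bernoulli_weight ::
  "('a \<Rightarrow> 'a) \<Rightarrow> ('a \<Rightarrow> real) \<Rightarrow> nat \<Rightarrow> 'a \<Rightarrow> (nat \<Rightarrow> real) \<Rightarrow> real" where
  "bernoulli_weight T f n x \<sigma> = (\<Prod>i=1..n. if \<sigma> i = 1 then f ((T ^^ i) x) else 1 - f ((T ^^ i) x))"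

definition partition_fun ::
  "real \<Rightarrow> real \<Rightarrow> ('a \<Rightarrow> 'a) \<Rightarrow> ('a \<Rightarrow> real) \<Rightarrow> nat \<Rightarrow> 'a \<Rightarrow> real" where
  "partition_fun \<beta> J T f n x = (\<Sum>\<sigma>\<in>spins n. gibbs_weight \<beta> J T f n x \<sigma>)"

definition emp_mean :: "('a \<Rightarrow> 'a) \<Rightarrow> 'a \<Rightarrow> nat \<Rightarrow> ('a \<Rightarrow> real) \<Rightarrow> real" where
  "emp_mean T x n g = (\<Sum>i=1..n. g ((T ^^ i) x)) / real n"

lemma finite_spins [simp]: "finite (spins n)"
  by (simp add: spins_def finite_PiE)

lemma gibbs_weight_eq:
  "gibbs_weight \<beta> J T f n x \<sigma> =
    exp (\<beta> * J / (2 * real n) * (magnetization n \<sigma>)\<^sup>2) * bernoulli_weight T f n x \<sigma>"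
  by (simp add: gibbs_weight_def magnetization_def bernoulli_weight_def)

lemma magnetization_bound:
  assumes "\<sigma> \<in> spins n" shows "\<bar>magnetization n \<sigma> / real n\<bar> \<le> 1"
proof -
  have "\<bar>magnetization n \<sigma>\<bar> \<le> (\<Sum>i=1..n. \<bar>\<sigma> i\<bar>)" unfolding magnetization_def by (rule sum_abs)
  also have "\<dots> \<le> (\<Sum>i=1..n. 1)"
    using assms by (intro sum_mono) (force simp: spins_def PiE_def Pi_def)
  finally show ?thesis by (cases "n = 0") (auto simp: divide_le_eq)
qed

text \<open>A Chebyshev argument: near \<open>m\<close> uniform continuity applies, elsewhere
  \<open>2 * B\<close> is at most \<open>2 * B / d^2\<close> times the squared distance, whose
  Gaussian mean is the variance. Centres in \<open>[-1, 1]\<close> and \<open>d \<le> 1\<close> keep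
  the first case inside \<open>[-2, 2]\<close>, so \<open>C\<close> serves all centres at
  once.\<close>

lemma normal_smoothing:
  fixes h :: "real \<Rightarrow> real"
  assumes h: "continuous_on UNIV h" and B: "\<And>s. \<bar>h s\<bar> \<le> B" and e: "e > 0"
  obtains C where "C \<ge> 0"
    "\<And>m sd. \<bar>m\<bar> \<le> 1 \<Longrightarrow> sd > 0 \<Longrightarrow> \<bar>h m - (\<integral>s. normal_density m sd s * h s \<partial>lborel)\<bar> \<le> e + C * sd\<^sup>2"
proof -
  have "uniformly_continuous_on {-2..2} h"
    by (intro compact_uniformly_continuous continuous_on_subset[OF h]) auto
  then obtain d0 where d0: "d0 > 0" "\<And>s s'. s \<in> {-2..2} \<Longrightarrow> s' \<in> {-2..2} \<Longrightarrow> \<bar>s' - s\<bar> < d0 \<Longrightarrow> \<bar>h s' - h s\<bar> < e"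
    using e unfolding uniformly_continuous_on_def dist_real_def by metis
  define d where "d = min d0 1"
  have d: "d > 0" using d0 by (simp add: d_def)
  have B0: "B \<ge> 0" using B[of 0] by linarith
  have hm: "h \<in> borel_measurable borel" using h by (rule borel_measurable_continuous_onI)
  show ?thesis
  proof (rule that[of "2 * B / d\<^sup>2"])
    fix m sd :: real assume m: "\<bar>m\<bar> \<le> 1" and sd: "sd > 0"
    have pt: "\<bar>h m - h s\<bar> \<le> e + 2 * B / d\<^sup>2 * (s - m)\<^sup>2" for s
    proof (cases "\<bar>s - m\<bar> < d")
      case True
      then have "\<bar>h s - h m\<bar> < e" using m by (intro d0(2)) (auto simp: d_def)
      moreover have "0 \<le> 2 * B / d\<^sup>2 * (s - m)\<^sup>2" using B0 by auto
      ultimately show ?thesis by linarith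
    next
      case False
      then have "d\<^sup>2 \<le> (s - m)\<^sup>2" using d by (metis abs_le_square_iff abs_of_pos not_less)
      then have "2 * B \<le> 2 * B / d\<^sup>2 * (s - m)\<^sup>2"
        using d B0 mult_left_mono[of "d\<^sup>2" "(s - m)\<^sup>2" "2 * B"] by (simp add: field_simps)
      then show ?thesis using B[of m] B[of s] e by linarith
    qed
    have int1: "integrable lborel (\<lambda>s. normal_density m sd s * h s)"
    proof (rule Bochner_Integration.integrable_bound)
      show "integrable lborel (\<lambda>s. B * normal_density m sd s)" using sd by simp
      show "AE s in lborel. norm (normal_density m sd s * h s) \<le> norm (B * normal_density m sd s)"
        using B B0 by (intro AE_I2) (simp add: abs_mult mult.commute[of B] mult_left_mono)
    qed (use hm in simp)
    have int2: "integrable lborel (\<lambda>s. normal_density m sd s * (s - m)\<^sup>2)"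
      using integrable_normal_moment[OF sd, of m 2] .
    have eq: "h m - (\<integral>s. normal_density m sd s * h s \<partial>lborel) = (\<integral>s. normal_density m sd s * h m - normal_density m sd s * h s \<partial>lborel)"
      using int1 sd by simp
    have "\<bar>\<integral>s. normal_density m sd s * h m - normal_density m sd s * h s \<partial>lborel\<bar> \<le> (\<integral>s. e * normal_density m sd s + 2 * B / d\<^sup>2 * (normal_density m sd s * (s - m)\<^sup>2) \<partial>lborel)"
    proof (rule order_trans[OF integral_abs_bound], rule integral_mono)
      fix s
      have "\<bar>normal_density m sd s * h m - normal_density m sd s * h s\<bar> = normal_density m sd s * \<bar>h m - h s\<bar>"
        by (simp add: abs_mult flip: right_diff_distrib)
      also have "\<dots> \<le> normal_density m sd s * (e + 2 * B / d\<^sup>2 * (s - m)\<^sup>2)"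
        by (intro mult_left_mono pt) simp
      finally show "\<bar>normal_density m sd s * h m - normal_density m sd s * h s\<bar> \<le>
         e * normal_density m sd s + 2 * B / d\<^sup>2 * (normal_density m sd s * (s - m)\<^sup>2)"
        by (simp add: algebra_simps)
    next
      show "integrable lborel (\<lambda>s. \<bar>normal_density m sd s * h m - normal_density m sd s * h s\<bar>)"
        using sd by (intro integrable_abs Bochner_Integration.integrable_diff int1 integrable_mult_left) auto
      show "integrable lborel (\<lambda>s. e * normal_density m sd s + 2 * B / d\<^sup>2 * (normal_density m sd s * (s - m)\<^sup>2))"
        using sd by (intro Bochner_Integration.integrable_add integrable_mult_right int2) auto
    qed
    also have "\<dots> = (\<integral>s. e * normal_density m sd s \<partial>lborel) + (\<integral>s. 2 * B / d\<^sup>2 * (normal_density m sd s * (s - m)\<^sup>2) \<partial>lborel)"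
      using sd by (intro Bochner_Integration.integral_add integrable_mult_right int2) auto
    also have "\<dots> = e + 2 * B / d\<^sup>2 * (\<integral>s. normal_density m sd s * (s - m)\<^sup>2 \<partial>lborel)"
      using sd by simp
    also have "(\<integral>s. normal_density m sd s * (s - m)\<^sup>2 \<partial>lborel) = sd\<^sup>2"
      using sd integral_normal_moment_even[OF sd, of m 1] by (simp add: fact_numeral)
    finally show "\<bar>h m - (\<integral>s. normal_density m sd s * h s \<partial>lborel)\<bar> \<le> e + 2 * B / d\<^sup>2 * sd\<^sup>2"
      unfolding eq .
  qed (use B0 in auto)
qed

locale gibbs_system =
  fixes T :: "'a \<Rightarrow> 'a" and f :: "'a \<Rightarrow> real" and x :: 'a and \<beta> J :: real
  assumes f01: "\<And>y. f y \<in> {0..1}" and \<beta>: "0 < \<beta>" and J: "0 < J"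
begin

abbreviation "c \<equiv> \<beta> * J"
abbreviation "gw n \<equiv> gibbs_weight \<beta> J T f n x"
abbreviation "Z n \<equiv> partition_fun \<beta> J T f n x"
abbreviation "bw n \<equiv> bernoulli_weight T f n x"
abbreviation "mbar n \<sigma> \<equiv> magnetization n \<sigma> / real n"
abbreviation "Gn \<equiv> G_emp \<beta> J T f x"
abbreviation "boltz n s \<equiv> exp (- (real n * Gn n s))"
abbreviation "lap_on A n h \<equiv> \<integral>s. indicator A s * (h s * boltz n s) \<partial>lborel"
abbreviation "lap n h \<equiv> \<integral>s. h s * boltz n s \<partial>lborel"
abbreviation "Q n \<equiv> mean_magnetization_distr \<beta> J T f n x"
abbreviation "Lam_n n l \<equiv> emp_mean T x n (\<lambda>y. L_fun (f y) l)"
abbreviation "gibbs_mean n h \<equiv> (\<integral>\<sigma>. h (magnetization n \<sigma> / real n) \<partial>gibbs \<beta> J T f n x)"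

lemma bernoulli_weight_nonneg: "0 \<le> bw n \<sigma>"
  unfolding bernoulli_weight_def using f01 by (intro prod_nonneg) auto

lemma bernoulli_mgf:
  "(\<Sum>\<sigma>\<in>spins n. bw n \<sigma> * exp (l * magnetization n \<sigma>)) =
    exp (\<Sum>i=1..n. L_fun (f ((T ^^ i) x)) l)"
proof -
  define w where "w i v = (if v = 1 then f ((T ^^ i) x) else 1 - f ((T ^^ i) x)) * exp (l * v)" for i :: nat and v :: real
  have "bw n \<sigma> * exp (l * magnetization n \<sigma>) = (\<Prod>i=1..n. w i (\<sigma> i))" for \<sigma>
    unfolding bernoulli_weight_def magnetization_def w_def sum_distrib_left
    by (simp add: exp_sum prod.distrib)
  then have "(\<Sum>\<sigma>\<in>spins n. bw n \<sigma> * exp (l * magnetization n \<sigma>)) =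
    (\<Prod>i=1..n. \<Sum>v\<in>{-1,1}. w i v)"
    unfolding spins_def by (subst prod_sum_PiE) auto
  also have "\<dots> = (\<Prod>i=1..n. exp (L_fun (f ((T ^^ i) x)) l))"
    using spin_mgf_pos[OF f01] by (intro prod.cong) (auto simp: w_def L_fun_def add.commute)
  finally show ?thesis by (simp add: exp_sum)
qed

lemma bernoulli_mgf_emp_mean:
  assumes "n \<ge> 1"
  shows "(\<Sum>\<sigma>\<in>spins n. bw n \<sigma> * exp (l * magnetization n \<sigma>)) =
    exp (real n * Lam_n n l)"
  using assms by (simp add: bernoulli_mgf emp_mean_def)

lemma sum_bernoulli_weight: "(\<Sum>\<sigma>\<in>spins n. bw n \<sigma>) = 1"
  using bernoulli_mgf[of n 0] by (simp add: L_fun_def)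

lemma gibbs_weight_nonneg: "0 \<le> gw n \<sigma>"
  by (simp add: gibbs_weight_eq bernoulli_weight_nonneg)

text \<open>The interaction factor is at least 1 and the Bernoulli weights sum to 1. Every
  normalization by \<open>Z n\<close> is thereby legitimate, also at \<open>n = 0\<close>.\<close>

lemma partition_fun_ge_1: "1 \<le> Z n"
proof -
  have "1 = (\<Sum>\<sigma>\<in>spins n. bw n \<sigma>)" by (simp add: sum_bernoulli_weight)
  also have "\<dots> \<le> Z n"
    unfolding partition_fun_def gibbs_weight_eq
  proof (rule sum_mono)
    fix \<sigma>
    have "1 * bw n \<sigma> \<le> exp (\<beta> * J / (2 * real n) * (magnetization n \<sigma>)\<^sup>2) * bw n \<sigma>"
      using \<beta> J by (intro mult_right_mono bernoulli_weight_nonneg) auto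
    then show "bw n \<sigma> \<le> exp (\<beta> * J / (2 * real n) * (magnetization n \<sigma>)\<^sup>2) * bw n \<sigma>"
      by simp
  qed
  finally show ?thesis .
qed

lemma integral_gibbs:
  "(\<integral>\<sigma>. h \<sigma> \<partial>gibbs \<beta> J T f n x) =
    (\<Sum>\<sigma>\<in>spins n. gw n \<sigma> * h \<sigma>) / Z n" for h :: "_ \<Rightarrow> real"
  unfolding gibbs_def partition_fun_def[symmetric] using partition_fun_ge_1[of n]
  by (subst lebesgue_integral_point_measure_finite)
     (auto simp: gibbs_weight_nonneg sum_divide_distrib)

lemma real_distribution_mean_magnetization:
  "real_distribution (Q n)"
proof -
  have "emeasure (gibbs \<beta> J T f n x) (spins n) =
      (\<Sum>\<sigma>\<in>spins n. ennreal (gw n \<sigma> / Z n))"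
    unfolding gibbs_def partition_fun_def by (subst emeasure_point_measure_finite) auto
  also have "\<dots> = ennreal (\<Sum>\<sigma>\<in>spins n. gw n \<sigma> / Z n)"
    using partition_fun_ge_1[of n] by (intro sum_ennreal) (auto simp: gibbs_weight_nonneg)
  also have "\<dots> = 1"
    using partition_fun_ge_1[of n] by (simp flip: sum_divide_distrib add: partition_fun_def)
  finally have "prob_space (gibbs \<beta> J T f n x)"
    by (intro prob_spaceI) (simp add: gibbs_def space_point_measure)
  then interpret prob_space "gibbs \<beta> J T f n x" .
  show ?thesis
    unfolding mean_magnetization_distr_def real_distribution_def real_distribution_axioms_def
    by (intro conjI prob_space_distr) (simp_all add: gibbs_def)
qed

lemma integral_mean_magnetization:
  fixes h :: "real \<Rightarrow> real"
  assumes "h \<in> borel_measurable borel"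
  shows "(\<integral>s. h s \<partial>Q n) =
    (\<Sum>\<sigma>\<in>spins n. gw n \<sigma> * h (mbar n \<sigma>)) / Z n"
  unfolding mean_magnetization_distr_def
  by (subst integral_distr) (auto simp: gibbs_def[symmetric] integral_gibbs assms, auto simp: gibbs_def)

lemma measure_mean_magnetization:
  assumes "B \<in> sets borel"
  shows "measure (Q n) B =
    (\<Sum>\<sigma>\<in>{\<sigma>\<in>spins n. mbar n \<sigma> \<in> B}. gw n \<sigma>) / Z n"
proof -
  interpret real_distribution "Q n"
    by (rule real_distribution_mean_magnetization)
  have "measure (Q n) B = (\<integral>s. indicator B s \<partial>Q n)"
    using assms by simp
  also have "\<dots> = (\<Sum>\<sigma>\<in>spins n. gw n \<sigma> * indicator B (mbar n \<sigma>)) / Z n"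
    using assms by (intro integral_mean_magnetization) auto
  also have "(\<Sum>\<sigma>\<in>spins n. gw n \<sigma> * indicator B (mbar n \<sigma>)) =
      (\<Sum>\<sigma>\<in>{\<sigma>\<in>spins n. mbar n \<sigma> \<in> B}. gw n \<sigma>)"
    by (intro sum.mono_neutral_cong_right) (auto simp: indicator_def)
  finally show ?thesis .
qed

text \<open>Completing the square: with this variance the quadratic terms in the magnetization
  cancel. What remains is linear in it, so the sum is the generating function of independent spins
  at \<open>\<beta> * J * s\<close>.\<close>

lemma hubbard_stratonovich:
  assumes n: "n \<ge> 1"
  shows "(\<Sum>\<sigma>\<in>spins n. gw n \<sigma> *
      normal_density (mbar n \<sigma>) (1 / sqrt (real n * (\<beta> * J))) s) =
    sqrt (real n * (\<beta> * J) / (2 * pi)) * boltz n s"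
proof -
  define c where "c = \<beta> * J"
  have c: "c > 0" using \<beta> J by (simp add: c_def)
  have var: "(1 / sqrt (real n * c))\<^sup>2 = 1 / (real n * c)" using c by (simp add: power_divide)
  have nd: "normal_density m (1 / sqrt (real n * c)) s = sqrt (real n * c / (2 * pi)) * exp (- (real n * c * (s - m)\<^sup>2 / 2))" for m
  proof -
    have "1 / sqrt (2 * pi * (1 / (real n * c))) = sqrt (real n * c / (2 * pi))"
      by (simp add: real_sqrt_divide)
    moreover have "- (s - m)\<^sup>2 / (2 * (1 / (real n * c))) = - (real n * c * (s - m)\<^sup>2 / 2)" by simp
    ultimately show ?thesis unfolding normal_density_def var by (simp only:)
  qed
  have "gw n \<sigma> * normal_density (mbar n \<sigma>) (1 / sqrt (real n * c)) s =
      sqrt (real n * c / (2 * pi)) * exp (- (real n * c * s\<^sup>2 / 2)) *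
      (bw n \<sigma> * exp (c * s * magnetization n \<sigma>))" for \<sigma>
  proof -
    define m where "m = magnetization n \<sigma>"
    have "exp (c / (2 * real n) * m\<^sup>2) * exp (- (real n * c * (s - m / real n)\<^sup>2 / 2))
       = exp (c / (2 * real n) * m\<^sup>2 - real n * c * (s - m / real n)\<^sup>2 / 2)"
      by (simp flip: exp_add)
    also have "c / (2 * real n) * m\<^sup>2 - real n * c * (s - m / real n)\<^sup>2 / 2 = - (real n * c * s\<^sup>2 / 2) + c * s * m"
      using n by (simp add: field_simps power2_eq_square)
    finally have "exp (c / (2 * real n) * m\<^sup>2) * exp (- (real n * c * (s - m / real n)\<^sup>2 / 2))
       = exp (- (real n * c * s\<^sup>2 / 2)) * exp (c * s * m)" by (simp only: exp_add)
    moreover have "p * e1 = e2 * e3 \<Longrightarrow> p * b * (k * e1) = k * e2 * (b * e3)" for p e1 e2 e3 b k :: real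
      by algebra
    ultimately show ?thesis
      unfolding gibbs_weight_eq nd c_def[symmetric] m_def[symmetric] by blast
  qed
  then have "(\<Sum>\<sigma>\<in>spins n. gw n \<sigma> * normal_density (mbar n \<sigma>) (1 / sqrt (real n * c)) s)
    = sqrt (real n * c / (2 * pi)) * exp (- (real n * c * s\<^sup>2 / 2)) * exp (\<Sum>i=1..n. L_fun (f ((T ^^ i) x)) (c * s))"
    by (simp add: bernoulli_mgf flip: sum_distrib_left)
  also have "\<dots> = sqrt (real n * c / (2 * pi)) * boltz n s"
  proof -
    have "- (real n * c * s\<^sup>2 / 2) + (\<Sum>i=1..n. L_fun (f ((T ^^ i) x)) (c * s)) = - (real n * Gn n s)"
      using n by (simp add: G_emp_def c_def field_simps)
    then show ?thesis by (simp only: mult.assoc exp_add[symmetric])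
  qed
  finally show ?thesis by (simp add: c_def)
qed

text \<open>Both integrals carry the same Gaussian prefactor, so their quotient is exactly the Gibbs
  mean of the smoothed \<open>h\<close>. The variance tends to 0, and
  \<open>normal_smoothing\<close> is uniform over all configurations.\<close>

lemma gibbs_expectation_smoothing:
  fixes h :: "real \<Rightarrow> real"
  assumes h: "continuous_on UNIV h" and B: "\<And>s. \<bar>h s\<bar> \<le> B"
  shows "(\<lambda>n. gibbs_mean n h
     - lap n h / (\<integral>s. boltz n s \<partial>lborel)) \<longlonglongrightarrow> 0"
proof (rule LIMSEQ_I)
  fix e :: real assume e: "e > 0"
  define c where "c = \<beta> * J"
  have c: "c > 0" using \<beta> J by (simp add: c_def)
  obtain C where C: "C \<ge> 0" "\<And>m sd. \<bar>m\<bar> \<le> 1 \<Longrightarrow> sd > 0 \<Longrightarrow>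
      \<bar>h m - (\<integral>s. normal_density m sd s * h s \<partial>lborel)\<bar> \<le> e / 2 + C * sd\<^sup>2"
    using normal_smoothing[OF h B, of "e / 2"] e by auto
  have hm: "h \<in> borel_measurable borel" using h by (rule borel_measurable_continuous_onI)
  have B0: "B \<ge> 0" using B[of 0] by linarith
  have key: "\<bar>gibbs_mean n h
     - lap n h / (\<integral>s. boltz n s \<partial>lborel)\<bar>
     \<le> e / 2 + C / (real n * c)" if n: "n \<ge> 1" for n
  proof -
    define sd where "sd = 1 / sqrt (real n * c)"
    define \<kappa> where "\<kappa> = sqrt (real n * c / (2 * pi))"
    define w where "w = gw n"
    define p where "p = Z n"
    define N where "N \<sigma> = normal_density (mbar n \<sigma>) sd" for \<sigma>
    have sd: "sd > 0" using n c by (simp add: sd_def)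
    have \<kappa>: "\<kappa> > 0" using n c by (simp add: \<kappa>_def)
    have p: "p > 0" using partition_fun_ge_1[of n] by (simp add: p_def)
    have HS: "\<kappa> * boltz n s = (\<Sum>\<sigma>\<in>spins n. w \<sigma> * N \<sigma> s)" for s
      using hubbard_stratonovich[OF n, of s] by (simp add: \<kappa>_def w_def N_def sd_def c_def)
    have int1: "integrable lborel (\<lambda>s. N \<sigma> s * h s)" for \<sigma>
    proof (rule Bochner_Integration.integrable_bound)
      show "integrable lborel (\<lambda>s. B * N \<sigma> s)" using sd by (simp add: N_def)
      show "AE s in lborel. norm (N \<sigma> s * h s) \<le> norm (B * N \<sigma> s)"
        using B B0 by (intro AE_I2) (simp add: N_def abs_mult mult.commute[of B] mult_left_mono)
    qed (use hm in \<open>simp add: N_def\<close>)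
    have "\<kappa> * (\<integral>s. boltz n s \<partial>lborel) = (\<integral>s. (\<Sum>\<sigma>\<in>spins n. w \<sigma> * N \<sigma> s) \<partial>lborel)"
      by (simp flip: HS)
    also have "\<dots> = (\<Sum>\<sigma>\<in>spins n. w \<sigma> * (\<integral>s. N \<sigma> s \<partial>lborel))"
      using sd by (subst Bochner_Integration.integral_sum) (auto simp: N_def)
    also have "\<dots> = p" using sd by (simp add: N_def p_def partition_fun_def w_def)
    finally have I1: "\<kappa> * (\<integral>s. boltz n s \<partial>lborel) = p" .
    have "\<kappa> * lap n h =
        (\<integral>s. h s * (\<kappa> * boltz n s) \<partial>lborel)"
      by (simp add: mult.left_commute)
    also have "\<dots> = (\<integral>s. (\<Sum>\<sigma>\<in>spins n. w \<sigma> * (N \<sigma> s * h s)) \<partial>lborel)"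
      unfolding HS by (simp add: sum_distrib_left mult_ac)
    also have "\<dots> = (\<Sum>\<sigma>\<in>spins n. w \<sigma> * (\<integral>s. N \<sigma> s * h s \<partial>lborel))"
      using int1 by (subst Bochner_Integration.integral_sum) auto
    finally have I2: "\<kappa> * lap n h =
        (\<Sum>\<sigma>\<in>spins n. w \<sigma> * (\<integral>s. N \<sigma> s * h s \<partial>lborel))" .
    have "lap n h / (\<integral>s. boltz n s \<partial>lborel)
      = (\<Sum>\<sigma>\<in>spins n. w \<sigma> * (\<integral>s. N \<sigma> s * h s \<partial>lborel)) / p"
      using \<kappa> by (simp flip: I1 I2)
    then have eq: "gibbs_mean n h
     - lap n h / (\<integral>s. boltz n s \<partial>lborel)
     = (\<Sum>\<sigma>\<in>spins n. w \<sigma> * (h (mbar n \<sigma>) - (\<integral>s. N \<sigma> s * h s \<partial>lborel))) / p"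
      by (simp add: integral_gibbs w_def p_def right_diff_distrib sum_subtractf diff_divide_distrib)
    have "\<bar>w \<sigma> * (h (mbar n \<sigma>) - (\<integral>s. N \<sigma> s * h s \<partial>lborel))\<bar> \<le> w \<sigma> * (e / 2 + C * sd\<^sup>2)"
      if "\<sigma> \<in> spins n" for \<sigma>
      using C(2)[OF magnetization_bound[OF that] sd]
      by (simp add: abs_mult w_def gibbs_weight_nonneg N_def mult_left_mono)
    then have "\<bar>\<Sum>\<sigma>\<in>spins n. w \<sigma> * (h (mbar n \<sigma>) - (\<integral>s. N \<sigma> s * h s \<partial>lborel))\<bar>
        \<le> (\<Sum>\<sigma>\<in>spins n. w \<sigma> * (e / 2 + C * sd\<^sup>2))"
      by (intro order_trans[OF sum_abs] sum_mono)
    then have "\<bar>(\<Sum>\<sigma>\<in>spins n. w \<sigma> * (h (mbar n \<sigma>) - (\<integral>s. N \<sigma> s * h s \<partial>lborel))) / p\<bar>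
        \<le> (\<Sum>\<sigma>\<in>spins n. w \<sigma> * (e / 2 + C * sd\<^sup>2)) / p"
      using p by (simp add: divide_right_mono del: sum_divide_distrib)
    also have "\<dots> = e / 2 + C * sd\<^sup>2"
      using p by (simp add: p_def w_def partition_fun_def flip: sum_distrib_right)
    also have "C * sd\<^sup>2 = C / (real n * c)" using c by (simp add: sd_def power_divide)
    finally show ?thesis unfolding eq .
  qed
  have "(\<lambda>n. C / c / real n) \<longlonglongrightarrow> 0" by (rule lim_const_over_n)
  then have "eventually (\<lambda>n. C / c / real n < e / 2) sequentially"
    using e by (intro order_tendstoD) auto
  then have "eventually (\<lambda>n. norm (gibbs_mean n h
     - lap n h / (\<integral>s. boltz n s \<partial>lborel) - 0) < e) sequentially"
    using eventually_ge_at_top[of 1]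
  proof eventually_elim
    case (elim n)
    have "C / (real n * c) = C / c / real n" by (simp add: mult.commute)
    with key[OF elim(2)] elim(1) show ?case
      unfolding real_norm_def diff_0_right by linarith
  qed
  then show "\<exists>no. \<forall>n\<ge>no. norm (gibbs_mean n h
     - lap n h / (\<integral>s. boltz n s \<partial>lborel) - 0) < e"
    by (simp only: eventually_sequentially)
qed

end

section \<open>Large deviations\<close>

lemma eventually_exp_mult_le:
  fixes a :: "nat \<Rightarrow> real"
  assumes a: "a \<longlonglongrightarrow> a0" "a0 < 0" and r: "r > 0"
  shows "eventually (\<lambda>n. exp (real n * a n) \<le> r) sequentially"
proof -
  have "eventually (\<lambda>n. a n < a0 / 2) sequentially"
    using a by (intro order_tendstoD(2)) auto
  moreover have "eventually (\<lambda>n. real n \<ge> 2 * ln r / a0) sequentially"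
    by (rule eventually_ge_at_top[THEN filterlim_real_sequentially[unfolded filterlim_iff, rule_format]])
  ultimately show ?thesis
  proof eventually_elim
    case (elim n)
    have "real n * a n \<le> real n * (a0 / 2)" using elim by (intro mult_left_mono) auto
    also have "\<dots> \<le> ln r" using elim(2) a(2) by (simp add: field_simps)
    finally have "exp (real n * a n) \<le> exp (ln r)" by simp
    then show ?case using r by simp
  qed
qed

text \<open>Left unnormalized, so that the partition function is the mass of the whole line and
  obeys the same bounds as the numerators.\<close>

definition gibbs_mass ::
  "real \<Rightarrow> real \<Rightarrow> ('a \<Rightarrow> 'a) \<Rightarrow> ('a \<Rightarrow> real) \<Rightarrow> nat \<Rightarrow> 'a \<Rightarrow> real set \<Rightarrow> real" where
  "gibbs_mass \<beta> J T f n x B =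
    (\<Sum>\<sigma>\<in>{\<sigma>\<in>spins n. magnetization n \<sigma> / real n \<in> B}. gibbs_weight \<beta> J T f n x \<sigma>)"

text \<open>The setting of the Gaertner-Ellis theorem with a differentiable limit:
  \<open>Lam'_mono\<close> expresses convexity, \<open>Lam_le\<close> makes the Legendre transform
  infinite outside \<open>[-1, 1]\<close>, and \<open>conv\<close> is the ergodic input.\<close>

locale scaled_cumulant_limit = gibbs_system +
  fixes Lam Lam' :: "real \<Rightarrow> real"
  assumes conv: "\<And>l. (\<lambda>n. Lam_n n l) \<longlonglongrightarrow> Lam l"
    and Lam_deriv: "\<And>l. (Lam has_real_derivative Lam' l) (at l)"
    and Lam'_cont: "continuous_on UNIV Lam'"
    and Lam'_mono: "mono Lam'"
    and Lam_0: "Lam 0 = 0"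
    and Lam_le: "\<And>l. Lam l \<le> \<bar>l\<bar>"
begin

abbreviation "mass n \<equiv> gibbs_mass \<beta> J T f n x"

lemma gibbs_mass_mono: "A \<subseteq> B \<Longrightarrow> mass n A \<le> mass n B"
  unfolding gibbs_mass_def
  by (intro sum_mono2) (auto simp: gibbs_weight_nonneg)

lemma gibbs_mass_UNIV: "mass n UNIV = Z n"
  by (simp add: gibbs_mass_def partition_fun_def)

lemma gibbs_mass_nonneg: "0 \<le> mass n B"
  unfolding gibbs_mass_def by (intro sum_nonneg gibbs_weight_nonneg)

text \<open>For each \<open>z\<close> some tilt \<open>l\<close> beats the rate \<open>a\<close> on
  an open set around \<open>z\<close>. Compactness of \<open>C \<inter> {-1..1}\<close> leaves
  finitely many tilts \<open>D\<close>, and each Gibbs weight is at most the sum of the tilted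
  bounds over \<open>D\<close>. The slack \<open>e\<close> absorbs the convergence error and the
  number of tilts.\<close>

lemma gibbs_mass_upper:
  assumes C: "closed C" and a: "\<And>z. z \<in> C \<Longrightarrow> \<bar>z\<bar> \<le> 1 \<Longrightarrow> \<exists>l. a < l * z - Lam l - \<beta> * J / 2 * z\<^sup>2"
    and e: "e > 0"
  shows "eventually (\<lambda>n. mass n C \<le> exp (- (real n * (a - e)))) sequentially"
proof -
  define U where "U l = {z. a < l * z - Lam l - \<beta> * J / 2 * z\<^sup>2}" for l
  have "open (U l)" for l unfolding U_def by (intro open_Collect_less continuous_intros)
  moreover have "compact (C \<inter> {-1..1})" using C by (intro closed_Int_compact) auto
  moreover have "C \<inter> {-1..1} \<subseteq> (\<Union>l. U l)" using a by (fastforce simp: U_def)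
  ultimately obtain D where D: "finite D" "C \<inter> {-1..1} \<subseteq> (\<Union>l\<in>D. U l)"
    using compactE_image[of "C \<inter> {-1..1}" UNIV U] by metis
  have bound: "mass n C \<le>
      (\<Sum>l\<in>D. exp (real n * (Lam_n n l - Lam l - a)))" if n: "n \<ge> 1" for n
  proof -
    define b where "b = bw n"
    have "gw n \<sigma> \<le> (\<Sum>l\<in>D. exp (- (real n * (Lam l + a))) * (b \<sigma> * exp (l * magnetization n \<sigma>)))"
      if \<sigma>: "\<sigma> \<in> spins n" "mbar n \<sigma> \<in> C" for \<sigma>
    proof -
      define z where "z = mbar n \<sigma>"
      have M: "magnetization n \<sigma> = real n * z" using n by (simp add: z_def)
      have "z \<in> C \<inter> {-1..1}" using \<sigma> magnetization_bound[OF \<sigma>(1), folded z_def] by (auto simp: z_def[symmetric])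
      then obtain l where l: "l \<in> D" "a < l * z  - Lam l - \<beta> * J / 2 * z\<^sup>2"
        using D(2) by (auto simp: U_def)
      have "\<beta> * J / (2 * real n) * (real n * z)\<^sup>2 = real n * (\<beta> * J / 2 * z\<^sup>2)"
        using n by (simp add: power2_eq_square)
      also have "\<dots> \<le> real n * (l * z - Lam l - a)"
        using l(2) by (intro mult_left_mono) auto
      also have "\<dots> = - (real n * (Lam l + a)) + l * (real n * z)" by (simp add: algebra_simps)
      finally have "gw n \<sigma> \<le> exp (- (real n * (Lam l + a)) + l * (real n * z)) * b \<sigma>"
        unfolding gibbs_weight_eq M b_def
        by (intro mult_right_mono bernoulli_weight_nonneg) simp
      also have "\<dots> = exp (- (real n * (Lam l + a))) * (b \<sigma> * exp (l * magnetization n \<sigma>))"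
        by (simp only: exp_add M mult_ac)
      also have "\<dots> \<le> (\<Sum>l\<in>D. exp (- (real n * (Lam l + a))) * (b \<sigma> * exp (l * magnetization n \<sigma>)))"
        using l(1) D(1) by (intro member_le_sum) (auto simp: b_def bernoulli_weight_nonneg)
      finally show ?thesis .
    qed
    then have "mass n C \<le> (\<Sum>\<sigma>\<in>{\<sigma>\<in>spins n. mbar n \<sigma> \<in> C}.
        (\<Sum>l\<in>D. exp (- (real n * (Lam l + a))) * (b \<sigma> * exp (l * magnetization n \<sigma>))))"
      unfolding gibbs_mass_def by (intro sum_mono) auto
    also have "\<dots> \<le> (\<Sum>\<sigma>\<in>spins n. (\<Sum>l\<in>D. exp (- (real n * (Lam l + a))) * (b \<sigma> * exp (l * magnetization n \<sigma>))))"
      by (intro sum_mono2) (auto simp: b_def intro!: sum_nonneg mult_nonneg_nonneg bernoulli_weight_nonneg)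
    also have "\<dots> = (\<Sum>l\<in>D. exp (- (real n * (Lam l + a))) * (\<Sum>\<sigma>\<in>spins n. b \<sigma> * exp (l * magnetization n \<sigma>)))"
      by (subst sum.swap) (simp add: sum_distrib_left)
    also have "\<dots> = (\<Sum>l\<in>D. exp (real n * (Lam_n n l - Lam l - a)))"
      unfolding b_def bernoulli_mgf_emp_mean[OF n]
      by (intro sum.cong refl) (simp add: algebra_simps flip: exp_add)
    finally show ?thesis .
  qed
  \<comment> \<open>With this share the sum over \<open>D\<close> is at most 1; the
    \<open>1 +\<close> covers an empty \<open>D\<close>.\<close>
  have "eventually (\<lambda>n. \<forall>l\<in>D. exp (real n * (Lam_n n l - Lam l - e)) \<le> 1 / (1 + real (card D))) sequentially"
  proof (intro eventually_ball_finite[OF D(1)] ballI eventually_exp_mult_le)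
    show "(\<lambda>n. Lam_n n l - Lam l - e) \<longlonglongrightarrow> Lam l - Lam l - e" for l
      by (intro tendsto_intros conv)
  qed (use e in auto)
  then show ?thesis using eventually_ge_at_top[of 1]
  proof eventually_elim
    case (elim n)
    have "exp (real n * (Lam_n n l - Lam l - a))
        = exp (- (real n * (a - e))) * exp (real n * (Lam_n n l - Lam l - e))" for l
      by (simp add: algebra_simps flip: exp_add)
    then have "mass n C \<le> exp (- (real n * (a - e))) *
        (\<Sum>l\<in>D. exp (real n * (Lam_n n l - Lam l - e)))"
      using bound[OF elim(2)] by (simp add: sum_distrib_left)
    also have "\<dots> \<le> exp (- (real n * (a - e))) * 1"
    proof (rule mult_left_mono)
      have "(\<Sum>l\<in>D. exp (real n * (Lam_n n l - Lam l - e))) \<le> (\<Sum>l\<in>D. 1 / (1 + real (card D)))"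
        using elim(1) by (intro sum_mono) auto
      also have "\<dots> \<le> 1" by (simp add: field_simps)
      finally show "(\<Sum>l\<in>D. exp (real n * (Lam_n n l - Lam l - e))) \<le> 1" .
    qed simp
    finally show ?case by simp
  qed
qed

section \<open>Lower bounds by tilting\<close>

text \<open>By convexity \<open>Lam l - l * Lam' 0\<close> is smallest at 0. Consequently the
  Legendre transform is at most 0 at \<open>Lam' 0\<close>.\<close>

lemma Lam_above_tangent: "l * Lam' 0 \<le> Lam l"
proof (cases "l \<ge> 0")
  case True
  then have "Lam 0 - 0 * Lam' 0 \<le> Lam l - l * Lam' 0"
    by (intro DERIV_nonneg_imp_nondecreasing[where f = "\<lambda>l. Lam l - l * Lam' 0"])
       (auto intro!: exI derivative_eq_intros Lam_deriv monoD[OF Lam'_mono])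
  then show ?thesis by (simp add: Lam_0)
next
  case False
  then have "Lam l - l * Lam' 0 \<ge> Lam 0 - 0 * Lam' 0"
    by (intro DERIV_nonpos_imp_nonincreasing[where f = "\<lambda>l. Lam l - l * Lam' 0"])
       (auto intro!: exI derivative_eq_intros Lam_deriv monoD[OF Lam'_mono])
  then show ?thesis by (simp add: Lam_0)
qed

text \<open>Tilting by \<open>l\<close>: under the weights \<open>exp (l M)\<close> the mean magnetization concentrates at
  \<open>Lam' l\<close>, by Chernoff bounds that only use the derivative of \<open>Lam\<close> at \<open>l\<close>.\<close>

lemma tilted_tail:
  assumes d: "d > 0" and s: "\<bar>s\<bar> = 1"
  shows "eventually (\<lambda>n. (\<Sum>\<sigma>\<in>{\<sigma>\<in>spins n. d \<le> s * (mbar n \<sigma> - Lam' l)}.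
      bw n \<sigma> * exp (l * magnetization n \<sigma>))
    \<le> exp (real n * Lam_n n l) / 4) sequentially"
proof -
  have "((\<lambda>h. (Lam (l + h) - Lam l) / h) \<longlongrightarrow> Lam' l) (at 0)"
    using Lam_deriv[of l] by (simp add: DERIV_def)
  then have "eventually (\<lambda>h. dist ((Lam (l + h) - Lam l) / h) (Lam' l) < d) (at 0)"
    using d by (auto dest: tendstoD)
  then obtain r where r: "r > 0" "\<And>h. h \<noteq> 0 \<Longrightarrow> \<bar>h\<bar> < r \<Longrightarrow> \<bar>(Lam (l + h) - Lam l) / h - Lam' l\<bar> < d"
    by (auto simp: eventually_at dist_real_def)
  \<comment> \<open>\<open>t\<close> has the sign of \<open>s\<close>, which selects the tail, and
    is so short that the difference quotient of \<open>Lam\<close> is within \<open>d\<close> of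
    \<open>Lam' l\<close>; this makes the Chernoff exponent negative.\<close>
  define t where "t = s * (r / 2)"
  have st: "s * s = 1" using s by (metis abs_mult_self_eq mult_1)
  have t: "t \<noteq> 0" "\<bar>t\<bar> < r" "\<bar>t\<bar> = s * t" "s * t > 0" using s r st by (auto simp: t_def abs_mult mult.assoc[symmetric])
  have "\<bar>Lam (l + t) - Lam l - t * Lam' l\<bar> = \<bar>t\<bar> * \<bar>(Lam (l + t) - Lam l) / t - Lam' l\<bar>"
    using t(1) by (simp add: field_simps flip: abs_mult)
  also have "\<dots> < s * t * d" using r(2)[OF t(1,2)] t(1) by (simp flip: t(3))
  finally have neg: "Lam (l + t) - Lam l - t * Lam' l - s * t * d < 0" by linarith
  have "eventually (\<lambda>n. exp (real n * (Lam_n n (l + t) - Lam_n n l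
      - t * Lam' l - s * t * d)) \<le> 1 / 4) sequentially"
    by (rule eventually_exp_mult_le[OF _ neg]) (auto intro!: tendsto_intros conv)
  then show ?thesis using eventually_ge_at_top[of 1]
  proof eventually_elim
    case (elim n)
    define b where "b = bw n"
    have "(\<Sum>\<sigma>\<in>{\<sigma>\<in>spins n. d \<le> s * (mbar n \<sigma> - Lam' l)}. b \<sigma> * exp (l * magnetization n \<sigma>))
      \<le> (\<Sum>\<sigma>\<in>{\<sigma>\<in>spins n. d \<le> s * (mbar n \<sigma> - Lam' l)}.
          exp (- (real n * (t * Lam' l + s * t * d))) * (b \<sigma> * exp ((l + t) * magnetization n \<sigma>)))"
    proof (rule sum_mono)
      fix \<sigma> assume "\<sigma> \<in> {\<sigma>\<in>spins n. d \<le> s * (mbar n \<sigma> - Lam' l)}"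
      then have "s * t * d \<le> s * t * (s * (mbar n \<sigma> - Lam' l))"
        using t(4) by (intro mult_left_mono) auto
      also have "\<dots> = t * (mbar n \<sigma> - Lam' l)" using st by algebra
      finally have "real n * (s * t * d) \<le> real n * (t * (mbar n \<sigma> - Lam' l))"
        by (intro mult_left_mono) auto
      also have "\<dots> = t * magnetization n \<sigma> - real n * (t * Lam' l)"
        using elim(2) by (simp add: field_simps)
      finally have "l * magnetization n \<sigma> \<le> - (real n * (t * Lam' l + s * t * d)) + (l + t) * magnetization n \<sigma>"
        by (simp add: algebra_simps)
      then have "b \<sigma> * exp (l * magnetization n \<sigma>) \<le> b \<sigma> * exp (- (real n * (t * Lam' l + s * t * d)) + (l + t) * magnetization n \<sigma>)"
        unfolding b_def by (intro mult_left_mono bernoulli_weight_nonneg) simp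
      then show "b \<sigma> * exp (l * magnetization n \<sigma>) \<le> exp (- (real n * (t * Lam' l + s * t * d))) * (b \<sigma> * exp ((l + t) * magnetization n \<sigma>))"
        by (simp only: exp_add mult_ac)
    qed
    also have "\<dots> \<le> (\<Sum>\<sigma>\<in>spins n. exp (- (real n * (t * Lam' l + s * t * d))) * (b \<sigma> * exp ((l + t) * magnetization n \<sigma>)))"
      by (intro sum_mono2) (auto simp: b_def bernoulli_weight_nonneg)
    also have "\<dots> = exp (- (real n * (t * Lam' l + s * t * d))) * exp (real n * Lam_n n (l + t))"
      unfolding b_def sum_distrib_left[symmetric] bernoulli_mgf_emp_mean[OF elim(2)] ..
    also have "\<dots> = exp (real n * Lam_n n l) *
        exp (real n * (Lam_n n (l + t) - Lam_n n l
      - t * Lam' l - s * t * d))"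
      by (simp add: algebra_simps flip: exp_add)
    also have "\<dots> \<le> exp (real n * Lam_n n l) * (1 / 4)"
      using elim(1) by (intro mult_left_mono) auto
    finally show ?case by (simp add: b_def)
  qed
qed

text \<open>The slack \<open>e\<close> is spent in thirds. On \<open>V\<close> the exponent
  \<open>l * z - c / 2 * z^2\<close>, the cost of removing the tilt, exceeds its value at
  \<open>w\<close> by less than \<open>e / 3\<close>; the other two pay for replacing the empirical
  cumulant by \<open>Lam\<close> and for a factor 1/2.\<close>

lemma gibbs_mass_lower_exposed:
  assumes O: "open O'" "Lam' l \<in> O'" and e: "e > 0"
  shows "eventually (\<lambda>n. exp (- (real n * (l * Lam' l - Lam l - \<beta> * J / 2 * (Lam' l)\<^sup>2 + e))) \<le> mass n O') sequentially"
proof -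
  define w where "w = Lam' l"
  define c where "c = \<beta> * J"
  define V where "V = O' \<inter> {z. l * z - c / 2 * z\<^sup>2 < l * w - c / 2 * w\<^sup>2 + e / 3}"
  have "open V" unfolding V_def using O by (intro open_Int open_Collect_less continuous_intros)
  moreover have "w \<in> V" using O e by (simp add: V_def w_def)
  ultimately obtain d where d: "d > 0" "ball w d \<subseteq> V" by (auto simp: open_contains_ball)
  have "eventually (\<lambda>n. Lam_n n l > Lam l - e / 3) sequentially"
    using conv[of l] e by (intro order_tendstoD(1)) auto
  moreover have "eventually (\<lambda>n. exp (real n * (- (e / 3))) \<le> 1 / 2) sequentially"
    using e by (intro eventually_exp_mult_le) auto
  ultimately show ?thesis
    using tilted_tail[OF d(1) abs_one, of l] tilted_tail[of d "-1" l, OF d(1) abs_neg_one] eventually_ge_at_top[of 1]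
  proof eventually_elim
    case (elim n)
    define b where "b = bw n"
    define g where "g \<sigma> = b \<sigma> * exp (l * magnetization n \<sigma>)" for \<sigma>
    define z where "z \<sigma> = mbar n \<sigma>" for \<sigma>
    define E where "E = exp (real n * Lam_n n l)"
    have n: "n \<ge> 1" using elim by simp
    have g0: "g \<sigma> \<ge> 0" for \<sigma> by (simp add: g_def b_def bernoulli_weight_nonneg)
    have tot: "(\<Sum>\<sigma>\<in>spins n. g \<sigma>) = E"
      unfolding g_def b_def E_def by (rule bernoulli_mgf_emp_mean[OF n])
    have "(\<Sum>\<sigma>\<in>spins n. g \<sigma>) \<le> (\<Sum>\<sigma>\<in>spins n. (if z \<sigma> \<in> ball w d then g \<sigma> else 0)
        + ((if d \<le> 1 * (z \<sigma> - w) then g \<sigma> else 0) + (if d \<le> - 1 * (z \<sigma> - w) then g \<sigma> else 0)))"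
      using g0 by (intro sum_mono) (auto simp: dist_real_def)
    also have "\<dots> = (\<Sum>\<sigma>\<in>{\<sigma>\<in>spins n. z \<sigma> \<in> ball w d}. g \<sigma>)
        + ((\<Sum>\<sigma>\<in>{\<sigma>\<in>spins n. d \<le> 1 * (z \<sigma> - w)}. g \<sigma>) + (\<Sum>\<sigma>\<in>{\<sigma>\<in>spins n. d \<le> - 1 * (z \<sigma> - w)}. g \<sigma>))"
      by (simp only: sum.distrib sum.inter_filter finite_spins)
    also have "\<dots> \<le> (\<Sum>\<sigma>\<in>{\<sigma>\<in>spins n. z \<sigma> \<in> ball w d}. g \<sigma>) + (E / 4 + E / 4)"
      unfolding g_def b_def z_def w_def E_def by (intro add_left_mono add_mono elim)
    \<comment> \<open>Each tail takes at most a quarter of the tilted mass, so half of it lies in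
      the ball.\<close>
    finally have half: "E / 2 \<le> (\<Sum>\<sigma>\<in>{\<sigma>\<in>spins n. z \<sigma> \<in> ball w d}. g \<sigma>)" unfolding tot by simp
    have "exp (- (real n * (l * w - c / 2 * w\<^sup>2 + e / 3))) * (E / 2) \<le>
        exp (- (real n * (l * w - c / 2 * w\<^sup>2 + e / 3))) * (\<Sum>\<sigma>\<in>{\<sigma>\<in>spins n. z \<sigma> \<in> ball w d}. g \<sigma>)"
      using half by (intro mult_left_mono) auto
    also have "\<dots> = (\<Sum>\<sigma>\<in>{\<sigma>\<in>spins n. z \<sigma> \<in> ball w d}. exp (- (real n * (l * w - c / 2 * w\<^sup>2 + e / 3))) * g \<sigma>)"
      by (simp add: sum_distrib_left)
    also have "\<dots> \<le> (\<Sum>\<sigma>\<in>{\<sigma>\<in>spins n. z \<sigma> \<in> ball w d}. gw n \<sigma>)"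
    proof (rule sum_mono)
      fix \<sigma> assume "\<sigma> \<in> {\<sigma>\<in>spins n. z \<sigma> \<in> ball w d}"
      then have "z \<sigma> \<in> V" using d by auto
      then have "real n * (l * z \<sigma> - c / 2 * (z \<sigma>)\<^sup>2) \<le> real n * (l * w - c / 2 * w\<^sup>2 + e / 3)"
        by (intro mult_left_mono) (auto simp: V_def)
      moreover have M: "magnetization n \<sigma> = real n * z \<sigma>" using n by (simp add: z_def)
      moreover have "c / (2 * real n) * (real n * z \<sigma>)\<^sup>2 = real n * (c / 2 * (z \<sigma>)\<^sup>2)"
        using n by (simp add: power2_eq_square)
      ultimately have "- (real n * (l * w - c / 2 * w\<^sup>2 + e / 3)) + l * magnetization n \<sigma> \<le> c / (2 * real n) * (magnetization n \<sigma>)\<^sup>2"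
        by (simp only: M) (simp add: right_diff_distrib distrib_left mult_ac)
      then have "exp (- (real n * (l * w - c / 2 * w\<^sup>2 + e / 3)) + l * magnetization n \<sigma>) * b \<sigma> \<le>  gw n \<sigma>"
        unfolding gibbs_weight_eq b_def c_def by (intro mult_right_mono bernoulli_weight_nonneg) simp
      then show "exp (- (real n * (l * w - c / 2 * w\<^sup>2 + e / 3))) * g \<sigma> \<le> gw n \<sigma>"
        unfolding g_def by (simp only: exp_add mult_ac)
    qed
    also have "\<dots> \<le> mass n O'"
      unfolding gibbs_mass_def using d(2)
      by (intro sum_mono2) (auto simp: gibbs_weight_nonneg z_def V_def)
    finally have main: "exp (- (real n * (l * w - c / 2 * w\<^sup>2 + e / 3))) * (E / 2) \<le> mass n O'" .
    have "exp (- (real n * (l * w - Lam l - c / 2 * w\<^sup>2 + e))) =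
        exp (- (real n * (l * w - c / 2 * w\<^sup>2 + e / 3))) * (exp (real n * (Lam l - e / 3)) * exp (real n * (- (e / 3))))"
      by (simp add: algebra_simps flip: exp_add)
    also have "\<dots> \<le> exp (- (real n * (l * w - c / 2 * w\<^sup>2 + e / 3))) * (E * (1 / 2))"
    proof (intro mult_left_mono mult_mono)
      show "exp (real n * (Lam l - e / 3)) \<le> E"
        using elim(1) unfolding E_def by (simp add: mult_left_mono)
    qed (use elim(2) in \<open>auto simp: E_def\<close>)
    finally show ?case using main by (simp add: w_def c_def)
  qed
qed

text \<open>If \<open>Lam'\<close> stayed on one side of the target \<open>w\<close> along the
  half-line from 0 in the direction of \<open>z - Lam' 0\<close>, then
  \<open>Lam l \<le> l * w\<close> there, and \<open>l * z - Lam l \<ge> l * (z - w)\<close> would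
  exceed \<open>S\<close>. So \<open>w\<close> is passed, and the intermediate value theorem
  applies. \<open>\<tau> > 0\<close> separates \<open>w\<close> from \<open>z\<close> unless
  \<open>z\<close> is already \<open>Lam' 0\<close>.\<close>

lemma Lam'_attains:
  assumes S: "\<And>l. l * z - Lam l \<le> S" and \<tau>: "0 < \<tau>" "\<tau> < 1"
  shows "\<exists>l. Lam' l = (1 - \<tau>) * z + \<tau> * Lam' 0"
proof -
  define w where "w = (1 - \<tau>) * z + \<tau> * Lam' 0"
  have zw: "z - w = \<tau> * (z - Lam' 0)" by (simp add: w_def algebra_simps)
  have w0: "w - Lam' 0 = (1 - \<tau>) * (z - Lam' 0)" by (simp add: w_def algebra_simps)
  consider "z = Lam' 0" | "z > Lam' 0" | "z < Lam' 0" by linarith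
  then show ?thesis
  proof cases
    case 1
    then show ?thesis by (intro exI[of _ 0]) (simp add: algebra_simps)
  next
    case 2
    have pos: "z - w > 0" "w > Lam' 0" using 2 \<tau> w0 by (auto simp: zw) (smt (verit) mult_pos_pos)
    have "\<exists>l\<ge>0. w \<le> Lam' l"
    proof (rule ccontr)
      assume "\<not> ?thesis"
      then have lt: "Lam' l < w" if "l \<ge> 0" for l using that by force
      define l where "l = (\<bar>S\<bar> + 1) / (z - w)"
      have l0: "l \<ge> 0" using pos by (simp add: l_def)
      have "Lam l - l * w \<le> Lam 0 - 0 * w"
        using l0 lt by (intro DERIV_nonpos_imp_nonincreasing[where f = "\<lambda>l. Lam l - l * w"])
           (auto intro!: exI derivative_eq_intros Lam_deriv intro: less_imp_le)
      moreover have "l * (z - w) = \<bar>S\<bar> + 1" using pos by (simp add: l_def)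
      ultimately show False using S[of l] by (simp add: Lam_0 algebra_simps)
    qed
    then obtain l1 where "l1 \<ge> 0" "w \<le> Lam' l1" by blast
    then obtain l where "Lam' l = w"
      using IVT'[of Lam' 0 w l1] pos Lam'_cont by (auto intro: continuous_on_subset)
    then show ?thesis by (auto simp: w_def)
  next
    case 3
    have pos: "w - z > 0" "w < Lam' 0" using 3 \<tau> zw w0 by (smt (verit) mult_pos_neg)+
    have "\<exists>l\<le>0. Lam' l \<le> w"
    proof (rule ccontr)
      assume "\<not> ?thesis"
      then have lt: "Lam' l > w" if "l \<le> 0" for l using that by force
      define l where "l = - ((\<bar>S\<bar> + 1) / (w - z))"
      have l0: "l \<le> 0" using pos by (simp add: l_def)
      have "Lam l - l * w \<le> Lam 0 - 0 * w"
        using l0 lt by (intro DERIV_nonneg_imp_nondecreasing[where f = "\<lambda>l. Lam l - l * w"])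
           (auto intro!: exI derivative_eq_intros Lam_deriv intro: less_imp_le)
      moreover have "l * (z - w) = \<bar>S\<bar> + 1" using pos by (simp add: l_def field_simps)
      ultimately show False using S[of l] by (simp add: Lam_0 algebra_simps)
    qed
    then obtain l1 where "l1 \<le> 0" "Lam' l1 \<le> w" by blast
    then obtain l where "Lam' l = w"
      using IVT'[of Lam' l1 w 0] pos Lam'_cont by (auto intro: continuous_on_subset)
    then show ?thesis by (auto simp: w_def)
  qed
qed

text \<open>Points of the effective domain that are not of the form \<open>Lam' l\<close> (its end points) are
  approached along the segment towards \<open>Lam' 0\<close>.\<close>

lemma gibbs_mass_lower:
  assumes O: "open O'" "z \<in> O'" and S: "\<And>l. l * z - Lam l \<le> S" and e: "e > 0"
  shows "eventually (\<lambda>n. exp (- (real n * (S - \<beta> * J / 2 * z\<^sup>2 + e))) \<le> mass n O') sequentially"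
proof -
  define c where "c = \<beta> * J"
  define V where "V = O' \<inter> {w. - (c / 2 * w\<^sup>2) < - (c / 2 * z\<^sup>2) + e / 2}"
  have "open V" unfolding V_def using O by (intro open_Int open_Collect_less continuous_intros)
  moreover have "z \<in> V" using O e by (simp add: V_def)
  moreover have "((\<lambda>\<tau>. (1 - \<tau>) * z + \<tau> * Lam' 0) \<longlongrightarrow> (1 - 0) * z + 0 * Lam' 0) (at_right 0)"
    by (intro tendsto_intros)
  ultimately have "eventually (\<lambda>\<tau>. (1 - \<tau>) * z + \<tau> * Lam' 0 \<in> V) (at_right 0)"
    by (intro topological_tendstoD) auto
  moreover have "eventually (\<lambda>\<tau>::real. \<tau> \<in> {0<..<1}) (at_right 0)"
    by (rule eventually_at_right_real) simp
  ultimately have "eventually (\<lambda>\<tau>. (1 - \<tau>) * z + \<tau> * Lam' 0 \<in> V \<and> \<tau> \<in> {0<..<1}) (at_right 0)"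
    by eventually_elim auto
  then obtain \<tau> where \<tau>: "(1 - \<tau>) * z + \<tau> * Lam' 0 \<in> V" "0 < \<tau>" "\<tau> < 1"
    using eventually_happens'[OF trivial_limit_at_right_real] by (metis (no_types, lifting) greaterThanLessThan_iff)
  obtain l where l: "Lam' l = (1 - \<tau>) * z + \<tau> * Lam' 0"
    using Lam'_attains[OF S \<tau>(2,3)] by blast
  have S0: "0 \<le> S" using S[of 0] by (simp add: Lam_0)
  \<comment> \<open>Convexity of the Legendre transform along the segment, written out for the
    \<open>l\<close> just found; the second term is at most 0 because \<open>Lam\<close> lies above
    its tangent at 0.\<close>
  have "l * Lam' l - Lam l = (1 - \<tau>) * (l * z - Lam l) + \<tau> * (l * Lam' 0 - Lam l)"
    unfolding l by (simp add: algebra_simps)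
  also have "\<dots> \<le> (1 - \<tau>) * S + \<tau> * 0"
    using \<tau> S Lam_above_tangent[of l] by (intro add_mono mult_left_mono) auto
  also have "\<dots> \<le> S" using S0 \<tau> by (simp add: algebra_simps)
  finally have le: "l * Lam' l - Lam l - c / 2 * (Lam' l)\<^sup>2 + e / 2 \<le> S - c / 2 * z\<^sup>2 + e"
    using \<tau>(1) by (simp add: V_def l)
  have "eventually (\<lambda>n. exp (- (real n * (l * Lam' l - Lam l - \<beta> * J / 2 * (Lam' l)\<^sup>2 + e / 2))) \<le> mass n O') sequentially"
    using \<tau>(1) e O by (intro gibbs_mass_lower_exposed) (auto simp: V_def l)
  then show ?thesis
  proof eventually_elim
    case (elim n)
    have "exp (- (real n * (S - c / 2 * z\<^sup>2 + e))) \<le> exp (- (real n * (l * Lam' l - Lam l - c / 2 * (Lam' l)\<^sup>2 + e / 2)))"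
      using le by (simp add: mult_left_mono)
    then show ?case using elim unfolding c_def by (rule order_trans)
  qed
qed

end

section \<open>From exponential mass bounds to the large deviation principle\<close>

lemma ereal_less_minus_real_iff: "e < x - ereal r \<longleftrightarrow> e + ereal r < x"
  by (cases e; cases x) auto

context scaled_cumulant_limit
begin

definition unnormalized_rate :: "real \<Rightarrow> ereal" where
  "unnormalized_rate z = (SUP l. ereal (l * z - Lam l)) - ereal (\<beta> * J / 2 * z\<^sup>2)"

text \<open>A strict lower bound on a supremum is witnessed by a single \<open>l\<close>. This
  reduces extended-real statements to real ones and exhibits the rate as a supremum of continuous
  functions.\<close>

lemma less_unnormalized_rate_iff:
  "e < unnormalized_rate z \<longleftrightarrow> (\<exists>l. e < ereal (l * z - Lam l - \<beta> * J / 2 * z\<^sup>2))"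
proof -
  have "e < unnormalized_rate z \<longleftrightarrow> (\<exists>l. e + ereal (\<beta> * J / 2 * z\<^sup>2) < ereal (l * z - Lam l))"
    unfolding unnormalized_rate_def ereal_less_minus_real_iff less_SUP_iff by simp
  also have "\<dots> \<longleftrightarrow> (\<exists>l. e < ereal (l * z - Lam l - \<beta> * J / 2 * z\<^sup>2))"
    by (cases e) (auto simp: algebra_simps)
  finally show ?thesis .
qed

text \<open>A tilt of size \<open>q\<close> in the direction of \<open>z\<close> gains at least
  \<open>q * (\<bar>z\<bar> - 1)\<close>, which is unbounded in \<open>q\<close>.\<close>

lemma unnormalized_rate_outside:
  assumes "\<bar>z\<bar> > 1" shows "unnormalized_rate z = \<infinity>"
proof -
  have "ereal r < unnormalized_rate z" for r
  proof -
    define q where "q = (\<bar>r\<bar> + 1 + \<beta> * J / 2 * z\<^sup>2) / (\<bar>z\<bar> - 1)"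
    have "0 \<le> \<beta> * J / 2 * z\<^sup>2" using \<beta> J by simp
    then have q: "q \<ge> 0" "q * (\<bar>z\<bar> - 1) = \<bar>r\<bar> + 1 + \<beta> * J / 2 * z\<^sup>2"
      using assms by (auto simp: q_def)
    have "q * \<bar>z\<bar> - q \<le> sgn z * q * z - Lam (sgn z * q)"
      using Lam_le[of "sgn z * q"] q(1) assms by (auto simp: abs_mult sgn_if split: if_splits)
    then have "r < sgn z * q * z - Lam (sgn z * q) - \<beta> * J / 2 * z\<^sup>2"
      using q(2) by (simp add: right_diff_distrib)
    then show ?thesis by (subst less_unnormalized_rate_iff) auto
  qed
  then show ?thesis by (intro ereal_top less_imp_le)
qed

lemma gibbs_mass_upper_ereal:
  assumes C: "closed C" and a: "ereal a < (INF z\<in>C. unnormalized_rate z)"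
  shows "eventually (\<lambda>n. mass n C \<le> exp (- (real n * a))) sequentially"
proof -
  obtain a' where a': "ereal a < a'" "a' < (INF z\<in>C. unnormalized_rate z)" using dense[OF a] by blast
  then obtain r where r: "a' = ereal r" by (cases a') auto
  have "\<exists>l. r < l * z - Lam l - \<beta> * J / 2 * z\<^sup>2" if "z \<in> C" for z
  proof -
    have "ereal r < unnormalized_rate z"
      using a'(2) that unfolding r by (meson INF_lower less_le_trans)
    then show ?thesis by (simp add: less_unnormalized_rate_iff)
  qed
  then have "eventually (\<lambda>n. mass n C \<le> exp (- (real n * (r - (r - a))))) sequentially"
    using a'(1) r C by (intro gibbs_mass_upper) auto
  then show ?thesis by simp
qed

lemma gibbs_mass_lower_ereal:
  assumes O: "open O'" "z \<in> O'" and b: "unnormalized_rate z < ereal b"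
  shows "eventually (\<lambda>n. exp (- (real n * b)) \<le> mass n O') sequentially"
proof -
  obtain b' where b': "unnormalized_rate z < b'" "b' < ereal b" using dense[OF b] by blast
  then obtain r where r: "b' = ereal r" by (cases b') auto
  have "l * z - Lam l \<le> r + \<beta> * J / 2 * z\<^sup>2" for l
  proof -
    have "\<not> ereal r < unnormalized_rate z" using b'(1) r by simp
    then have "\<not> ereal r < ereal (l * z - Lam l - \<beta> * J / 2 * z\<^sup>2)" by (metis less_unnormalized_rate_iff)
    then show ?thesis by simp
  qed
  then have "eventually (\<lambda>n. exp (- (real n * ((r + \<beta> * J / 2 * z\<^sup>2) - \<beta> * J / 2 * z\<^sup>2 + (b - r)))) \<le> mass n O') sequentially"
    using b'(2) r by (intro gibbs_mass_lower[OF O]) auto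
  then show ?thesis by simp
qed

text \<open>Finiteness excludes \<open>\<infinity> - \<infinity>\<close> in the normalized rate.
  From below, \<open>l = 0\<close> suffices on \<open>[-1, 1]\<close>, the extra 1 providing the
  strict inequality of the criterion; from above, the rate at \<open>Lam' 0\<close> is at most
  0.\<close>

lemma infimum_unnormalized_rate:
  obtains k where "(INF z. unnormalized_rate z) = ereal k"
proof -
  have "ereal (- (\<beta> * J / 2)) - 1 \<le> (INF z. unnormalized_rate z)"
  proof (rule INF_greatest)
    fix z
    show "ereal (- (\<beta> * J / 2)) - 1 \<le> unnormalized_rate z"
    proof (cases "\<bar>z\<bar> > 1")
      case False
      then have "z\<^sup>2 \<le> 1" by (simp add: abs_square_le_1)
      then have "\<beta> * J / 2 * z\<^sup>2 \<le> \<beta> * J / 2" using \<beta> J by (simp add: mult_left_le)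
      then have "ereal (- (\<beta> * J / 2)) - 1 < ereal (0 * z - Lam 0 - \<beta> * J / 2 * z\<^sup>2)"
        by (simp add: Lam_0 one_ereal_def)
      then have "ereal (- (\<beta> * J / 2)) - 1 < unnormalized_rate z" by (subst less_unnormalized_rate_iff) blast
      then show ?thesis by simp
    qed (simp add: unnormalized_rate_outside)
  qed
  moreover have "(INF z. unnormalized_rate z) \<le> ereal 0"
  proof -
    have "l * Lam' 0 - Lam l \<le> 0" for l
      using Lam_above_tangent[of l] by simp
    then have "l * Lam' 0 - Lam l - \<beta> * J / 2 * (Lam' 0)\<^sup>2 \<le> 0" for l
      using \<beta> J by (smt (verit) divide_nonneg_nonneg mult_nonneg_nonneg zero_le_power2)
    then have "\<not> ereal 0 < unnormalized_rate (Lam' 0)"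
      unfolding less_unnormalized_rate_iff by (auto simp: not_less)
    then show ?thesis by (meson INF_lower UNIV_I order_trans not_less)
  qed
  ultimately show ?thesis using that by (cases "INF z. unnormalized_rate z") (auto simp: one_ereal_def)
qed

context
  fixes \<mu> :: "'a measure"
  assumes Lam_eq: "Lambda f \<mu> = Lam"
begin

abbreviation "rate \<equiv> rate_fun \<beta> J f \<mu>"

lemma rate_fun_eq:
  assumes "(INF z. unnormalized_rate z) = ereal k"
  shows "rate z = unnormalized_rate z - ereal k"
  using assms by (simp add: rate_fun_def unnormalized_rate_def Lambda_star_def Lam_eq)

lemma less_rate_fun_iff:
  assumes k: "(INF z. unnormalized_rate z) = ereal k"
  shows "e < rate z \<longleftrightarrow> (\<exists>l. e < ereal (l * z - Lam l - \<beta> * J / 2 * z\<^sup>2 - k))"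
proof -
  have "e < rate z \<longleftrightarrow> (\<exists>l. e + ereal k < ereal (l * z - Lam l - \<beta> * J / 2 * z\<^sup>2))"
    unfolding rate_fun_eq[OF k] ereal_less_minus_real_iff less_unnormalized_rate_iff ..
  also have "\<dots> \<longleftrightarrow> (\<exists>l. e < ereal (l * z - Lam l - \<beta> * J / 2 * z\<^sup>2 - k))"
    by (cases e) (auto simp: algebra_simps)
  finally show ?thesis .
qed

lemma good_rate_function_rate_fun: "good_rate_function (rate)"
proof -
  obtain k where k: "(INF z. unnormalized_rate z) = ereal k" by (rule infimum_unnormalized_rate)
  have op: "open {z. e < rate z}" for e
  proof -
    have "{z. e < rate z} = (\<Union>l. {z. e < ereal (l * z - Lam l - \<beta> * J / 2 * z\<^sup>2 - k)})"
      by (auto simp: less_rate_fun_iff[OF k])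
    also have "open \<dots>" by (intro open_UN ballI open_Collect_less continuous_intros)
    finally show ?thesis .
  qed
  have "0 \<le> rate z" for z
  proof -
    have "ereal k \<le> unnormalized_rate z" unfolding k[symmetric] by (rule INF_lower) simp
    then show ?thesis unfolding rate_fun_eq[OF k] by (cases "unnormalized_rate z") auto
  qed
  moreover have "compact {z. rate z \<le> ereal e}" for e
  proof -
    have "closed {z. rate z \<le> ereal e}"
      using op[of "ereal e"] by (simp add: closed_def Collect_neg_eq[symmetric] not_le)
    moreover have "{z. rate z \<le> ereal e} \<subseteq> {-1..1}"
    proof
      fix z assume "z \<in> {z. rate z \<le> ereal e}"
      then have "\<not> \<bar>z\<bar> > 1" using unnormalized_rate_outside[of z] by (auto simp: rate_fun_eq[OF k])
      then show "z \<in> {-1..1}" by (auto simp: abs_le_iff)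
    qed
    ultimately show ?thesis
      using compact_Int_closed[of "{-1..1}" "{z. rate z \<le> ereal e}"] by (simp add: Int_absorb1)
  qed
  ultimately show ?thesis using op by (simp add: good_rate_function_def)
qed

lemma partition_fun_bounds:
  assumes k: "(INF z. unnormalized_rate z) = ereal k" and e: "e > 0"
  shows "eventually (\<lambda>n. exp (- (real n * (k + e))) \<le> Z n) sequentially"
    and "eventually (\<lambda>n. Z n \<le> exp (- (real n * (k - e)))) sequentially"
proof -
  have "(INF z. unnormalized_rate z) < ereal (k + e)" using e k by simp
  then obtain z where "unnormalized_rate z < ereal (k + e)" by (auto simp: INF_less_iff)
  then show "eventually (\<lambda>n. exp (- (real n * (k + e))) \<le> Z n) sequentially"
    using gibbs_mass_lower_ereal[of UNIV z "k + e"] by (simp add: gibbs_mass_UNIV)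
  show "eventually (\<lambda>n. Z n \<le> exp (- (real n * (k - e)))) sequentially"
    using gibbs_mass_upper_ereal[of UNIV "k - e"] e k by (simp add: gibbs_mass_UNIV)
qed

lemma measure_eq_gibbs_mass:
  assumes "B \<in> sets borel"
  shows "measure (Q n) B = mass n B / Z n"
  using measure_mean_magnetization[OF assms] by (simp add: gibbs_mass_def)

lemma LDP_upper:
  assumes B: "B \<in> sets borel"
  shows "limsup (\<lambda>n. ereal (1 / real n) * ereal_log (measure (Q n) B))
    \<le> - (INF z\<in>closure B. rate z)"
proof (rule dense_ge)
  obtain k where k: "(INF z. unnormalized_rate z) = ereal k" by (rule infimum_unnormalized_rate)
  fix y assume y: "- (INF z\<in>closure B. rate z) < y"
  show "limsup (\<lambda>n. ereal (1 / real n) * ereal_log (measure (Q n) B)) \<le> y"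
  proof (cases y)
    case (real d)
    have "ereal (- d) < (INF z\<in>closure B. rate z)"
      using y real by (metis ereal_uminus_less_reorder uminus_ereal.simps(1))
    \<comment> \<open>\<open>a\<close> is the rate given to the numerator and the gap
      \<open>a + d > 0\<close> pays for the lower bound of \<open>Z n\<close>; a second number
      \<open>a'\<close> keeps the comparison strict after the shift by \<open>k\<close>.\<close>
    then obtain a where a: "ereal (- d) < ereal a" "ereal a < (INF z\<in>closure B. rate z)"
      using ereal_dense2 by blast
    then obtain a' where a': "ereal a < ereal a'" "ereal a' < (INF z\<in>closure B. rate z)"
      using ereal_dense2 by blast
    have "ereal (a' + k) \<le> (INF z\<in>closure B. unnormalized_rate z)"
    proof (rule INF_greatest)
      fix z assume "z \<in> closure B"
      then have "ereal a' < rate z" using a'(2) by (meson INF_lower less_le_trans)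
      then show "ereal (a' + k) \<le> unnormalized_rate z"
        unfolding rate_fun_eq[OF k] ereal_less_minus_real_iff by simp
    qed
    moreover have "ereal (a + k) < ereal (a' + k)" using a'(1) by simp
    ultimately have "ereal (a + k) < (INF z\<in>closure B. unnormalized_rate z)" by (rule less_le_trans[rotated])
    then have "eventually (\<lambda>n. mass n (closure B) \<le> exp (- (real n * (a + k)))) sequentially"
      by (intro gibbs_mass_upper_ereal) auto
    moreover have "a + d > 0" using a(1) by simp
    then have "eventually (\<lambda>n. exp (- (real n * (k + (a + d)))) \<le> Z n) sequentially"
      by (rule partition_fun_bounds(1)[OF k])
    ultimately have "eventually (\<lambda>n. ereal (1 / real n) * ereal_log (measure (Q n) B) \<le> ereal d) sequentially"
      using eventually_ge_at_top[of 1]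
    proof eventually_elim
      case (elim n)
      define p where "p = measure (Q n) B"
      have "mass n B \<le> mass n (closure B)"
        by (intro gibbs_mass_mono closure_subset)
      then have "p \<le> exp (- (real n * (a + k))) / exp (- (real n * (k + (a + d))))"
        unfolding p_def measure_eq_gibbs_mass[OF B] using elim
        by (intro frac_le) (auto intro: order_trans gibbs_mass_nonneg)
      also have "\<dots> = exp (real n * d)" by (simp add: algebra_simps flip: exp_diff)
      finally have p: "p \<le> exp (real n * d)" .
      show ?case
      \<comment> \<open>An event of probability 0 has logarithm \<open>-\<infinity>\<close>;
        \<open>n \<ge> 1\<close> keeps \<open>1 / n\<close> positive, so the product is again
        \<open>-\<infinity>\<close>.\<close>
      proof (cases "p = 0")
        case False
        then have "p > 0" by (simp add: p_def zero_less_measure_iff)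
        then have "ln p \<le> real n * d" using p by (metis ln_exp ln_mono)
        then have "1 / real n * ln p \<le> d" using elim(3) by (simp add: field_simps)
        then show ?thesis using False by (simp add: ereal_log_def p_def)
      qed (use elim(3) in \<open>simp add: ereal_log_def p_def\<close>)
    qed
    then show ?thesis unfolding real by (rule Limsup_bounded)
  qed (use y in auto)
qed

lemma LDP_lower:
  assumes B: "B \<in> sets borel"
  shows "- (INF z\<in>interior B. rate z)
    \<le> liminf (\<lambda>n. ereal (1 / real n) * ereal_log (measure (Q n) B))"
proof (rule dense_le)
  obtain k where k: "(INF z. unnormalized_rate z) = ereal k" by (rule infimum_unnormalized_rate)
  fix y assume y: "y < - (INF z\<in>interior B. rate z)"
  show "y \<le> liminf (\<lambda>n. ereal (1 / real n) * ereal_log (measure (Q n) B))"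
  proof (cases y)
    case (real d)
    have "(INF z\<in>interior B. rate z) < ereal (- d)"
      using y real by (metis ereal_less_uminus_reorder uminus_ereal.simps(1))
    then obtain z where z: "z \<in> interior B" "rate z < ereal (- d)"
      by (auto simp: INF_less_iff)
    have "unnormalized_rate z < ereal (k - d)"
      using z(2) unfolding rate_fun_eq[OF k] by (cases "unnormalized_rate z") auto
    then obtain b where b: "unnormalized_rate z < ereal b" "ereal b < ereal (k - d)"
      using ereal_dense2 by blast
    have "eventually (\<lambda>n. exp (- (real n * b)) \<le> mass n (interior B)) sequentially"
      by (rule gibbs_mass_lower_ereal[OF open_interior z(1) b(1)])
    moreover have "k - d - b > 0" using b(2) by simp
    then have "eventually (\<lambda>n. Z n \<le> exp (- (real n * (k - (k - d - b))))) sequentially"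
      by (rule partition_fun_bounds(2)[OF k])
    ultimately have "eventually (\<lambda>n. ereal d \<le> ereal (1 / real n) * ereal_log (measure (Q n) B)) sequentially"
      using eventually_ge_at_top[of 1]
    proof eventually_elim
      case (elim n)
      define p where "p = measure (Q n) B"
      have "mass n (interior B) \<le> mass n B"
        by (intro gibbs_mass_mono interior_subset)
      then have "exp (- (real n * b)) / exp (- (real n * (k - (k - d - b)))) \<le> p"
        unfolding p_def measure_eq_gibbs_mass[OF B] using elim less_le_trans[OF zero_less_one partition_fun_ge_1]
        by (intro frac_le gibbs_mass_nonneg) auto
      moreover have "exp (- (real n * b)) / exp (- (real n * (k - (k - d - b)))) = exp (real n * d)"
        by (simp add: algebra_simps flip: exp_diff)
      ultimately have p: "exp (real n * d) \<le> p" by simp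
      then have "p > 0" by (meson exp_gt_zero less_le_trans)
      then have "real n * d \<le> ln p" using p by (metis exp_gt_zero ln_exp ln_mono)
      then have "d \<le> 1 / real n * ln p" using elim(3) by (simp add: field_simps)
      then show ?case using \<open>p > 0\<close> by (simp add: ereal_log_def p_def)
    qed
    then show ?thesis unfolding real by (rule Liminf_bounded)
  qed (use y in auto)
qed

theorem LDP_mean_magnetization:
  "satisfies_LDP Q rate"
  unfolding satisfies_LDP_def using good_rate_function_rate_fun LDP_upper LDP_lower by blast

end

end

section \<open>Laplace's method\<close>

lemma integrable_gaussian:
  fixes a :: real
  assumes "a > 0" shows "integrable lborel (\<lambda>v. exp (- (a * v\<^sup>2)))"
proof -
  define sd where "sd = sqrt (1 / (2 * a))"
  have sd: "sd > 0" "sd\<^sup>2 = 1 / (2 * a)" using assms by (auto simp: sd_def)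
  have "exp (- (a * v\<^sup>2)) = sqrt (2 * pi * sd\<^sup>2) * normal_density 0 sd v" for v
    using sd assms by (simp add: normal_density_def mult.commute)
  then show ?thesis using sd by simp
qed

lemma square_le_power_plus_one:
  fixes v :: real assumes "t \<ge> 2" shows "v\<^sup>2 \<le> \<bar>v\<bar> ^ t + 1"
proof (cases "\<bar>v\<bar> \<le> 1")
  case True
  then have "v\<^sup>2 \<le> 1" by (simp add: abs_square_le_1)
  moreover have "0 \<le> \<bar>v\<bar> ^ t" by simp
  ultimately show ?thesis by linarith
next
  case False
  then have "\<bar>v\<bar> ^ 2 \<le> \<bar>v\<bar> ^ t" using assms by (intro power_increasing) auto
  then show ?thesis by simp
qed

lemma power_le_power_plus_one:
  fixes v :: real assumes "j \<le> t" shows "\<bar>v\<bar> ^ j \<le> \<bar>v\<bar> ^ t + 1"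
proof (cases "\<bar>v\<bar> \<le> 1")
  case True
  then have "\<bar>v\<bar> ^ j \<le> 1" by (simp add: power_le_one)
  moreover have "0 \<le> \<bar>v\<bar> ^ t" by simp
  ultimately show ?thesis by linarith
next
  case False
  then have "\<bar>v\<bar> ^ j \<le> \<bar>v\<bar> ^ t" using assms by (intro power_increasing) auto
  then show ?thesis by simp
qed

lemma integrable_exp_even_power:
  fixes a :: real
  assumes a: "a > 0" and t: "even t" "t \<ge> 2"
  shows "integrable lborel (\<lambda>v. exp (- (a * v ^ t)))"
proof (rule Bochner_Integration.integrable_bound)
  show "integrable lborel (\<lambda>v. exp a * exp (- (a * v\<^sup>2)))"
    using integrable_gaussian[OF a] by simp
  show "AE v in lborel. norm (exp (- (a * v ^ t))) \<le> norm (exp a * exp (- (a * v\<^sup>2)))"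
  proof (rule AE_I2)
    fix v :: real
    have "a * v\<^sup>2 \<le> a * (\<bar>v\<bar> ^ t + 1)" using a t by (intro mult_left_mono square_le_power_plus_one) auto
    then show "norm (exp (- (a * v ^ t))) \<le> norm (exp a * exp (- (a * v\<^sup>2)))"
      using t by (simp add: power_even_abs algebra_simps flip: exp_add)
  qed
qed measurable

lemma integral_exp_even_power_pos:
  fixes a :: real
  assumes a: "a > 0" and t: "even t" "t \<ge> 2"
  shows "0 < (\<integral>v. exp (- (a * v ^ t)) \<partial>lborel)"
proof -
  have "(\<integral>v. exp (- (a * v ^ t)) \<partial>lborel) \<noteq> 0"
  proof
    assume "(\<integral>v. exp (- (a * v ^ t)) \<partial>lborel) = 0"
    then have "AE v in lborel. exp (- (a * v ^ t)) = 0"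
      using integral_nonneg_eq_0_iff_AE[OF integrable_exp_even_power[OF a t]] by simp
    then have "AE v in (lborel :: real measure). False" by simp
    then show False by (simp add: AE_iff_measurable[OF _ refl])
  qed
  moreover have "0 \<le> (\<integral>v. exp (- (a * v ^ t)) \<partial>lborel)" by (intro integral_nonneg_AE) simp
  ultimately show ?thesis by (metis order_le_less)
qed

lemma integral_exp_neg_power_fact_pos:
  assumes "even t" "t \<ge> 2"
  shows "0 < (\<integral>s. exp (- (s ^ t) / fact t) \<partial>(lborel :: real measure))"
proof -
  have eq: "(\<lambda>s::real. exp (- (s ^ t) / fact t)) = (\<lambda>s. exp (- (1 / fact t * s ^ t)))" by simp
  show ?thesis unfolding eq using assms by (intro integral_exp_even_power_pos) auto
qed

text \<open>The substitution \<open>v = lam powr (- 1 / t) * u\<close>, the origin of the power of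
  the strength in \<open>b_weight\<close>.\<close>

lemma integral_exp_even_power_scale:
  fixes lam :: real
  assumes lam: "lam > 0" and t: "t \<ge> 1"
  shows "(\<integral>v. exp (- (lam / fact t * v ^ t)) \<partial>lborel) = lam powr (- 1 / real t) * (\<integral>s. exp (- (s ^ t) / fact t) \<partial>lborel)"
proof -
  define c where "c = lam powr (- 1 / real t)"
  have c: "c > 0" using lam by (simp add: c_def)
  have "c ^ t = lam powr (-1)" using t lam by (simp add: c_def powr_power)
  then have ct: "lam * c ^ t = 1" using lam by (simp add: powr_minus field_simps)
  have "(\<integral>v. exp (- (lam / fact t * v ^ t)) \<partial>lborel) = \<bar>c\<bar> *\<^sub>R (\<integral>u. exp (- (lam / fact t * (0 + c * u) ^ t)) \<partial>lborel)"
    using c by (intro lborel_integral_real_affine) auto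
  also have "(\<lambda>u. exp (- (lam / fact t * (0 + c * u) ^ t))) = (\<lambda>s. exp (- (s ^ t) / fact t))"
  proof
    fix u
    have "lam / fact t * (0 + c * u) ^ t = (lam * c ^ t) * u ^ t / fact t" by (simp add: power_mult_distrib)
    then show "exp (- (lam / fact t * (0 + c * u) ^ t)) = exp (- (u ^ t) / fact t)" by (simp add: ct)
  qed
  finally show ?thesis using c by (simp add: c_def)
qed

text \<open>Laplace's method at a degenerate minimum, in the scaling \<open>s = m + v n\<^sup>-\<^sup>1\<^sup>/\<^sup>t\<close>.\<close>

lemma laplace_local:
  fixes F :: "nat \<Rightarrow> real \<Rightarrow> real" and a :: "nat \<Rightarrow> nat \<Rightarrow> real" and h :: "real \<Rightarrow> real"
  assumes t: "even t" "t \<ge> 2" and \<kappa>: "\<kappa> > 0" and C: "C \<ge> 0"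
    and expansion: "\<And>n w. n \<ge> 1 \<Longrightarrow>
      \<bar>F n (m + w) - F n m - (\<Sum>j=1..t. a n j * w ^ j)\<bar> \<le> real n * C * \<bar>w\<bar> ^ Suc t"
    and low: "\<And>j. 1 \<le> j \<Longrightarrow> j < t \<Longrightarrow> (\<lambda>n. a n j * real n powr (- real j / real t)) \<longlonglongrightarrow> 0"
    and top: "(\<lambda>n. a n t / real n) \<longlonglongrightarrow> \<kappa>"
    and F: "\<And>n. F n \<in> borel_measurable borel"
    and h: "continuous_on UNIV h" and B: "\<And>s. \<bar>h s\<bar> \<le> B"
    and \<delta>: "\<delta> > 0" "4 * C * \<delta> \<le> \<kappa>"
  shows "(\<lambda>n. real n powr (1 / real t) *
      (\<integral>s. indicator {m - \<delta><..<m + \<delta>} s * (h s * exp (- (F n s - F n m))) \<partial>lborel))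
    \<longlonglongrightarrow> h m * (\<integral>v. exp (- (\<kappa> * v ^ t)) \<partial>lborel)"
proof -
  \<comment> \<open>The scale at which a leading term of size \<open>n * \<kappa> * w ^ t\<close>
    becomes \<open>\<kappa> * v ^ t\<close>.\<close>
  define r where "r n = real n powr (- 1 / real t)" for n
  have r_pos: "r n > 0" if "n \<ge> 1" for n using that by (simp add: r_def)
  have r_pow: "r n ^ j = real n powr (- real j / real t)" if "n \<ge> 1" for n j
    using that by (cases "j = 0") (auto simp: r_def powr_power)
  have r_top: "real n * r n ^ t = 1" if "n \<ge> 1" for n
    using that t by (simp add: r_pow powr_minus field_simps)
  have r_0: "r \<longlonglongrightarrow> 0"
    unfolding r_def using t by (intro tendsto_neg_powr filterlim_real_sequentially) auto
  define g where "g n v = indicator {m - \<delta><..<m + \<delta>} (m + r n * v) * (h (m + r n * v) * exp (- (F n (m + r n * v) - F n m)))" for n v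
  have eq: "real n powr (1 / real t) *
      (\<integral>s. indicator {m - \<delta><..<m + \<delta>} s * (h s * exp (- (F n s - F n m))) \<partial>lborel) = (\<integral>v. g n v \<partial>lborel)" if n: "n \<ge> 1" for n
  proof -
    have "(\<integral>s. indicator {m - \<delta><..<m + \<delta>} s * (h s * exp (- (F n s - F n m))) \<partial>lborel) = \<bar>r n\<bar> *\<^sub>R (\<integral>v. g n v \<partial>lborel)"
      unfolding g_def using r_pos[OF n] by (intro lborel_integral_real_affine) auto
    moreover have "real n powr (1 / real t) * r n = 1"
      using n by (simp add: r_def flip: powr_add)
    ultimately show ?thesis using r_pos[OF n] by simp
  qed
  \<comment> \<open>Rescaled Taylor coefficients: below order \<open>t\<close> they tend to 0, at
    order \<open>t\<close> to \<open>\<kappa>\<close>.\<close>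
  define A where "A n j = a n j * r n ^ j" for n j
  have A_low: "(\<lambda>n. A n j) \<longlonglongrightarrow> 0" if "1 \<le> j" "j < t" for j
    by (rule Lim_transform_eventually[OF low[OF that]])
       (use eventually_ge_at_top[of 1] in eventually_elim, simp add: A_def r_pow)
  have A_top: "(\<lambda>n. A n t) \<longlonglongrightarrow> \<kappa>"
    by (rule Lim_transform_eventually[OF top])
       (use eventually_ge_at_top[of 1] in eventually_elim, use r_top in \<open>simp add: A_def field_simps\<close>)
  have scaled: "\<bar>F n (m + r n * v) - F n m - (\<Sum>j=1..t. A n j * v ^ j)\<bar> \<le> C * r n * \<bar>v\<bar> * \<bar>v\<bar> ^ t" if n: "n \<ge> 1" for n v
  proof -
    have "(\<Sum>j=1..t. a n j * (r n * v) ^ j) = (\<Sum>j=1..t. A n j * v ^ j)"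
      by (simp add: A_def power_mult_distrib mult_ac)
    moreover have "real n * C * \<bar>r n * v\<bar> ^ Suc t = (real n * r n ^ t) * (C * r n * \<bar>v\<bar> * \<bar>v\<bar> ^ t)"
      using r_pos[OF n] by (simp add: abs_mult power_mult_distrib mult_ac)
    ultimately show ?thesis using expansion[OF n, of "r n * v"] by (simp only: r_top[OF n] mult_1)
  qed
  have sumA: "(\<lambda>n. \<Sum>j=1..t. A n j * v ^ j) \<longlonglongrightarrow> \<kappa> * v ^ t" for v
  proof -
    have "(\<lambda>n. \<Sum>j=1..t. A n j * v ^ j) \<longlonglongrightarrow> (\<Sum>j=1..t. (if j = t then \<kappa> else 0) * v ^ j)"
      using A_low A_top by (intro tendsto_sum tendsto_mult tendsto_const) auto
    also have "(\<Sum>j=1..t. (if j = t then \<kappa> else 0) * v ^ j) = \<kappa> * v ^ t"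
      using t by (simp add: if_distrib[of "\<lambda>u. u * _"] sum.delta cong: if_cong)
    finally show ?thesis .
  qed
  have lim: "(\<lambda>n. g n v) \<longlonglongrightarrow> h m * exp (- (\<kappa> * v ^ t))" for v
  proof -
    have arg: "(\<lambda>n. m + r n * v) \<longlonglongrightarrow> m + 0 * v" by (intro tendsto_intros r_0)
    then have arg': "(\<lambda>n. m + r n * v) \<longlonglongrightarrow> m" by simp
    have "eventually (\<lambda>n. m + r n * v \<in> {m - \<delta><..<m + \<delta>}) sequentially"
      using \<delta> by (intro topological_tendstoD[OF arg']) auto
    then have "(\<lambda>n. indicator {m - \<delta><..<m + \<delta>} (m + r n * v) :: real) \<longlonglongrightarrow> 1"
      by (intro tendsto_eventually) (auto elim!: eventually_mono)
    moreover have "(\<lambda>n. h (m + r n * v)) \<longlonglongrightarrow> h m"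
      using h arg' by (intro isCont_tendsto_compose[of m h]) (auto simp: continuous_on_eq_continuous_at)
    moreover have "(\<lambda>n. F n (m + r n * v) - F n m) \<longlonglongrightarrow> \<kappa> * v ^ t"
    proof -
      have "(\<lambda>n. F n (m + r n * v) - F n m - (\<Sum>j=1..t. A n j * v ^ j)) \<longlonglongrightarrow> 0"
      proof (rule Lim_null_comparison)
        show "\<forall>\<^sub>F n in sequentially. norm (F n (m + r n * v) - F n m - (\<Sum>j=1..t. A n j * v ^ j)) \<le> C * r n * \<bar>v\<bar> * \<bar>v\<bar> ^ t"
          using eventually_ge_at_top[of 1] by eventually_elim (use scaled in auto)
        have "(\<lambda>n. C * r n * \<bar>v\<bar> * \<bar>v\<bar> ^ t) \<longlonglongrightarrow> C * 0 * \<bar>v\<bar> * \<bar>v\<bar> ^ t" by (intro tendsto_intros r_0)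
        then show "(\<lambda>n. C * r n * \<bar>v\<bar> * \<bar>v\<bar> ^ t) \<longlonglongrightarrow> 0" by simp
      qed
      from tendsto_add[OF this sumA[of v]] show ?thesis by simp
    qed
    ultimately have "(\<lambda>n. g n v) \<longlonglongrightarrow> 1 * (h m * exp (- (\<kappa> * v ^ t)))"
      unfolding g_def by (intro tendsto_intros)
    then show ?thesis by simp
  qed
  \<comment> \<open>Budget for the domination: the top coefficient keeps
    \<open>3 * \<kappa> / 4\<close>, the fewer than \<open>t\<close> lower terms cost at most
    \<open>\<kappa> / 4 * (\<bar>v\<bar> ^ t + 1)\<close>, and the remainder at most
    \<open>\<kappa> / 4 * \<bar>v\<bar> ^ t\<close>. This leaves
    \<open>\<kappa> / 4 * \<bar>v\<bar> ^ t - \<kappa> / 4\<close>.\<close>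
  define \<eta> where "\<eta> = \<kappa> / (4 * real t)"
  have \<eta>: "\<eta> > 0" using \<kappa> t by (simp add: \<eta>_def)
  have B0: "B \<ge> 0" using B[of 0] by linarith
  have "eventually (\<lambda>n. \<forall>j\<in>{1..<t}. \<bar>A n j\<bar> < \<eta>) sequentially"
  proof (intro eventually_ball_finite ballI)
    fix j assume "j \<in> {1..<t}"
    then show "eventually (\<lambda>n. \<bar>A n j\<bar> < \<eta>) sequentially"
      using tendstoD[OF A_low[of j] \<eta>] by (auto simp: dist_real_def)
  qed auto
  moreover have "eventually (\<lambda>n. A n t > 3 * \<kappa> / 4) sequentially"
    using \<kappa> by (intro order_tendstoD(1)[OF A_top]) auto
  ultimately have "eventually (\<lambda>n. (\<forall>j\<in>{1..<t}. \<bar>A n j\<bar> < \<eta>) \<and> A n t > 3 * \<kappa> / 4 \<and> n \<ge> 1) sequentially"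
    using eventually_ge_at_top[of 1] by eventually_elim auto
  then obtain N where N: "\<And>n. n \<ge> N \<Longrightarrow> (\<forall>j\<in>{1..<t}. \<bar>A n j\<bar> < \<eta>) \<and> A n t > 3 * \<kappa> / 4 \<and> n \<ge> 1"
    by (auto simp: eventually_sequentially)
  have dom: "norm (g n v) \<le> B * exp (\<kappa> / 2) * exp (- (\<kappa> / 4 * v\<^sup>2))" if n: "n \<ge> N" for n v
  proof (cases "m + r n * v \<in> {m - \<delta><..<m + \<delta>}")
    case True
    have n1: "n \<ge> 1" and Aj: "\<And>j. j \<in> {1..<t} \<Longrightarrow> \<bar>A n j\<bar> < \<eta>" and At: "A n t > 3 * \<kappa> / 4" using N[OF n] by auto
    define P where "P = \<bar>v\<bar> ^ t"
    have P: "P \<ge> 0" "v ^ t = P" using t by (auto simp: P_def power_even_abs)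
    \<comment> \<open>On the support of the indicator the unscaled displacement is at most
      \<open>\<delta>\<close>; \<open>4 * C * \<delta> \<le> \<kappa>\<close> then turns the
      remainder of order \<open>t + 1\<close> into a small multiple of the leading term.\<close>
    have "r n * \<bar>v\<bar> = \<bar>r n * v\<bar>" using r_pos[OF n1] by (simp add: abs_mult)
    also have "\<dots> \<le> \<delta>" using True by (auto simp: abs_le_iff)
    finally have "C * (r n * \<bar>v\<bar>) \<le> C * \<delta>" using C by (intro mult_left_mono) auto
    then have "C * r n * \<bar>v\<bar> \<le> \<kappa> / 4" using \<delta>(2) by (simp add: mult.assoc)
    then have rem: "C * r n * \<bar>v\<bar> * P \<le> \<kappa> / 4 * P" using P by (intro mult_right_mono) auto
    have "\<bar>\<Sum>j\<in>{1..<t}. A n j * v ^ j\<bar> \<le> (\<Sum>j\<in>{1..<t}. \<eta> * (P + 1))"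
    proof (rule order_trans[OF sum_abs sum_mono])
      fix j assume j: "j \<in> {1..<t}"
      show "\<bar>A n j * v ^ j\<bar> \<le> \<eta> * (P + 1)"
        unfolding abs_mult power_abs P_def
        using Aj[OF j] j \<eta> by (intro mult_mono power_le_power_plus_one) auto
    qed
    also have "\<dots> \<le> real t * (\<eta> * (P + 1))"
      using \<eta> P by (simp add: mult_right_mono)
    also have "\<dots> = \<kappa> / 4 * (P + 1)" using t by (simp add: \<eta>_def)
    finally have low_le: "\<bar>\<Sum>j\<in>{1..<t}. A n j * v ^ j\<bar> \<le> \<kappa> / 4 * (P + 1)" .
    have "{1..t} = insert t {1..<t}" using t by auto
    then have split: "(\<Sum>j=1..t. A n j * v ^ j) = A n t * P + (\<Sum>j\<in>{1..<t}. A n j * v ^ j)"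
      using P by simp
    have "3 * \<kappa> / 4 * P \<le> A n t * P" using At P by (intro mult_right_mono) auto
    then have lower: "\<kappa> / 4 * P - \<kappa> / 4 \<le> F n (m + r n * v) - F n m"
    proof -
      have "\<kappa> / 4 * (P + 1) = \<kappa> / 4 * P + \<kappa> / 4" "3 * \<kappa> / 4 * P = 3 * (\<kappa> / 4 * P)" by (simp_all add: algebra_simps)
      then show ?thesis
        using scaled[OF n1, of v] low_le rem \<open>3 * \<kappa> / 4 * P \<le> A n t * P\<close> unfolding split P_def[symmetric]
        by linarith
    qed
    have "\<kappa> / 4 * v\<^sup>2 \<le> \<kappa> / 4 * (P + 1)"
      unfolding P_def using \<kappa> t by (intro mult_left_mono square_le_power_plus_one) auto
    then have "- (F n (m + r n * v) - F n m) \<le> \<kappa> / 2 + - (\<kappa> / 4 * v\<^sup>2)"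
      using lower by (simp add: algebra_simps)
    then have "exp (- (F n (m + r n * v) - F n m)) \<le> exp (\<kappa> / 2) * exp (- (\<kappa> / 4 * v\<^sup>2))"
      by (simp flip: exp_add)
    then have "\<bar>h (m + r n * v)\<bar> * exp (- (F n (m + r n * v) - F n m)) \<le> B * (exp (\<kappa> / 2) * exp (- (\<kappa> / 4 * v\<^sup>2)))"
      using B B0 by (intro mult_mono) auto
    then show ?thesis using True by (simp add: g_def abs_mult mult.assoc)
  qed (use B0 in \<open>simp add: g_def\<close>)
  have hm: "h \<in> borel_measurable borel" using h by (rule borel_measurable_continuous_onI)
  have "(\<lambda>n. \<integral>v. g (n + N) v \<partial>lborel) \<longlonglongrightarrow> (\<integral>v. h m * exp (- (\<kappa> * v ^ t)) \<partial>lborel)"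
  proof (rule integral_dominated_convergence)
    show "integrable lborel (\<lambda>v. B * exp (\<kappa> / 2) * exp (- (\<kappa> / 4 * v\<^sup>2)))"
      using integrable_gaussian[of "\<kappa> / 4"] \<kappa> by simp
    show "AE v in lborel. (\<lambda>n. g (n + N) v) \<longlonglongrightarrow> h m * exp (- (\<kappa> * v ^ t))"
      using LIMSEQ_ignore_initial_segment[OF lim] by auto
    show "AE v in lborel. norm (g (n + N) v) \<le> B * exp (\<kappa> / 2) * exp (- (\<kappa> / 4 * v\<^sup>2))" for n
      using dom[of "n + N"] by auto
    show "g (n + N) \<in> borel_measurable lborel" for n
    proof -
      have 1: "(\<lambda>v. m + r (n + N) * v) \<in> borel_measurable borel" by measurable
      show ?thesis unfolding g_def
        using measurable_compose[OF 1 F[of "n + N"]] measurable_compose[OF 1 hm]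
          measurable_compose[OF 1 borel_measurable_indicator[of "{m - \<delta><..<m + \<delta>}"]]
        by simp
    qed
  qed simp
  then have "(\<lambda>n. \<integral>v. g n v \<partial>lborel) \<longlonglongrightarrow> h m * (\<integral>v. exp (- (\<kappa> * v ^ t)) \<partial>lborel)"
    by (subst (asm) integral_mult_right_zero) (rule LIMSEQ_offset[where k = N])
  then show ?thesis
    by (rule Lim_transform_eventually) (rule eventually_mono[OF eventually_ge_at_top[of 1]], simp only: eq)
qed

section \<open>Quotients of sums with possibly oscillating weights\<close>

text \<open>The normalized weights lie in \<open>[0, 1]\<close>, so the errors
  \<open>\<rho> n m - h m\<close> stay small after averaging even when the shares do not
  converge.\<close>

lemma weighted_sum_ratio_limit:
  fixes b \<rho> :: "nat \<Rightarrow> 'm \<Rightarrow> real"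
  assumes M: "finite M" and b: "\<And>n m. n \<ge> 1 \<Longrightarrow> m \<in> M \<Longrightarrow> 0 < b n m"
    and X: "\<And>n. n \<ge> 1 \<Longrightarrow> X n = (\<Sum>m\<in>M. b n m * \<rho> n m) + R n"
    and \<rho>: "\<And>m. m \<in> M \<Longrightarrow> (\<lambda>n. \<rho> n m) \<longlonglongrightarrow> h m"
    and R: "(\<lambda>n. R n / (\<Sum>m\<in>M. b n m)) \<longlonglongrightarrow> 0"
  shows "(\<lambda>n. X n / (\<Sum>m\<in>M. b n m) - (\<Sum>m\<in>M. b n m * h m) / (\<Sum>m\<in>M. b n m)) \<longlonglongrightarrow> 0"
proof -
  have "(\<lambda>n. (\<Sum>m\<in>M. b n m * (\<rho> n m - h m)) / (\<Sum>m\<in>M. b n m)) \<longlonglongrightarrow> 0"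
  proof (rule Lim_null_comparison)
    have "(\<lambda>n. \<Sum>m\<in>M. \<bar>\<rho> n m - h m\<bar>) \<longlonglongrightarrow> (\<Sum>m\<in>M. \<bar>h m - h m\<bar>)"
      by (intro tendsto_sum tendsto_rabs tendsto_diff tendsto_const \<rho>)
    then show "(\<lambda>n. \<Sum>m\<in>M. \<bar>\<rho> n m - h m\<bar>) \<longlonglongrightarrow> 0" by simp
    show "\<forall>\<^sub>F n in sequentially. norm ((\<Sum>m\<in>M. b n m * (\<rho> n m - h m)) / (\<Sum>m\<in>M. b n m)) \<le> (\<Sum>m\<in>M. \<bar>\<rho> n m - h m\<bar>)"
      using eventually_ge_at_top[of 1]
    proof eventually_elim
      case (elim n)
      define S where "S = (\<Sum>m\<in>M. b n m)"
      have S: "S \<ge> 0" unfolding S_def using b[OF elim] by (intro sum_nonneg) (auto intro: less_imp_le)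
      have "\<bar>\<Sum>m\<in>M. b n m * (\<rho> n m - h m)\<bar> \<le> (\<Sum>m\<in>M. S * \<bar>\<rho> n m - h m\<bar>)"
      proof (rule order_trans[OF sum_abs sum_mono])
        fix m assume m: "m \<in> M"
        have "b n m \<le> S" unfolding S_def using M m b[OF elim] by (intro member_le_sum) (auto intro: less_imp_le)
        then show "\<bar>b n m * (\<rho> n m - h m)\<bar> \<le> S * \<bar>\<rho> n m - h m\<bar>"
          using b[OF elim m] by (simp add: abs_mult mult_right_mono)
      qed
      also have "\<dots> = S * (\<Sum>m\<in>M. \<bar>\<rho> n m - h m\<bar>)" by (simp add: sum_distrib_left)
      finally have le: "\<bar>\<Sum>m\<in>M. b n m * (\<rho> n m - h m)\<bar> \<le> S * (\<Sum>m\<in>M. \<bar>\<rho> n m - h m\<bar>)" .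
      show ?case
      proof (cases "S = 0")
        case False
        then show ?thesis using S le by (simp add: S_def[symmetric] divide_le_eq mult.commute)
      qed (simp add: S_def sum_nonneg)
    qed
  qed
  from tendsto_add[OF this R] have "(\<lambda>n. (\<Sum>m\<in>M. b n m * (\<rho> n m - h m)) / (\<Sum>m\<in>M. b n m) + R n / (\<Sum>m\<in>M. b n m)) \<longlonglongrightarrow> 0"
    by simp
  moreover have "(\<Sum>m\<in>M. b n m * (\<rho> n m - h m)) / S + R n / S = X n / S - (\<Sum>m\<in>M. b n m * h m) / S"
    if "n \<ge> 1" for n S
  proof -
    have "(\<Sum>m\<in>M. b n m * (\<rho> n m - h m)) + R n = X n - (\<Sum>m\<in>M. b n m * h m)"
      using that by (simp add: X right_diff_distrib sum_subtractf)
    then show ?thesis by (simp only: add_divide_distrib[symmetric] diff_divide_distrib[symmetric])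
  qed
  ultimately show ?thesis
    by (rule Lim_transform_eventually[OF _ eventually_mono[OF eventually_ge_at_top[of 1]]])
qed

text \<open>Via \<open>X / Y - a = ((X - a) + a * (1 - Y)) / Y\<close>; boundedness of
  \<open>a\<close> replaces its convergence.\<close>

lemma ratio_limit:
  fixes X Y a :: "nat \<Rightarrow> real"
  assumes X: "(\<lambda>n. X n - a n) \<longlonglongrightarrow> 0" and Y: "Y \<longlonglongrightarrow> 1" and a: "\<And>n. \<bar>a n\<bar> \<le> B"
  shows "(\<lambda>n. X n / Y n - a n) \<longlonglongrightarrow> 0"
proof -
  have "(\<lambda>n. a n * (1 - Y n)) \<longlonglongrightarrow> 0"
  proof (rule Lim_null_comparison)
    have "(\<lambda>n. B * \<bar>1 - Y n\<bar>) \<longlonglongrightarrow> B * \<bar>1 - 1\<bar>" by (intro tendsto_intros Y)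
    then show "(\<lambda>n. B * \<bar>1 - Y n\<bar>) \<longlonglongrightarrow> 0" by simp
    show "\<forall>\<^sub>F n in sequentially. norm (a n * (1 - Y n)) \<le> B * \<bar>1 - Y n\<bar>"
      using a by (intro always_eventually) (simp add: abs_mult mult_right_mono)
  qed
  then have lim: "(\<lambda>n. ((X n - a n) + a n * (1 - Y n)) / Y n) \<longlonglongrightarrow> (0 + 0) / 1"
    by (intro tendsto_intros X Y) auto
  have "eventually (\<lambda>n. Y n > 0) sequentially"
    by (rule order_tendstoD(1)[OF Y]) simp
  then have "eventually (\<lambda>n. ((X n - a n) + a n * (1 - Y n)) / Y n = X n / Y n - a n) sequentially"
    by eventually_elim (simp add: field_simps)
  from Lim_transform_eventually[OF lim this] show ?thesis by simp
qed

lemma eventually_ball_compact: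
  assumes K: "compact K"
    and loc: "\<And>s. s \<in> K \<Longrightarrow> \<exists>U. open U \<and> s \<in> U \<and> eventually (\<lambda>n. \<forall>y\<in>U. P n y) F"
  shows "eventually (\<lambda>n. \<forall>y\<in>K. P n y) F"
proof -
  have "\<forall>s\<in>K. \<exists>U. open U \<and> s \<in> U \<and> eventually (\<lambda>n. \<forall>y\<in>U. P n y) F" using loc by simp
  from bchoice[OF this] obtain U where
    U: "\<forall>s\<in>K. open (U s) \<and> s \<in> U s \<and> eventually (\<lambda>n. \<forall>y\<in>U s. P n y) F" ..
  have cover: "K \<subseteq> (\<Union>s\<in>K. U s)" using U by fast
  have op: "open (U s)" if "s \<in> K" for s using U that by simp
  obtain D where D: "D \<subseteq> K" "finite D" "K \<subseteq> (\<Union>s\<in>D. U s)"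
    by (rule compactE_image[OF K op cover])
  have "eventually (\<lambda>n. \<forall>s\<in>D. \<forall>y\<in>U s. P n y) F"
    using D U by (intro eventually_ball_finite) auto
  then show ?thesis
  proof eventually_elim
    case (elim n)
    show ?case
    proof
      fix y assume "y \<in> K"
      then obtain s where "s \<in> D" "y \<in> U s" using D(3) by auto
      then show "P n y" using elim by simp
    qed
  qed
qed

section \<open>Asymptotics of the Gibbs expectations\<close>

lemma emp_mean_bound:
  assumes "\<And>y. \<bar>g y\<bar> \<le> B" shows "\<bar>emp_mean T x n g\<bar> \<le> B"
proof -
  have "\<bar>\<Sum>i=1..n. g ((T ^^ i) x)\<bar> \<le> (\<Sum>i=1..n. B)"
    using assms by (intro order_trans[OF sum_abs] sum_mono)
  moreover have "0 \<le> B" using assms[of x] by linarith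
  ultimately show ?thesis
    by (cases "n = 0") (auto simp: emp_mean_def divide_le_eq mult.commute)
qed

text \<open>The counterpart of \<open>G_deriv\<close> with the orbit average in place of the
  integral; the quadratic parts agree and cancel in differences.\<close>

definition G_emp_deriv ::
  "real \<Rightarrow> ('a \<Rightarrow> 'a) \<Rightarrow> ('a \<Rightarrow> real) \<Rightarrow> 'a \<Rightarrow> nat \<Rightarrow> nat \<Rightarrow> real \<Rightarrow> real" where
  "G_emp_deriv c T f x n j s = quad_deriv c j s - c ^ j * emp_mean T x n (\<lambda>y. L_deriv j (f y) (c * s))"

lemma G_emp_eq: "G_emp \<beta> J T f x n = G_emp_deriv (\<beta> * J) T f x n 0"
  by (auto simp: G_emp_def G_emp_deriv_def quad_deriv_def L_deriv_0 emp_mean_def fun_eq_iff)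

lemma G_emp_deriv_has_derivative:
  assumes "\<And>y. f y \<in> {0..1}"
  shows "(G_emp_deriv c T f x n j has_real_derivative G_emp_deriv c T f x n (Suc j) s) (at s)"
proof -
  have d: "((\<lambda>s. L_deriv j (f y) (c * s)) has_real_derivative L_deriv (Suc j) (f y) (c * s) * c) (at s)" for y
    by (rule DERIV_chain2[OF L_deriv_has_derivative[OF assms]]) (auto intro!: derivative_eq_intros)
  have "((\<lambda>s. (\<Sum>i=1..n. L_deriv j (f ((T ^^ i) x)) (c * s)) / real n) has_real_derivative
      (\<Sum>i=1..n. L_deriv (Suc j) (f ((T ^^ i) x)) (c * s) * c) / real n) (at s)"
    by (intro DERIV_cdivide DERIV_sum d)
  then have "((\<lambda>s. emp_mean T x n (\<lambda>y. L_deriv j (f y) (c * s))) has_real_derivative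
      c * emp_mean T x n (\<lambda>y. L_deriv (Suc j) (f y) (c * s))) (at s)"
    by (simp add: emp_mean_def mult.commute flip: sum_distrib_left)
  then show ?thesis unfolding G_emp_deriv_def[abs_def]
    by (auto intro!: derivative_eq_intros quad_deriv_has_derivative)
qed

lemma finite_separated:
  fixes M :: "real set"
  assumes "finite M"
  shows "\<exists>d>0. \<forall>m\<in>M. \<forall>m'\<in>M. m \<noteq> m' \<longrightarrow> d \<le> \<bar>m - m'\<bar>"
proof -
  define S where "S = insert 1 ((\<lambda>(m, m'). \<bar>m - m'\<bar>) ` {(m, m'). m \<in> M \<and> m' \<in> M \<and> m \<noteq> m'})"
  have "finite {(m, m'). m \<in> M \<and> m' \<in> M \<and> m \<noteq> m'}"
    by (rule finite_subset[of _ "M \<times> M"]) (use assms in auto)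
  then have S: "finite S" by (simp add: S_def)
  show ?thesis
  proof (intro exI[of _ "Min S"] conjI ballI impI)
    show "Min S > 0" using S by (subst Min_gr_iff) (auto simp: S_def)
    show "Min S \<le> \<bar>m - m'\<bar>" if "m \<in> M" "m' \<in> M" "m \<noteq> m'" for m m'
      using S that by (intro Min_le) (auto simp: S_def)
  qed
qed

locale curie_weiss_over_dynamics = gibbs_system T f x \<beta> J
  for T :: "'a::metric_space \<Rightarrow> 'a" and f x \<beta> J +
  fixes \<mu> :: "'a measure"
  assumes comp: "compact (UNIV :: 'a set)"
    and T: "continuous_on UNIV T"
    and ue: "uniquely_ergodic T \<mu>"
    and f: "continuous_on UNIV f"
begin

abbreviation "G \<equiv> G_lim \<beta> J f \<mu>"
abbreviation "minima \<equiv> global_minima G"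
abbreviation "weight \<equiv> b_weight \<beta> J T f \<mu> x"
abbreviation "wsum n \<equiv> \<Sum>m\<in>minima. weight n m"
abbreviation "wmean n h \<equiv> (\<Sum>m\<in>minima. weight n m * h m) / wsum n"

lemma c_pos: "c > 0" using \<beta> J by simp

lemma abs_c: "\<bar>\<beta>\<bar> * \<bar>J\<bar> = c" using \<beta> J by simp

lemma \<mu>_prob: "prob_space \<mu>" and \<mu>_sets: "sets \<mu> = sets borel"
  using ue by (auto simp: uniquely_ergodic_def invariant_prob_def)

lemma f_meas: "f \<in> borel_measurable \<mu>"
  using borel_measurable_continuous_onI[OF f] measurable_cong_sets[OF \<mu>_sets refl] by auto

text \<open>The integrand is continuous for every order \<open>j\<close>, so the ergodic theorem
  covers \<open>Gn\<close> and all its derivatives at any fixed point.\<close>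

lemma emp_mean_L_deriv:
  "(\<lambda>n. emp_mean T x n (\<lambda>y. L_deriv j (f y) s)) \<longlonglongrightarrow> (\<integral>y. L_deriv j (f y) s \<partial>\<mu>)"
  unfolding emp_mean_def
  by (intro uniquely_ergodic_birkhoff[OF comp T ue] continuous_on_compose2[OF continuous_on_L_deriv f])
     (use f01 in auto)

lemma G_emp_tendsto: "(\<lambda>n. Gn n s) \<longlonglongrightarrow> G s"
  unfolding G_emp_eq G_emp_deriv_def G_lim_eq_G_deriv G_deriv_def
  by (intro tendsto_intros emp_mean_L_deriv)

lemma emp_mean_L_fun_bound: "\<bar>Lam_n n (c * s)\<bar> \<le> c * \<bar>s\<bar>"
proof (rule emp_mean_bound)
  show "\<bar>L_fun (f y) (c * s)\<bar> \<le> c * \<bar>s\<bar>" for y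
    using L_fun_bound[OF f01[of y], of "c * s"] by (simp add: abs_mult abs_c)
qed

text \<open>Completing a square absorbs \<open>- c * \<bar>s\<bar>\<close> into half of the
  quadratic term. The result is a Gaussian bound for \<open>boltz n\<close> with constants
  independent of the orbit.\<close>

lemma G_emp_lower: "c / 4 * s\<^sup>2 - c \<le> Gn n s"
proof -
  have "c * (\<bar>s\<bar> / 2 - 1)\<^sup>2 \<ge> 0" using c_pos by simp
  moreover have "c * (\<bar>s\<bar> / 2 - 1)\<^sup>2 = c / 4 * s\<^sup>2 - c * \<bar>s\<bar> + c"
    by (simp add: power2_eq_square algebra_simps flip: abs_mult)
  ultimately have "c / 4 * s\<^sup>2 - c \<le> c / 2 * s\<^sup>2 - c * \<bar>s\<bar>" by (simp add: algebra_simps)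
  moreover have "Gn n s = c / 2 * s\<^sup>2 - Lam_n n (c * s)"
    by (simp add: G_emp_def emp_mean_def)
  ultimately show ?thesis using emp_mean_L_fun_bound[of n s] by linarith
qed

text \<open>The slope of \<open>L_fun\<close> is bounded by 1. Uniformity in \<open>n\<close> turns
  convergence at single points into estimates on neighbourhoods.\<close>

lemma emp_mean_L_fun_Lipschitz:
  "\<bar>Lam_n n (c * s) - Lam_n n (c * s')\<bar> \<le> c * \<bar>s - s'\<bar>"
proof -
  have eq: "Lam_n n (c * s) - Lam_n n (c * s')
      = emp_mean T x n (\<lambda>y. L_fun (f y) (c * s) - L_fun (f y) (c * s'))"
    by (simp add: emp_mean_def sum_subtractf diff_divide_distrib)
  have "\<bar>L_fun (f y) (c * s) - L_fun (f y) (c * s')\<bar> \<le> c * \<bar>s - s'\<bar>" for y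
  proof -
    obtain t where "L_deriv 0 (f y) (c * s' + (c * s - c * s')) =
       (\<Sum>i<1. L_deriv (0 + i) (f y) (c * s') / fact i * (c * s - c * s') ^ i)
       + L_deriv (0 + 1) (f y) (c * s' + t) / fact 1 * (c * s - c * s') ^ 1"
      using deriv_seq_Taylor[of "\<lambda>j. L_deriv j (f y)" "c * s - c * s'" 0 "c * s'" 1]
        L_deriv_has_derivative[OF f01] by blast
    then have "L_fun (f y) (c * s) - L_fun (f y) (c * s') = L_deriv (Suc 0) (f y) (c * s' + t) * (c * (s - s'))"
      by (simp add: L_deriv_0 right_diff_distrib)
    then have "\<bar>L_fun (f y) (c * s) - L_fun (f y) (c * s')\<bar> = \<bar>L_deriv (Suc 0) (f y) (c * s' + t)\<bar> * (c * \<bar>s - s'\<bar>)"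
      using c_pos by (simp add: abs_mult abs_c)
    also have "\<dots> \<le> 1 * (c * \<bar>s - s'\<bar>)"
      using L_deriv_bound[OF f01[of y], of 0 "c * s' + t"] c_pos by (intro mult_right_mono) auto
    finally show ?thesis by simp
  qed
  then show ?thesis unfolding eq by (rule emp_mean_bound)
qed

lemma G_emp_continuous: "continuous_on A (Gn n)"
  unfolding G_emp_eq by (rule deriv_seq_continuous[of "G_emp_deriv c T f x n"]) (rule G_emp_deriv_has_derivative[OF f01])

lemma G_emp_measurable [measurable]: "Gn n \<in> borel_measurable borel"
  by (intro borel_measurable_continuous_onI G_emp_continuous)

lemma G_continuous: "continuous_on A G"
  unfolding G_lim_eq_G_deriv
  by (rule deriv_seq_continuous[of "G_deriv c f \<mu>"]) (rule G_deriv_has_derivative[OF \<mu>_prob f_meas f01 c_pos])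

lemmas G_type = G_min_type_properties[OF \<mu>_prob f_meas f01 c_pos, folded G_lim_eq_G_deriv]
lemmas G_even_pos = G_min_type_even_strength_pos[OF \<mu>_prob f_meas f01 c_pos, folded G_lim_eq_G_deriv]
lemmas G_minima_nonempty = G_global_minima_nonempty[OF \<mu>_prob f_meas f01 c_pos, folded G_lim_eq_G_deriv]
lemmas G_minima_finite = G_global_minima_finite[OF \<mu>_prob f_meas f01 c_pos, folded G_lim_eq_G_deriv]

lemma type_ge_2:
  assumes "m \<in> minima" shows "2 \<le> min_type G m"
  using G_type(1)[where m = m] G_even_pos(1)[OF assms] by (cases "min_type G m = 1") auto

lemma strength_pos:
  assumes "m \<in> minima" shows "0 < min_strength G m"
  using G_even_pos(2)[OF assms] G_type(4)[where m = m] by simp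

text \<open>\<open>\<delta>\<^sub>0\<close> precedes \<open>h\<close> because one radius has to
  serve the numerator with \<open>h\<close>, the denominator with the constant 1 and, after taking a
  minimum, all points of \<open>minima\<close>. It is built from \<open>\<kappa>\<close> and the
  remainder bound \<open>C\<close>, which do not depend on \<open>n\<close> or
  \<open>h\<close>.\<close>

lemma G_emp_local_laplace:
  assumes m: "m \<in> minima"
    and cls: "\<And>j. j \<in> {1..min_type G m} \<Longrightarrow>
      (\<lambda>y. (deriv ^^ j) (L_fun (f y)) (c * m)) \<in> class_C T \<mu> (real j / real (min_type G m))"
  shows "\<exists>\<delta>\<^sub>0>0. \<forall>\<delta> h B. 0 < \<delta> \<longrightarrow> \<delta> \<le> \<delta>\<^sub>0 \<longrightarrow> continuous_on UNIV h \<longrightarrow> (\<forall>s. \<bar>h s\<bar> \<le> B) \<longrightarrow>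
      (\<lambda>n. lap_on {m - \<delta><..<m + \<delta>} n h
        / weight n m) \<longlonglongrightarrow> h m"
proof -
  define t where "t = min_type G m"
  define lam where "lam = min_strength G m"
  define \<kappa> where "\<kappa> = lam / fact t"
  define C where "C = c ^ Suc t * (2 ^ t * fact t)"
  define D where "D n = G_emp_deriv c T f x n" for n
  define a where "a n j = real n * D n j m / fact j" for n j
  have t: "even t" "t \<ge> 2" using G_even_pos(1)[OF m] type_ge_2[OF m] by (auto simp: t_def)
  have lam: "lam > 0" using strength_pos[OF m] by (simp add: lam_def)
  have \<kappa>: "\<kappa> > 0" using lam by (simp add: \<kappa>_def)
  have C0: "C \<ge> 0" using c_pos by (simp add: C_def)
  have D0: "Gn n = D n 0" for n by (simp add: D_def G_emp_eq)
  have D_der: "(D n j has_real_derivative D n (Suc j) s) (at s)" for n j s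
    unfolding D_def by (rule G_emp_deriv_has_derivative[OF f01])
  \<comment> \<open>Order \<open>t + 1\<close> is at least 3, where the quadratic part is
    gone.\<close>
  have D_bound: "\<bar>D n (Suc t) s\<bar> \<le> C" for n s
  proof -
    have "\<bar>emp_mean T x n (\<lambda>y. L_deriv (Suc t) (f y) (c * s))\<bar> \<le> 2 ^ t * fact t"
      by (intro emp_mean_bound L_deriv_bound f01)
    then have "c ^ Suc t * \<bar>emp_mean T x n (\<lambda>y. L_deriv (Suc t) (f y) (c * s))\<bar> \<le> C"
      unfolding C_def using c_pos by (intro mult_left_mono) auto
    then show ?thesis using t c_pos by (simp add: D_def G_emp_deriv_def quad_deriv_def abs_mult abs_c)
  qed
  have expansion: "\<bar>real n * Gn n (m + w) - real n * Gn n m - (\<Sum>j=1..t. a n j * w ^ j)\<bar> \<le> real n * C * \<bar>w\<bar> ^ Suc t" for n w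
  proof -
    obtain u where "D n 0 (m + w) = (\<Sum>i<Suc t. D n (0 + i) m / fact i * w ^ i) + D n (0 + Suc t) (m + u) / fact (Suc t) * w ^ Suc t"
      using deriv_seq_Taylor[of "D n" w 0 m "Suc t"] D_der by blast
    moreover have "(\<Sum>i<Suc t. D n i m / fact i * w ^ i) = D n 0 m + (\<Sum>j=1..t. D n j m / fact j * w ^ j)"
      by (simp add: lessThan_Suc_atMost atMost_atLeast0 sum.atLeast_Suc_atMost)
    ultimately have "real n * Gn n (m + w) - real n * Gn n m - (\<Sum>j=1..t. a n j * w ^ j)
        = real n * (D n (Suc t) (m + u) / fact (Suc t)) * w ^ Suc t"
      by (simp add: D0 a_def distrib_left sum_distrib_left mult_ac del: fact_Suc power_Suc)
    also have "\<bar>\<dots>\<bar> = real n * (\<bar>D n (Suc t) (m + u)\<bar> / fact (Suc t)) * \<bar>w\<bar> ^ Suc t"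
      by (simp add: abs_mult power_abs del: fact_Suc power_Suc)
    also have "\<dots> \<le> real n * C * \<bar>w\<bar> ^ Suc t"
    proof (intro mult_right_mono mult_left_mono)
      have "\<bar>D n (Suc t) (m + u)\<bar> \<le> C * 1" using D_bound by simp
      also have "\<dots> \<le> C * fact (Suc t)" using C0 by (intro mult_left_mono fact_ge_1)
      finally show "\<bar>D n (Suc t) (m + u)\<bar> / fact (Suc t) \<le> C" by (simp add: divide_le_eq del: fact_Suc)
    qed auto
    finally show ?thesis .
  qed
  have G_eq: "G_deriv c f \<mu> j m = 0" if "1 \<le> j" "j < t" for j
    using G_type(3)[where m = m and j = j] that by (simp add: t_def)
  have low: "(\<lambda>n. a n j * real n powr (- real j / real t)) \<longlonglongrightarrow> 0" if j: "1 \<le> j" "j < t" for j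
  proof -
    define L where "L = (\<integral>z. L_deriv j (f z) (c * m) \<partial>\<mu>)"
    have "(\<lambda>n. \<bar>\<Sum>k=1..n. L_deriv j (f ((T ^^ k) x)) (c * m) - L\<bar>) \<in> o(\<lambda>n. real n powr (real j / real t))"
      using cls[of j] j by (auto simp: class_C_def deriv_funpow_L_fun[OF f01] L_def t_def)
    then have "(\<lambda>n. \<bar>\<Sum>k=1..n. L_deriv j (f ((T ^^ k) x)) (c * m) - L\<bar> / real n powr (real j / real t)) \<longlonglongrightarrow> 0"
      by (rule smalloD_tendsto)
    then have "(\<lambda>n. c ^ j / fact j * (\<bar>\<Sum>k=1..n. L_deriv j (f ((T ^^ k) x)) (c * m) - L\<bar> / real n powr (real j / real t))) \<longlonglongrightarrow> c ^ j / fact j * 0"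
      by (intro tendsto_mult tendsto_const)
    then have *: "(\<lambda>n. c ^ j / fact j * (\<bar>\<Sum>k=1..n. L_deriv j (f ((T ^^ k) x)) (c * m) - L\<bar> / real n powr (real j / real t))) \<longlonglongrightarrow> 0"
      by simp
    show ?thesis
    proof (rule Lim_null_comparison[OF _ *], rule eventually_mono[OF eventually_ge_at_top[of 1]])
      fix n :: nat assume n: "1 \<le> n"
      \<comment> \<open>Subtracting the vanishing derivative of \<open>G\<close> turns that of
        \<open>Gn\<close> into \<open>- c ^ j\<close> times a Birkhoff deviation; the scaling
        \<open>n powr (- j / t)\<close> matches the exponent of \<open>class_C\<close>.\<close>
      have "D n j m = D n j m - G_deriv c f \<mu> j m" using G_eq[OF j] by simp
      also have "\<dots> = - (c ^ j * (emp_mean T x n (\<lambda>y. L_deriv j (f y) (c * m)) - L))"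
        by (simp add: D_def G_emp_deriv_def G_deriv_def L_def algebra_simps)
      finally have "a n j = - (c ^ j / fact j * (real n * (emp_mean T x n (\<lambda>y. L_deriv j (f y) (c * m)) - L)))"
        by (simp add: a_def)
      also have "real n * (emp_mean T x n (\<lambda>y. L_deriv j (f y) (c * m)) - L) = (\<Sum>k=1..n. L_deriv j (f ((T ^^ k) x)) (c * m) - L)"
        using n by (simp add: emp_mean_def sum_subtractf right_diff_distrib)
      finally show "norm (a n j * real n powr (- real j / real t)) \<le>
          c ^ j / fact j * (\<bar>\<Sum>k=1..n. L_deriv j (f ((T ^^ k) x)) (c * m) - L\<bar> / real n powr (real j / real t))"
        using c_pos by (simp add: abs_mult powr_minus_divide)
    qed
  qed
  have top: "(\<lambda>n. a n t / real n) \<longlonglongrightarrow> \<kappa>"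
  proof -
    have "(\<lambda>n. D n t m) \<longlonglongrightarrow> G_deriv c f \<mu> t m"
      unfolding D_def G_emp_deriv_def G_deriv_def by (intro tendsto_intros emp_mean_L_deriv)
    then have "(\<lambda>n. D n t m / fact t) \<longlonglongrightarrow> G_deriv c f \<mu> t m / fact t" by (intro tendsto_divide tendsto_const) auto
    moreover have "G_deriv c f \<mu> t m / fact t = \<kappa>" using G_type(4)[where m = m] by (simp add: \<kappa>_def lam_def t_def)
    ultimately have lim: "(\<lambda>n. D n t m / fact t) \<longlonglongrightarrow> \<kappa>" by simp
    show ?thesis
      by (rule Lim_transform_eventually[OF lim], rule eventually_mono[OF eventually_ge_at_top[of 1]]) (simp add: a_def)
  qed
  define I where "I = (\<integral>v. exp (- (\<kappa> * v ^ t)) \<partial>lborel)"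
  have I: "I > 0" unfolding I_def by (rule integral_exp_even_power_pos[OF \<kappa> t])
  have b_eq: "weight n m = real n powr (- 1 / real t) * boltz n m * I" for n
    unfolding b_weight_def Let_def t_def[symmetric] lam_def[symmetric] I_def \<kappa>_def
    using t by (subst integral_exp_even_power_scale[OF lam]) auto
  show ?thesis
  proof (intro exI[of _ "\<kappa> / (4 * (C + 1))"] conjI allI impI)
    show "\<kappa> / (4 * (C + 1)) > 0" using \<kappa> C0 by simp
    fix \<delta> B :: real and h :: "real \<Rightarrow> real"
    assume \<delta>: "0 < \<delta>" "\<delta> \<le> \<kappa> / (4 * (C + 1))" and h: "continuous_on UNIV h" and "\<forall>s. \<bar>h s\<bar> \<le> B"
    then have B: "\<bar>h s\<bar> \<le> B" for s by simp
    have "4 * (C + 1) * \<delta> \<le> \<kappa>" using \<delta>(2) C0 by (simp add: field_simps)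
    then have \<delta>': "4 * C * \<delta> \<le> \<kappa>" using \<delta>(1) by (simp add: algebra_simps)
    have lim: "(\<lambda>n. real n powr (1 / real t) *
        (\<integral>s. indicator {m - \<delta><..<m + \<delta>} s * (h s * exp (- (real n * Gn n s - real n * Gn n m))) \<partial>lborel) / I) \<longlonglongrightarrow> h m * I / I"
      unfolding I_def
      by (intro tendsto_divide tendsto_const
          laplace_local[where F = "\<lambda>n s. real n * Gn n s", OF t \<kappa> C0 expansion low top _ h B \<delta>(1) \<delta>'])
         (use I in \<open>auto simp: I_def\<close>)
    show "(\<lambda>n. lap_on {m - \<delta><..<m + \<delta>} n h
        / weight n m) \<longlonglongrightarrow> h m"
    proof -
      have "real n powr (1 / real t) *
        (\<integral>s. indicator {m - \<delta><..<m + \<delta>} s * (h s * exp (- (real n * Gn n s - real n * Gn n m))) \<partial>lborel) / I =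
        lap_on {m - \<delta><..<m + \<delta>} n h / weight n m"
        if n: "n \<ge> 1" for n
      proof -
        have "(\<lambda>s. indicator {m - \<delta><..<m + \<delta>} s * (h s * exp (- (real n * Gn n s - real n * Gn n m)))) =
            (\<lambda>s. exp (real n * Gn n m) * (indicator {m - \<delta><..<m + \<delta>} s * (h s * boltz n s)))"
          by (simp add: exp_diff exp_minus fun_eq_iff field_simps)
        moreover define W where "W = lap_on {m - \<delta><..<m + \<delta>} n h"
        ultimately have "(\<integral>s. indicator {m - \<delta><..<m + \<delta>} s * (h s * exp (- (real n * Gn n s - real n * Gn n m))) \<partial>lborel) =
            exp (real n * Gn n m) * W"
          by simp
        then show ?thesis
          unfolding W_def[symmetric] using n by (simp add: b_eq powr_minus exp_minus field_simps)
      qed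
      then have "(\<lambda>n. lap_on {m - \<delta><..<m + \<delta>} n h
        / weight n m) \<longlonglongrightarrow> h m * I / I"
        by (intro Lim_transform_eventually[OF lim eventually_mono[OF eventually_ge_at_top[of 1]]])
      then show ?thesis using I by simp
    qed
  qed
qed

section \<open>Contribution away from the minima\<close>

text \<open>Far out the quadratic lower bound works for all \<open>n\<close>. On the remaining
  compact set \<open>G\<close> exceeds its minimum by a fixed amount, and the Lipschitz bound
  spreads convergence at single points over neighbourhoods, finitely many of which cover.\<close>

lemma G_emp_outside:
  assumes m0: "m\<^sub>0 \<in> minima" and \<delta>: "\<delta> > 0"
  obtains \<epsilon> where "\<epsilon> > 0"
    "eventually (\<lambda>n. \<forall>s. (\<forall>m\<in>minima. \<delta> \<le> \<bar>s - m\<bar>) \<longrightarrow> G m\<^sub>0 + \<epsilon> \<le> Gn n s) sequentially"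
proof -
  define g where "g = G m\<^sub>0"
  \<comment> \<open>\<open>c * (R - 4) = \<bar>g + 1\<bar>\<close>, and for
    \<open>\<bar>s\<bar> \<ge> 4\<close> the line \<open>\<bar>s\<bar> - 4\<close> lies below
    \<open>s^2 / 4 - 1\<close>.\<close>
  define R where "R = 4 + \<bar>g + 1\<bar> / c"
  define K where "K = {-R..R} \<inter> {s. \<forall>m\<in>minima. \<delta> \<le> \<bar>s - m\<bar>}"
  have far: "g + 1 \<le> Gn n s" if s: "R \<le> \<bar>s\<bar>" for n s
  proof -
    have R: "\<bar>g + 1\<bar> / c \<ge> 0" using c_pos by simp
    have "\<bar>g + 1\<bar> \<le> c * (R - 4)" using \<beta> J by (simp add: R_def)
    also have "\<dots> \<le> c * (\<bar>s\<bar> - 4)" using s c_pos by (intro mult_left_mono) auto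
    also have "\<dots> \<le> c * (s\<^sup>2 / 4 - 1)"
    proof (intro mult_left_mono)
      have "4 * \<bar>s\<bar> \<le> \<bar>s\<bar> * \<bar>s\<bar>" using s R by (intro mult_right_mono) (auto simp: R_def)
      then have "4 * \<bar>s\<bar> \<le> s\<^sup>2" by (simp add: power2_eq_square)
      then show "\<bar>s\<bar> - 4 \<le> s\<^sup>2 / 4 - 1" by linarith
    qed (use c_pos in auto)
    also have "\<dots> = c / 4 * s\<^sup>2 - c" by (simp add: algebra_simps)
    finally show ?thesis using G_emp_lower[of s n] by linarith
  qed
  have "closed {s. \<forall>m\<in>minima. \<delta> \<le> \<bar>s - m\<bar>}"
  proof -
    have "{s. \<forall>m\<in>minima. \<delta> \<le> \<bar>s - m\<bar>} = (\<Inter>m\<in>minima. {s. \<delta> \<le> \<bar>s - m\<bar>})" by auto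
    also have "closed \<dots>" by (intro closed_INT ballI closed_Collect_le continuous_intros)
    finally show ?thesis .
  qed
  then have K: "compact K" unfolding K_def by (intro compact_Int_closed) auto
  obtain e0 where e0: "e0 > 0" "\<And>s. s \<in> K \<Longrightarrow> g + 2 * e0 \<le> G s"
  proof (cases "K = {}")
    case True
    then show ?thesis using that[of 1] by simp
  next
    case False
    obtain z where z: "z \<in> K" "\<forall>y\<in>K. G z \<le> G y"
      using continuous_attains_inf[OF K False G_continuous] by blast
    have "z \<notin> minima" using z(1) \<delta> by (auto simp: K_def)
    then have "g < G z" using m0 by (auto simp: global_minima_def g_def not_le intro: le_less_trans)
    have eq: "g + 2 * ((G z - g) / 2) = G z" by (simp add: field_simps)
    show ?thesis
    proof (rule that[of "(G z - g) / 2"])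
      show "0 < (G z - g) / 2" using \<open>g < G z\<close> by simp
      show "g + 2 * ((G z - g) / 2) \<le> G s" if "s \<in> K" for s unfolding eq using z(2) that by blast
    qed
  qed
  have "eventually (\<lambda>n. \<forall>y\<in>K. g + e0 \<le> Gn n y) sequentially"
  proof (rule eventually_ball_compact[OF K])
    fix s assume s: "s \<in> K"
    \<comment> \<open>Of the gap \<open>2 * e0\<close> at \<open>s\<close>, convergence costs
      \<open>e0 / 2\<close> and the quadratic and Lipschitz terms \<open>e0 / 4\<close> each, which
      leaves \<open>e0\<close>.\<close>
    define U where "U = {y. c / 2 * s\<^sup>2 - e0 / 4 < c / 2 * y\<^sup>2} \<inter> {y. c * \<bar>s - y\<bar> < e0 / 4}"
    have "open U" unfolding U_def by (intro open_Int open_Collect_less continuous_intros)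
    moreover have "s \<in> U" using e0 by (simp add: U_def)
    moreover have "eventually (\<lambda>n. \<forall>y\<in>U. g + e0 \<le> Gn n y) sequentially"
    proof -
      have "g + 3 / 2 * e0 < G s" using e0(2)[OF s] e0(1) by linarith
      then have "eventually (\<lambda>n. g + 3 / 2 * e0 < Gn n s) sequentially"
        by (rule order_tendstoD(1)[OF G_emp_tendsto])
      then show ?thesis
      proof eventually_elim
        case (elim n)
        show ?case
        proof
          fix y assume y: "y \<in> U"
          have Gn: "Gn n z = c / 2 * z\<^sup>2 - emp_mean T x n (\<lambda>y. L_fun (f y) (c * z))" for z
            by (simp add: G_emp_def emp_mean_def)
          have "c / 2 * s\<^sup>2 - e0 / 4 < c / 2 * y\<^sup>2" "c * \<bar>s - y\<bar> < e0 / 4"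
            using y by (auto simp: U_def)
          moreover have "emp_mean T x n (\<lambda>z. L_fun (f z) (c * y)) - emp_mean T x n (\<lambda>z. L_fun (f z) (c * s)) \<le> c * \<bar>s - y\<bar>"
            using emp_mean_L_fun_Lipschitz[of n s y] by linarith
          ultimately show "g + e0 \<le> Gn n y" using elim Gn[of s] Gn[of y] by linarith
        qed
      qed
    qed
    ultimately show "\<exists>U. open U \<and> s \<in> U \<and> eventually (\<lambda>n. \<forall>y\<in>U. g + e0 \<le> Gn n y) sequentially" by blast
  qed
  then have "eventually (\<lambda>n. \<forall>s. (\<forall>m\<in>minima. \<delta> \<le> \<bar>s - m\<bar>) \<longrightarrow> G m\<^sub>0 + min 1 e0 \<le> Gn n s) sequentially"
  proof eventually_elim
    case (elim n)
    show ?case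
    proof (intro allI impI)
      fix s assume s: "\<forall>m\<in>minima. \<delta> \<le> \<bar>s - m\<bar>"
      show "G m\<^sub>0 + min 1 e0 \<le> Gn n s"
      proof (cases "R \<le> \<bar>s\<bar>")
        case True
        then show ?thesis using far[OF True, of n] by (simp add: g_def)
      next
        case False
        then have "s \<in> K" using s by (auto simp: K_def)
        then have "g + e0 \<le> Gn n s" using elim by blast
        then show ?thesis by (simp add: g_def)
      qed
    qed
  qed
  then show ?thesis using that[of "min 1 e0"] e0(1) by simp
qed

lemma exp_G_emp_le:
  assumes "n \<ge> 1"
  shows "boltz n s \<le> exp (real n * c) * exp (- (real n * c / 4 * s\<^sup>2))"
proof -
  have "real n * (c / 4 * s\<^sup>2 - c) \<le> real n * Gn n s" by (intro mult_left_mono G_emp_lower) simp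
  then show ?thesis by (simp add: algebra_simps flip: exp_add)
qed

lemma integrable_exp_G_emp:
  assumes n: "n \<ge> 1" and h: "h \<in> borel_measurable borel" and B: "\<And>s. \<bar>h s\<bar> \<le> B"
  shows "integrable lborel (\<lambda>s. h s * boltz n s)"
proof (rule Bochner_Integration.integrable_bound)
  show "integrable lborel (\<lambda>s. B * exp (real n * c) * exp (- (real n * c / 4 * s\<^sup>2)))"
    using n c_pos by (intro integrable_mult_right integrable_gaussian) simp
  have "B \<ge> 0" using B[of 0] by linarith
  show "AE s in lborel. norm (h s * boltz n s) \<le> norm (B * exp (real n * c) * exp (- (real n * c / 4 * s\<^sup>2)))"
  proof (rule AE_I2)
    fix s
    have "\<bar>h s\<bar> * boltz n s \<le> B * (exp (real n * c) * exp (- (real n * c / 4 * s\<^sup>2)))"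
      using B \<open>B \<ge> 0\<close> by (intro mult_mono exp_G_emp_le[OF n]) auto
    then show "norm (h s * boltz n s) \<le> norm (B * exp (real n * c) * exp (- (real n * c / 4 * s\<^sup>2)))"
      using \<open>B \<ge> 0\<close> by (simp add: abs_mult)
  qed
  show "(\<lambda>s. h s * boltz n s) \<in> borel_measurable lborel" using h by measurable
qed

lemma b_weight_pos:
  assumes "n \<ge> 1" "m \<in> minima"
  shows "0 < weight n m"
proof -
  show ?thesis
    unfolding b_weight_def Let_def
    using assms(1) strength_pos[OF assms(2)]
    by (intro mult_pos_pos integral_exp_neg_power_fact_pos G_even_pos(1)[OF assms(2)] type_ge_2[OF assms(2)]) auto
qed

text \<open>One factor \<open>exp (- Gn n s)\<close> is kept for integrability over the unbounded
  set, the other \<open>n - 1\<close> give exponential decay at rate \<open>g + \<epsilon>\<close>.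
  The weight of \<open>m\<^sub>0\<close> alone decays at rate at most
  \<open>g + \<epsilon> / 2\<close> up to a factor \<open>1 / n\<close>, so the quotient is of order
  at most \<open>n * exp (- n * \<epsilon> / 2)\<close>.\<close>

lemma outside_integral_negligible:
  assumes m0: "m\<^sub>0 \<in> minima" and \<delta>: "\<delta> > 0"
    and S: "S \<in> sets borel" "\<And>s m. s \<in> S \<Longrightarrow> m \<in> minima \<Longrightarrow> \<delta> \<le> \<bar>s - m\<bar>"
    and h: "h \<in> borel_measurable borel" and B: "\<And>s. \<bar>h s\<bar> \<le> B"
  shows "(\<lambda>n. lap_on S n h
      / wsum n) \<longlonglongrightarrow> 0"
proof -
  obtain \<epsilon> where \<epsilon>: "\<epsilon> > 0" and ev:
    "eventually (\<lambda>n. \<forall>s. (\<forall>m\<in>minima. \<delta> \<le> \<bar>s - m\<bar>) \<longrightarrow> G m\<^sub>0 + \<epsilon> \<le> Gn n s) sequentially"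
    using G_emp_outside[OF m0 \<delta>] by blast
  define g where "g = G m\<^sub>0"
  define t where "t = min_type G m\<^sub>0"
  define K where "K = min_strength G m\<^sub>0 powr (- 1 / real t) * (\<integral>s. exp (- (s ^ t) / fact t) \<partial>lborel)"
  have t: "even t" "t \<ge> 2" using G_even_pos(1)[OF m0] type_ge_2[OF m0] by (auto simp: t_def)
  have K: "K > 0"
    unfolding K_def using strength_pos[OF m0]
    by (intro mult_pos_pos integral_exp_neg_power_fact_pos t) auto
  have b_eq: "weight n m\<^sub>0 = real n powr (- 1 / real t) * exp (- (real n * Gn n m\<^sub>0)) * K" for n
    by (simp add: b_weight_def Let_def K_def t_def)
  define D where "D = (\<integral>s. exp c * exp (- (c / 4 * s\<^sup>2)) \<partial>lborel)"
  have D_int: "integrable lborel (\<lambda>s. exp c * exp (- (c / 4 * s\<^sup>2)))"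
    using integrable_gaussian[of "c / 4"] c_pos by simp
  have B0: "B \<ge> 0" using B[of 0] by linarith
  have D0: "D \<ge> 0" unfolding D_def by (intro integral_nonneg_AE) simp
  have "eventually (\<lambda>n. Gn n m\<^sub>0 < g + \<epsilon> / 2) sequentially"
    using \<epsilon> by (intro order_tendstoD(2)[OF G_emp_tendsto]) (simp add: g_def)
  then have "eventually (\<lambda>n. norm (lap_on S n h
      / wsum n) \<le> B * D * exp (g + \<epsilon>) / K * (real n * exp (- (\<epsilon> / 2)) ^ n)) sequentially"
    using ev eventually_ge_at_top[of 1]
  proof eventually_elim
    case (elim n)
    have n: "n \<ge> 1" by fact
    have Sh: "(\<lambda>s. indicator S s * h s) \<in> borel_measurable borel"
      using h S(1) by simp
    have "\<bar>\<integral>s. indicator S s * (h s * boltz n s) \<partial>lborel\<bar>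
        \<le> (\<integral>s. B * exp (- (real (n - 1) * (g + \<epsilon>))) * (exp c * exp (- (c / 4 * s\<^sup>2))) \<partial>lborel)"
    proof (rule order_trans[OF integral_abs_bound], rule integral_mono)
      have "integrable lborel (\<lambda>s. (indicator S s * h s) * boltz n s)"
      proof (rule integrable_exp_G_emp[OF n Sh])
        show "\<bar>indicator S s * h s\<bar> \<le> B" for s using B[of s] B0 by (simp add: indicator_def)
      qed
      then show "integrable lborel (\<lambda>s. \<bar>indicator S s * (h s * boltz n s)\<bar>)"
        by (intro integrable_abs) (simp add: mult.assoc)
      show "integrable lborel (\<lambda>s. B * exp (- (real (n - 1) * (g + \<epsilon>))) * (exp c * exp (- (c / 4 * s\<^sup>2))))"
        by (intro integrable_mult_right D_int)
      fix s
      show "\<bar>indicator S s * (h s * boltz n s)\<bar> \<le> B * exp (- (real (n - 1) * (g + \<epsilon>))) * (exp c * exp (- (c / 4 * s\<^sup>2)))"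
      proof (cases "s \<in> S")
        case True
        then have G1: "g + \<epsilon> \<le> Gn n s" using elim(2) S(2) by (simp add: g_def)
        have "real (n - 1) * (g + \<epsilon>) + (c / 4 * s\<^sup>2 - c) \<le> real (n - 1) * Gn n s + Gn n s"
          by (intro add_mono mult_left_mono G1 G_emp_lower) simp
        also have "\<dots> = real n * Gn n s"
          using n by (simp add: of_nat_diff algebra_simps)
        finally have "boltz n s \<le> exp (- (real (n - 1) * (g + \<epsilon>))) * (exp c * exp (- (c / 4 * s\<^sup>2)))"
          by (simp flip: exp_add)
        then have "\<bar>h s\<bar> * boltz n s \<le> B * (exp (- (real (n - 1) * (g + \<epsilon>))) * (exp c * exp (- (c / 4 * s\<^sup>2))))"
          using B B0 by (intro mult_mono) auto
        then show ?thesis using True by (simp add: abs_mult mult.assoc)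
      qed (use B0 in simp)
    qed
    also have "\<dots> = B * D * exp (- (real (n - 1) * (g + \<epsilon>)))"
      by (subst integral_mult_right_zero) (simp add: D_def)
    also have "exp (- (real (n - 1) * (g + \<epsilon>))) = exp (g + \<epsilon>) * exp (- (real n * (g + \<epsilon>)))"
      using n by (simp add: of_nat_diff algebra_simps flip: exp_add)
    finally have num: "\<bar>\<integral>s. indicator S s * (h s * boltz n s) \<partial>lborel\<bar>
        \<le> B * D * exp (g + \<epsilon>) * exp (- (real n * (g + \<epsilon>)))" by (simp add: mult.assoc)
    have n1: "1 / real n \<le> real n powr (- 1 / real t)"
    proof -
      have "real n powr (- 1) \<le> real n powr (- 1 / real t)" using n t by (intro powr_mono) auto
      then show ?thesis using n by (simp add: powr_minus_divide)
    qed
    have b0: "1 / real n * exp (- (real n * (g + \<epsilon> / 2))) * K \<le> weight n m\<^sub>0"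
      unfolding b_eq using n1 K elim(1) by (intro mult_right_mono mult_mono) (auto simp: mult_left_mono)
    also have "\<dots> \<le> wsum n"
      using m0 b_weight_pos[OF n] by (intro member_le_sum G_minima_finite) (auto intro: less_imp_le)
    finally have den: "1 / real n * exp (- (real n * (g + \<epsilon> / 2))) * K \<le> wsum n" .
    have den0: "0 < 1 / real n * exp (- (real n * (g + \<epsilon> / 2))) * K" using n K by simp
    have "norm (lap_on S n h / wsum n)
      = \<bar>\<integral>s. indicator S s * (h s * boltz n s) \<partial>lborel\<bar> / wsum n"
      using den den0 by (simp add: abs_divide)
    also have "\<dots> \<le> B * D * exp (g + \<epsilon>) * exp (- (real n * (g + \<epsilon>))) / (1 / real n * exp (- (real n * (g + \<epsilon> / 2))) * K)"
      using B0 D0 by (intro frac_le num den den0) auto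
    also have "\<dots> = B * D * exp (g + \<epsilon>) / K * (real n * (exp (- (real n * (g + \<epsilon>))) / exp (- (real n * (g + \<epsilon> / 2)))))"
    proof -
      have "A * p / (1 / r * q * k) = A / k * (r * (p / q))" for A p q r k :: real by (simp add: mult_ac)
      then show ?thesis .
    qed
    also have "exp (- (real n * (g + \<epsilon>))) / exp (- (real n * (g + \<epsilon> / 2))) = exp (- (\<epsilon> / 2)) ^ n"
      by (simp add: algebra_simps flip: exp_diff exp_of_nat_mult)
    finally show ?case .
  qed
  moreover have "(\<lambda>n. B * D * exp (g + \<epsilon>) / K * (real n * exp (- (\<epsilon> / 2)) ^ n)) \<longlonglongrightarrow> B * D * exp (g + \<epsilon>) / K * 0"
    using \<epsilon> by (intro tendsto_mult[OF tendsto_const] powser_times_n_limit_0) simp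
  then have "(\<lambda>n. B * D * exp (g + \<epsilon>) / K * (real n * exp (- (\<epsilon> / 2)) ^ n)) \<longlonglongrightarrow> 0"
    by (simp only: mult_zero_right)
  ultimately show ?thesis by (rule Lim_null_comparison)
qed

lemma weighted_average_bound:
  assumes "n \<ge> 1" "\<And>s. \<bar>h s\<bar> \<le> B"
  shows "\<bar>wmean n h\<bar> \<le> B"
proof -
  define b where "b m = weight n m" for m
  have b: "b m > 0" if "m \<in> minima" for m using b_weight_pos[OF assms(1) that] by (simp add: b_def)
  have S: "(\<Sum>m\<in>minima. b m) > 0"
    using b by (intro sum_pos G_minima_finite G_minima_nonempty)
  have "\<bar>\<Sum>m\<in>minima. b m * h m\<bar> \<le> (\<Sum>m\<in>minima. b m * B)"
    using b assms(2) by (intro order_trans[OF sum_abs] sum_mono) (simp add: abs_mult mult_left_mono less_imp_le)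
  also have "\<dots> = B * (\<Sum>m\<in>minima. b m)" by (simp add: sum_distrib_left mult.commute)
  finally show ?thesis using S by (simp add: b_def[symmetric] abs_divide divide_le_eq)
qed

text \<open>The line is cut into disjoint intervals around the minima and a negligible rest. The
  resulting comparison with the weights is applied to \<open>h\<close> and to the constant 1; the
  quotient of these two integrals is the smoothed Gibbs mean.\<close>

lemma gibbs_expectation_asymptotics:
  assumes cls: "\<And>m j. m \<in> minima \<Longrightarrow> j \<in> {1..min_type G m} \<Longrightarrow>
      (\<lambda>y. (deriv ^^ j) (L_fun (f y)) (c * m)) \<in> class_C T \<mu> (real j / real (min_type G m))"
    and h: "continuous_on UNIV h" and B: "\<And>s. \<bar>h s\<bar> \<le> B"
  shows "(\<lambda>n. gibbs_mean n h
    - wmean n h) \<longlonglongrightarrow> 0"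
proof -
  define M where "M = minima"
  define b where "b = weight"
  have M: "finite M" "M \<noteq> {}" using G_minima_finite G_minima_nonempty by (auto simp: M_def)
  obtain m0 where m0: "m0 \<in> M" using M by blast
  have "\<forall>m\<in>M. \<exists>\<delta>0>0. \<forall>\<delta> h B. 0 < \<delta> \<longrightarrow> \<delta> \<le> \<delta>0 \<longrightarrow> continuous_on UNIV h \<longrightarrow> (\<forall>s. \<bar>h s\<bar> \<le> B) \<longrightarrow>
      (\<lambda>n. lap_on {m - \<delta><..<m + \<delta>} n h / b n m) \<longlonglongrightarrow> h m"
    unfolding M_def b_def
  proof (rule ballI)
    fix m assume m: "m \<in> minima"
    show "\<exists>\<delta>0>0. \<forall>\<delta> h B. 0 < \<delta> \<longrightarrow> \<delta> \<le> \<delta>0 \<longrightarrow> continuous_on UNIV h \<longrightarrow> (\<forall>s. \<bar>h s\<bar> \<le> B) \<longrightarrow>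
      (\<lambda>n. lap_on {m - \<delta><..<m + \<delta>} n h
        / weight n m) \<longlonglongrightarrow> h m"
      by (rule G_emp_local_laplace[OF m cls[OF m]])
  qed
  from bchoice[OF this] obtain \<delta>0 where
    lap: "\<forall>m\<in>M. \<delta>0 m > 0 \<and> (\<forall>\<delta> h B. 0 < \<delta> \<longrightarrow> \<delta> \<le> \<delta>0 m \<longrightarrow> continuous_on UNIV h \<longrightarrow> (\<forall>s. \<bar>h s\<bar> \<le> B) \<longrightarrow>
      (\<lambda>n. lap_on {m - \<delta><..<m + \<delta>} n h / b n m) \<longlonglongrightarrow> h m)" ..
  then have \<delta>0: "\<delta>0 m > 0" if "m \<in> M" for m using that by simp
  obtain d where d: "d > 0" "\<forall>m\<in>M. \<forall>m'\<in>M. m \<noteq> m' \<longrightarrow> d \<le> \<bar>m - m'\<bar>"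
    using finite_separated[OF M(1)] by auto
  \<comment> \<open>\<open>d / 2\<close> makes the intervals disjoint; the other bound makes the
    local asymptotics valid at every minimum.\<close>
  define \<delta> where "\<delta> = min (d / 2) (Min (\<delta>0 ` M))"
  have "Min (\<delta>0 ` M) > 0" using M \<delta>0 by (subst Min_gr_iff) auto
  then have \<delta>: "\<delta> > 0" "2 * \<delta> \<le> d" using d(1) by (simp_all add: \<delta>_def)
  have \<delta>_le: "\<delta> \<le> \<delta>0 m" if "m \<in> M" for m
    unfolding \<delta>_def using M(1) that by (intro min.coboundedI2 Min_le) auto
  define U where "U m = {m - \<delta><..<m + \<delta>}" for m :: real
  define S where "S = - (\<Union>m\<in>M. U m)"
  have partition: "(\<Sum>m\<in>M. indicator (U m) s) + indicator S s = (1 :: real)" for s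
  proof (cases "s \<in> S")
    case True
    then show ?thesis by (auto simp: S_def indicator_def)
  next
    case False
    then obtain m where m: "m \<in> M" "s \<in> U m" by (auto simp: S_def)
    have uniq: "m' = m" if "m' \<in> M" "s \<in> U m'" for m'
    proof (rule ccontr)
      assume "m' \<noteq> m"
      then have "d \<le> \<bar>m' - m\<bar>" using d(2) that m by blast
      moreover have "\<bar>m' - m\<bar> < 2 * \<delta>" using that m by (auto simp: U_def)
      ultimately show False using \<delta>(2) by linarith
    qed
    have "(\<Sum>m'\<in>M. indicator (U m') s) = (\<Sum>m'\<in>M. if m' = m then 1 else (0::real))"
    proof (rule sum.cong[OF refl])
      fix m' assume "m' \<in> M"
      then show "indicator (U m') s = (if m' = m then 1 else (0::real))"
        using m(2) uniq[of m'] by (cases "s \<in> U m'") auto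
    qed
    then show ?thesis using m M False by simp
  qed
  have S: "S \<in> sets borel" "\<And>s m. s \<in> S \<Longrightarrow> m \<in> M \<Longrightarrow> \<delta> \<le> \<bar>s - m\<bar>"
  proof -
    have "open (\<Union>m\<in>M. U m)" by (auto simp: U_def)
    then have "closed S" unfolding S_def by (rule closed_Compl)
    then show "S \<in> sets borel" by (rule borel_closed)
    show "\<delta> \<le> \<bar>s - m\<bar>" if "s \<in> S" "m \<in> M" for s m
    proof (rule ccontr)
      assume "\<not> \<delta> \<le> \<bar>s - m\<bar>"
      then have "s \<in> U m" by (auto simp: U_def)
      then show False using that by (auto simp: S_def)
    qed
  qed
  have main: "(\<lambda>n. lap n k / (\<Sum>m\<in>M. b n m)
      - (\<Sum>m\<in>M. b n m * k m) / (\<Sum>m\<in>M. b n m)) \<longlonglongrightarrow> 0"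
    if k: "continuous_on UNIV k" and B': "\<And>s. \<bar>k s\<bar> \<le> B'" for k B'
  proof (rule weighted_sum_ratio_limit[OF M(1)])
    have km: "k \<in> borel_measurable borel" using k by (rule borel_measurable_continuous_onI)
    show "0 < b n m" if "n \<ge> 1" "m \<in> M" for n m using b_weight_pos that by (simp add: b_def M_def)
    show "lap n k = (\<Sum>m\<in>M. b n m *
        (lap_on (U m) n k / b n m))
        + lap_on S n k" if n: "n \<ge> 1" for n
    proof -
      have B0: "B' \<ge> 0" using B'[of 0] by linarith
      have int: "integrable lborel (\<lambda>s. indicator A s * (k s * boltz n s))" if "A \<in> sets borel" for A
      proof -
        have "integrable lborel (\<lambda>s. (indicator A s * k s) * boltz n s)"
        proof (rule integrable_exp_G_emp[OF n])
          show "(\<lambda>s. indicator A s * k s) \<in> borel_measurable borel" using km that by simp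
          show "\<bar>indicator A s * k s\<bar> \<le> B'" for s using B'[of s] B0 by (simp add: indicator_def)
        qed
        then show ?thesis by (simp add: mult.assoc)
      qed
      have U: "U m \<in> sets borel" for m by (simp add: U_def)
      have "lap n k =
          (\<integral>s. ((\<Sum>m\<in>M. indicator (U m) s) + indicator S s) * (k s * boltz n s) \<partial>lborel)"
        by (simp only: partition mult_1)
      also have "\<dots> = (\<integral>s. (\<Sum>m\<in>M. indicator (U m) s * (k s * boltz n s)) + indicator S s * (k s * boltz n s) \<partial>lborel)"
        by (simp only: distrib_right sum_distrib_right)
      also have "\<dots> = (\<integral>s. (\<Sum>m\<in>M. indicator (U m) s * (k s * boltz n s)) \<partial>lborel) + lap_on S n k"
        by (intro Bochner_Integration.integral_add Bochner_Integration.integrable_sum int U S)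
      also have "(\<integral>s. (\<Sum>m\<in>M. indicator (U m) s * (k s * boltz n s)) \<partial>lborel)
          = (\<Sum>m\<in>M. lap_on (U m) n k)"
        by (intro Bochner_Integration.integral_sum int U)
      also have "\<dots> = (\<Sum>m\<in>M. b n m * (lap_on (U m) n k / b n m))"
      proof (rule sum.cong[OF refl])
        fix m assume "m \<in> M"
        then have "b n m > 0" using b_weight_pos[OF n] by (simp add: b_def M_def)
        then show "lap_on (U m) n k =
          b n m * (lap_on (U m) n k / b n m)" by simp
      qed
      finally show ?thesis .
    qed
    show "(\<lambda>n. lap_on (U m) n k / b n m) \<longlonglongrightarrow> k m" if "m \<in> M" for m
      unfolding U_def by (rule lap[rule_format, OF that, THEN conjunct2, rule_format, OF \<delta>(1) \<delta>_le[OF that] k B'])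
    show "(\<lambda>n. lap_on S n k / (\<Sum>m\<in>M. b n m)) \<longlonglongrightarrow> 0"
      unfolding b_def M_def using m0 S
      by (intro outside_integral_negligible[OF _ \<delta>(1) _ _ km B']) (auto simp: M_def)
  qed
  define X where "X n = lap n h" for n
  define Y where "Y n = (\<integral>s. boltz n s \<partial>lborel)" for n
  define Sb where "Sb n = (\<Sum>m\<in>M. b n m)" for n
  define a where "a n = (\<Sum>m\<in>M. b n m * h m) / Sb n" for n
  have Sb: "Sb n > 0" if "n \<ge> 1" for n
    unfolding Sb_def using b_weight_pos[OF that] M by (intro sum_pos) (auto simp: b_def M_def)
  have X: "(\<lambda>n. X n / Sb n - a n) \<longlonglongrightarrow> 0" using main[OF h B] by (simp add: X_def Sb_def a_def)
  have "(\<lambda>n. Y n / Sb n - Sb n / Sb n) \<longlonglongrightarrow> 0"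
    using main[of "\<lambda>_. 1" 1] by (simp add: Y_def Sb_def)
  then have lim: "(\<lambda>n. (Y n / Sb n - Sb n / Sb n) + 1) \<longlonglongrightarrow> 0 + 1" by (intro tendsto_add tendsto_const)
  have "eventually (\<lambda>n. (Y n / Sb n - Sb n / Sb n) + 1 = Y n / Sb n) sequentially"
    using eventually_ge_at_top[of 1]
  proof eventually_elim
    case (elim n)
    then show ?case using Sb[OF elim] by simp
  qed
  from Lim_transform_eventually[OF lim this] have Y: "(\<lambda>n. Y n / Sb n) \<longlonglongrightarrow> 1" by simp
  have "(\<lambda>n. (X n / Sb n) / (Y n / Sb n) - a n) \<longlonglongrightarrow> 0"
  proof (rule ratio_limit[OF X Y])
    show "\<bar>a n\<bar> \<le> B" for n
    proof (cases "n \<ge> 1")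
      case True
      then show ?thesis using weighted_average_bound[OF True B] by (simp add: a_def Sb_def b_def M_def)
    next
      case False
      \<comment> \<open>\<open>0 powr _\<close> is 0, so at \<open>n = 0\<close> all weights vanish
        and \<open>a 0\<close> is 0 by the convention for division by zero.\<close>
      then have "b n m = 0" for m by (simp add: b_def b_weight_def Let_def)
      then show ?thesis using B[of 0] by (simp add: a_def)
    qed
  qed
  moreover have "eventually (\<lambda>n. (X n / Sb n) / (Y n / Sb n) - a n = X n / Y n - a n) sequentially"
    using eventually_ge_at_top[of 1]
  proof eventually_elim
    case (elim n)
    then show ?case using Sb[OF elim] by simp
  qed
  ultimately have "(\<lambda>n. X n / Y n - a n) \<longlonglongrightarrow> 0" by (rule Lim_transform_eventually)
  from tendsto_add[OF gibbs_expectation_smoothing[OF h B, folded X_def Y_def] this]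
  show ?thesis by (simp add: a_def Sb_def b_def M_def)
qed

lemma large_deviations: "satisfies_LDP Q (rate_fun \<beta> J f \<mu>)"
proof -
  define Lam where "Lam l = (\<integral>y. L_deriv 0 (f y) l \<partial>\<mu>)" for l
  define Lam' where "Lam' l = (\<integral>y. L_deriv (Suc 0) (f y) l \<partial>\<mu>)" for l
  define Lam'' where "Lam'' l = (\<integral>y. L_deriv (Suc (Suc 0)) (f y) l \<partial>\<mu>)" for l
  have d1: "(Lam has_real_derivative Lam' l) (at l)" for l
    unfolding Lam_def[abs_def] Lam'_def by (rule integral_L_deriv_has_derivative[OF \<mu>_prob f_meas f01])
  have d2: "(Lam' has_real_derivative Lam'' l) (at l)" for l
    unfolding Lam'_def[abs_def] Lam''_def by (rule integral_L_deriv_has_derivative[OF \<mu>_prob f_meas f01])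
  \<comment> \<open>The integrand is \<open>1 - u^2\<close> with \<open>u\<close> the slope of
    \<open>L_fun\<close>; this is the convexity of \<open>Lam\<close>.\<close>
  have nonneg: "0 \<le> Lam'' l" for l
    unfolding Lam''_def
  proof (rule integral_nonneg_AE, rule AE_I2)
    fix y
    have "(L_slope (f y) l)\<^sup>2 \<le> 1" using L_slope_bound[OF f01] by (simp add: abs_square_le_1)
    then show "0 \<le> L_deriv (Suc (Suc 0)) (f y) l" by (simp add: L_deriv_def power2_eq_square)
  qed
  interpret scaled_cumulant_limit T f x \<beta> J Lam Lam'
  proof unfold_locales
    show "(\<lambda>n. Lam_n n l) \<longlonglongrightarrow> Lam l" for l
      using emp_mean_L_deriv[of 0 l] by (simp add: Lam_def L_deriv_0)
    show "continuous_on UNIV Lam'" using d2 by (auto intro!: continuous_at_imp_continuous_on dest: DERIV_isCont)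
    show "mono Lam'"
      by (rule monoI, rule DERIV_nonneg_imp_nondecreasing) (use d2 nonneg in blast)+
    show "Lam 0 = 0" by (simp add: Lam_def L_deriv_0 L_fun_def)
    show "Lam l \<le> \<bar>l\<bar>" for l
      using integral_L_fun_bound[OF \<mu>_prob f_meas f01, of l] by (simp add: Lam_def L_deriv_0)
  qed (rule d1)
  have "Lambda f \<mu> = Lam" by (auto simp: Lambda_def Lam_def L_deriv_0 L_fun_def fun_eq_iff)
  then show ?thesis by (rule LDP_mean_magnetization)
qed

end

text \<open>Equivalence is read as convergence of the difference to 0 for every \<open>h\<close>,
  with the quotient form added when the averages stay away from 0: for signed \<open>h\<close> the
  averages may vanish or tend to 0, and then a vanishing difference says nothing about the
  quotient.\<close>

theorem theorem3p2:
  fixes T :: "'a::metric_space \<Rightarrow> 'a" and \<mu> :: "'a measure" and f :: "'a \<Rightarrow> real"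
    and x :: 'a and \<beta> J :: real
  assumes "compact (UNIV :: 'a set)"
    and "continuous_on UNIV T"
    and "uniquely_ergodic T \<mu>"
    and "continuous_on UNIV f" and "\<And>y. f y \<in> {0..1}"
    and "0 < \<beta>" and "0 < J"
  shows
    "((\<forall>m \<in> global_minima (G_lim \<beta> J f \<mu>). \<forall>j \<in> {1..min_type (G_lim \<beta> J f \<mu>) m}.
        (\<lambda>y. (deriv ^^ j) (L_fun (f y)) (\<beta> * J * m))
          \<in> class_C T \<mu> (real j / real (min_type (G_lim \<beta> J f \<mu>) m)))
     \<longrightarrow>
       (\<forall>h :: real \<Rightarrow> real. continuous_on UNIV h \<longrightarrow> bounded (range h) \<longrightarrow>
          (let e = (\<lambda>n. \<integral>\<sigma>. h (magnetization n \<sigma> / real n) \<partial>(gibbs \<beta> J T f n x));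
               a = (\<lambda>n. (\<Sum>m\<in>global_minima (G_lim \<beta> J f \<mu>). b_weight \<beta> J T f \<mu> x n m * h m)
                      / (\<Sum>m\<in>global_minima (G_lim \<beta> J f \<mu>). b_weight \<beta> J T f \<mu> x n m))
           in (\<lambda>n. e n - a n) \<longlonglongrightarrow> 0 \<and>
              ((\<exists>c>0. \<forall>\<^sub>F n in sequentially. c \<le> \<bar>a n\<bar>) \<longrightarrow> asymp_equiv e sequentially a)))
       \<and> (\<forall>m. global_minima (G_lim \<beta> J f \<mu>) = {m} \<longrightarrow>
            weak_conv_m (\<lambda>n. mean_magnetization_distr \<beta> J T f n x) (return borel m)))
     \<and> satisfies_LDP (\<lambda>n. mean_magnetization_distr \<beta> J T f n x) (rate_fun \<beta> J f \<mu>)"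
proof -
  interpret curie_weiss_over_dynamics T f x \<beta> J \<mu>
    by unfold_locales (use assms in auto)
  have equiv: "asymp_equiv e sequentially a"
    if lim: "(\<lambda>n. e n - a n) \<longlonglongrightarrow> 0" and c: "\<exists>c>0. \<forall>\<^sub>F n in sequentially. c \<le> \<bar>a n\<bar>" for e a :: "nat \<Rightarrow> real"
  proof -
    obtain c where c: "c > 0" "\<forall>\<^sub>F n in sequentially. c \<le> \<bar>a n\<bar>" using c by blast
    have "(\<lambda>n. e n - a n) \<in> o(a)"
    proof (rule landau_o.smallI)
      fix k :: real assume k: "k > 0"
      then have "\<forall>\<^sub>F n in sequentially. dist (e n - a n) 0 < k * c" using c(1) by (intro tendstoD[OF lim]) simp
      then show "\<forall>\<^sub>F n in sequentially. norm (e n - a n) \<le> k * norm (a n)"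
        using c(2)
      proof eventually_elim
        case (elim n)
        have "k * c \<le> k * \<bar>a n\<bar>" using elim(2) k by (intro mult_left_mono) auto
        then show ?case using elim(1) by simp
      qed
    qed
    then show ?thesis by (rule smallo_imp_asymp_equiv)
  qed
  have asymptotics: "(\<lambda>n. gibbs_mean n h - wmean n h) \<longlonglongrightarrow> 0"
    if "\<forall>m\<in>minima. \<forall>j\<in>{1..min_type G m}. (\<lambda>y. (deriv ^^ j) (L_fun (f y)) (\<beta> * J * m)) \<in> class_C T \<mu> (real j / real (min_type G m))"
      "continuous_on UNIV h" "\<And>s. \<bar>h s\<bar> \<le> B" for h :: "real \<Rightarrow> real" and B
    by (rule gibbs_expectation_asymptotics) (use that in auto)
  show ?thesis
    unfolding Let_def
  proof (intro conjI impI allI)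
    show "satisfies_LDP Q (rate_fun \<beta> J f \<mu>)"
      by (rule large_deviations)
  next
    fix h :: "real \<Rightarrow> real"
    assume cls: "\<forall>m\<in>minima. \<forall>j\<in>{1..min_type G m}. (\<lambda>y. (deriv ^^ j) (L_fun (f y)) (\<beta> * J * m)) \<in> class_C T \<mu> (real j / real (min_type G m))"
      and h: "continuous_on UNIV h" and bnd: "bounded (range h)"
    obtain B where B: "\<And>s. \<bar>h s\<bar> \<le> B" using bnd by (auto simp: bounded_iff)
    show lim: "(\<lambda>n. gibbs_mean n h - wmean n h) \<longlonglongrightarrow> 0" by (rule asymptotics[OF cls h B])
    assume "\<exists>c>0. \<forall>\<^sub>F n in sequentially. c \<le> \<bar>wmean n h\<bar>"
    then show "asymp_equiv (\<lambda>n. gibbs_mean n h) sequentially (\<lambda>n. wmean n h)" by (rule equiv[OF lim])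
  next
    fix m
    assume cls: "\<forall>m\<in>minima. \<forall>j\<in>{1..min_type G m}. (\<lambda>y. (deriv ^^ j) (L_fun (f y)) (\<beta> * J * m)) \<in> class_C T \<mu> (real j / real (min_type G m))"
      and m: "minima = {m}"
    show "weak_conv_m Q (return borel m)"
    proof (rule integral_bdd_continuous_conv_imp_weak_conv)
      show "real_distribution (Q n)" for n
        by (rule real_distribution_mean_magnetization)
      show "real_distribution (return borel m)"
        by (simp add: real_distribution_def real_distribution_axioms_def prob_space_return)
      fix h :: "real \<Rightarrow> real"
      assume h: "\<And>s. isCont h s" and B: "\<And>s. \<bar>h s\<bar> \<le> 1"
      have hc: "continuous_on UNIV h" using h by (simp add: continuous_at_imp_continuous_on)
      have hm: "h \<in> borel_measurable borel" using hc by (rule borel_measurable_continuous_onI)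
      have eq: "(\<integral>s. h s \<partial>Q n) = gibbs_mean n h" for n
        by (simp only: integral_mean_magnetization[OF hm] integral_gibbs)
      have lim: "(\<lambda>n. gibbs_mean n h - wmean n h + h m) \<longlonglongrightarrow> 0 + h m"
        by (intro tendsto_add tendsto_const asymptotics[OF cls hc B])
      have "(\<lambda>n. \<integral>s. h s \<partial>Q n) \<longlonglongrightarrow> 0 + h m"
      \<comment> \<open>With a single minimum its weight cancels in the average; the weight is
        positive from \<open>n = 1\<close> on.\<close>
      proof (rule Lim_transform_eventually[OF lim], rule eventually_mono[OF eventually_ge_at_top[of 1]])
        fix n :: nat assume "1 \<le> n"
        then have "weight n m > 0" using b_weight_pos m by simp
        then show "gibbs_mean n h - wmean n h + h m = (\<integral>s. h s \<partial>Q n)"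
          by (simp add: eq m)
      qed
      moreover have "(\<integral>s. h s \<partial>return borel m) = h m" by (rule integral_return) (use hm in auto)
      ultimately show "(\<lambda>n. \<integral>s. h s \<partial>Q n) \<longlonglongrightarrow> (\<integral>s. h s \<partial>return borel m)"
        by simp
    qed
  qed
qed

end
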